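(* Let $R$ be a commutative Noetherian ring of prime characteristic $p$. Then tight closure commutes with localization in $R$ (i.e. for every ideal $I$ of $R$ and every multiplicative system $W\subseteq R$ one has $I^*R_W=(IR_W)^*$) in each of the following cases: (i) $\dim R<2$; (ii) $R$ is a two-dimensional local ring; (iii) $\dim R=2$ and either $R$ is a Nagata ring or $R$ possesses a $q'$-weak test element for some power $q'$ of $p$.
   Context: All rings are commutative Noetherian with identity of prime characteristic $p$; $q$ denotes a nonnegative power $p^e$ of $p$. $R^{\circ}$ is the set of elements of $R$ not in any minimal prime of $R$. For an ideal $I$, $I^{[q]}$ is the ideal generated by the $q$-th powers of elements of $I$. The tight closure $I^*$ of $I$ is the set of $x\in R$ for which there is $c\in R^{\circ}$ with $cx^q\in I^{[q]}$ for all $q\gg0$; for $R_W$ the tight closure $(IR_W)^*$ is taken in the ring $R_W$. For a power $q'$ of $p$, an element $c\in R^{\circ}$ is a $q'$-weak test element if for every ideal $I$ of $R$ and every $x\in I^*$ one has $cx^q\in I^{[q]}$ for all $q\ge q'$. *)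

theory Defs
  imports "HOL-Algebra.Algebra" "HOL-Library.Extended_Nat"
begin

definition char_p :: "('a, 'b) ring_scheme \<Rightarrow> nat \<Rightarrow> bool" where
  "char_p R p \<longleftrightarrow> Factorial_Ring.prime p \<and> add_pow R p \<one>\<^bsub>R\<^esub> = \<zero>\<^bsub>R\<^esub>"

definition minimal_prime :: "('a, 'b) ring_scheme \<Rightarrow> 'a set \<Rightarrow> bool" where
  "minimal_prime R P \<longleftrightarrow> primeideal P R \<and> (\<forall>Q. primeideal Q R \<and> Q \<subseteq> P \<longrightarrow> Q = P)"

definition ring_circ :: "('a, 'b) ring_scheme \<Rightarrow> 'a set" where
  "ring_circ R = carrier R - \<Union>{P. minimal_prime R P}"

definition frob_ideal :: "('a, 'b) ring_scheme \<Rightarrow> nat \<Rightarrow> 'a set \<Rightarrow> 'a set" where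
  "frob_ideal R q I = genideal R ((\<lambda>x. x [^]\<^bsub>R\<^esub> q) ` I)"

definition tight_closure :: "('a, 'b) ring_scheme \<Rightarrow> nat \<Rightarrow> 'a set \<Rightarrow> 'a set" where
  "tight_closure R p I =
     {x \<in> carrier R. \<exists>c \<in> ring_circ R. \<exists>e0. \<forall>e \<ge> e0.
        c \<otimes>\<^bsub>R\<^esub> (x [^]\<^bsub>R\<^esub> (p ^ e)) \<in> frob_ideal R (p ^ e) I}"

definition weak_test_element :: "('a, 'b) ring_scheme \<Rightarrow> nat \<Rightarrow> nat \<Rightarrow> 'a \<Rightarrow> bool" where
  "weak_test_element R p q' c \<longleftrightarrow> c \<in> ring_circ R \<and>
     (\<forall>I. ideal I R \<longrightarrow> (\<forall>x \<in> tight_closure R p I. \<forall>e. p ^ e \<ge> q' \<longrightarrow>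
        c \<otimes>\<^bsub>R\<^esub> (x [^]\<^bsub>R\<^esub> (p ^ e)) \<in> frob_ideal R (p ^ e) I))"

definition mult_system :: "('a, 'b) ring_scheme \<Rightarrow> 'a set \<Rightarrow> bool" where
  "mult_system R W \<longleftrightarrow> W \<subseteq> carrier R \<and> \<one>\<^bsub>R\<^esub> \<in> W \<and> (\<forall>a \<in> W. \<forall>b \<in> W. a \<otimes>\<^bsub>R\<^esub> b \<in> W)"

definition loc_rel :: "('a, 'b) ring_scheme \<Rightarrow> 'a set \<Rightarrow> (('a \<times> 'a) \<times> ('a \<times> 'a)) set" where
  "loc_rel R W = {((r, s), (r', s')). r \<in> carrier R \<and> s \<in> W \<and> r' \<in> carrier R \<and> s' \<in> W \<and>
      (\<exists>u \<in> W. u \<otimes>\<^bsub>R\<^esub> ((r \<otimes>\<^bsub>R\<^esub> s') \<ominus>\<^bsub>R\<^esub> (r' \<otimes>\<^bsub>R\<^esub> s)) = \<zero>\<^bsub>R\<^esub>)}"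

definition loc_frac :: "('a, 'b) ring_scheme \<Rightarrow> 'a set \<Rightarrow> 'a \<Rightarrow> 'a \<Rightarrow> ('a \<times> 'a) set" where
  "loc_frac R W r s = loc_rel R W `` {(r, s)}"

definition localization :: "('a, 'b) ring_scheme \<Rightarrow> 'a set \<Rightarrow> ('a \<times> 'a) set ring" where
  "localization R W =
    \<lparr>carrier = (carrier R \<times> W) // loc_rel R W,
     monoid.mult = (\<lambda>A B. \<Union>{loc_frac R W (r \<otimes>\<^bsub>R\<^esub> r') (s \<otimes>\<^bsub>R\<^esub> s') | r s r' s'. (r, s) \<in> A \<and> (r', s') \<in> B}),
     monoid.one = loc_frac R W \<one>\<^bsub>R\<^esub> \<one>\<^bsub>R\<^esub>,
     ring.zero = loc_frac R W \<zero>\<^bsub>R\<^esub> \<one>\<^bsub>R\<^esub>,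
     ring.add = (\<lambda>A B. \<Union>{loc_frac R W ((r \<otimes>\<^bsub>R\<^esub> s') \<oplus>\<^bsub>R\<^esub> (r' \<otimes>\<^bsub>R\<^esub> s)) (s \<otimes>\<^bsub>R\<^esub> s') | r s r' s'. (r, s) \<in> A \<and> (r', s') \<in> B})\<rparr>"

definition loc_map :: "('a, 'b) ring_scheme \<Rightarrow> 'a set \<Rightarrow> 'a \<Rightarrow> ('a \<times> 'a) set" where
  "loc_map R W r = loc_frac R W r \<one>\<^bsub>R\<^esub>"

definition ext_ideal :: "('a, 'b) ring_scheme \<Rightarrow> 'a set \<Rightarrow> 'a set \<Rightarrow> ('a \<times> 'a) set set" where
  "ext_ideal R W J = genideal (localization R W) (loc_map R W ` J)"

definition prime_chain :: "('a, 'b) ring_scheme \<Rightarrow> nat \<Rightarrow> bool" where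
  "prime_chain R n \<longleftrightarrow> (\<exists>Ps :: nat \<Rightarrow> 'a set. (\<forall>i \<le> n. primeideal (Ps i) R) \<and> (\<forall>i < n. Ps i \<subset> Ps (Suc i)))"

definition krull_dim :: "('a, 'b) ring_scheme \<Rightarrow> enat" where
  "krull_dim R = (SUP n \<in> {n. prime_chain R n}. enat n)"

definition local_ring :: "('a, 'b) ring_scheme \<Rightarrow> bool" where
  "local_ring R \<longleftrightarrow> (\<exists>!M. maximalideal M R)"

definition integral_closure_in :: "('c, 'd) ring_scheme \<Rightarrow> 'c set \<Rightarrow> 'c set" where
  "integral_closure_in L S = {x \<in> carrier L. \<exists>(n::nat) (a::nat \<Rightarrow> 'c). (\<forall>i. a i \<in> S) \<and>
      (x [^]\<^bsub>L\<^esub> n) \<oplus>\<^bsub>L\<^esub> finsum L (\<lambda>i. a i \<otimes>\<^bsub>L\<^esub> (x [^]\<^bsub>L\<^esub> i)) {..<n} = \<zero>\<^bsub>L\<^esub>}"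

definition fin_gen_over :: "('c, 'd) ring_scheme \<Rightarrow> 'c set \<Rightarrow> 'c set \<Rightarrow> bool" where
  "fin_gen_over L S C \<longleftrightarrow> (\<exists>G. finite G \<and> G \<subseteq> C \<and>
      C = {finsum L (\<lambda>g. a g \<otimes>\<^bsub>L\<^esub> g) G | a. a \<in> G \<rightarrow> S})"

text \<open>Japanese (N-2) domain D: for every finite field extension L of the fraction field K
  of D, the integral closure of D in L is a finite D-module. Finite extensions of K are
  represented (up to isomorphism) by fields whose carrier lies in the type nat => K.\<close>
definition japanese :: "('a, 'b) ring_scheme \<Rightarrow> bool" where
  "japanese D \<longleftrightarrow>
    (\<forall>(L :: (nat \<Rightarrow> ('a \<times> 'a) set) ring) \<phi>.
       field L \<and> \<phi> \<in> ring_hom (localization D (carrier D - {\<zero>\<^bsub>D\<^esub>})) L \<and>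
       ring.finite_dimension L (\<phi> ` carrier (localization D (carrier D - {\<zero>\<^bsub>D\<^esub>}))) (carrier L) \<longrightarrow>
       fin_gen_over L ((\<phi> \<circ> loc_map D (carrier D - {\<zero>\<^bsub>D\<^esub>})) ` carrier D)
         (integral_closure_in L ((\<phi> \<circ> loc_map D (carrier D - {\<zero>\<^bsub>D\<^esub>})) ` carrier D)))"

definition nagata_ring :: "('a, 'b) ring_scheme \<Rightarrow> bool" where
  "nagata_ring R \<longleftrightarrow> noetherian_ring R \<and> (\<forall>P. primeideal P R \<longrightarrow> japanese (R Quot P))"

end

theory Submission
  imports Defs
begin

text \<open>
  Write \<open>q = p\<^sup>e\<close>. If \<open>x/1\<close> is in the tight closure of \<open>I R\<^sub>W\<close>, then \<open>w\<^sub>q c x\<^sup>q \<in> I\<^sup>[\<^sup>q\<^sup>]\<close> for large \<open>q\<close>, where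
  \<open>w\<^sub>q \<in> W\<close> depends on \<open>q\<close>; the point is to remove this dependence. Put \<open>J = (I\<^sup>* : x)\<close>, let \<open>J'\<close> be its
  \<open>W\<close>-saturation, and choose \<open>v \<in> W\<close> with \<open>v J' \<subseteq> J\<close>.

  Suppose that every prime containing \<open>J\<close> and disjoint from \<open>W\<close> is maximal. Then every maximal ideal above \<open>J'\<close>
  is disjoint from \<open>W\<close>. Some \<open>d \<in> R\<^sup>\<circ>\<close> satisfies \<open>d (v x y)\<^sup>q \<in> I\<^sup>[\<^sup>q\<^sup>]\<close> for large \<open>q\<close> and all \<open>y\<close> in a finite
  generating set of \<open>J'\<close>. So \<open>(I\<^sup>[\<^sup>q\<^sup>] : c d (v x)\<^sup>q)\<close> contains \<open>w\<^sub>q\<close> and all these \<open>y\<^sup>q\<close>, hence lies in no maximal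
  ideal, and \<open>c d (v x)\<^sup>q \<in> I\<^sup>[\<^sup>q\<^sup>]\<close>.

  The supposition holds because \<open>dim R \<le> 2\<close>: a non-maximal prime \<open>Q\<close> disjoint from \<open>W\<close> has height at most one,
  and it cannot contain \<open>J\<close> since \<open>f x \<in> I\<^sup>*\<close> for some \<open>f\<close> outside \<open>Q\<close>. This may be tested modulo each minimal
  prime \<open>P\<close> below \<open>Q\<close>. By Akizuki's argument every element of the fraction field of \<open>R/P\<close> satisfies a
  polynomial relation with a coefficient outside \<open>Q\<close>, so finitely generated fractional ideals are invertible over
  the integral closure \<open>V\<close> of \<open>(R/P)\<^sub>Q\<close>. Write \<open>1 = \<Sum> h\<^sub>\<alpha> \<alpha>\<close> with \<open>\<alpha> \<in> I\<close> and \<open>h\<^sub>\<alpha> I \<subseteq> V\<close>. The powers of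
  \<open>h\<^sub>\<alpha> x\<close> have a common denominator up to multiples outside \<open>Q\<close>, so \<open>h\<^sub>\<alpha> x \<in> V\<close>, which puts \<open>x = \<Sum> (h\<^sub>\<alpha> x) \<alpha>\<close> in
  \<open>I V\<close>; this descends to \<open>R/P\<close> after multiplication by some \<open>f\<close> outside \<open>Q\<close>.
\<close>

no_notation Sum_Type.Plus (infixr \<open><+>\<close> 65)

section \<open>Submodules over a subring\<close>

context cring
begin

text \<open>\<open>subalgebra D M R\<close> is the library's way of saying that \<open>M\<close> is a \<open>D\<close>-submodule of \<open>R\<close>; the ideals of
  \<open>R\<close> are the case \<open>D = carrier R\<close>.\<close>

lemma subalgebraI:
  assumes D: "subring D R" and "M \<subseteq> carrier R" "\<zero> \<in> M"
    and "\<And>a b. a \<in> M \<Longrightarrow> b \<in> M \<Longrightarrow> a \<oplus> b \<in> M"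
    and smult: "\<And>d m. d \<in> D \<Longrightarrow> m \<in> M \<Longrightarrow> d \<otimes> m \<in> M"
  shows "subalgebra D M R"
proof (intro subalgebra.intro subalgebra_axioms.intro smult)
  show "subgroup M (add_monoid R)"
  proof (rule add.subgroupI)
    fix a assume "a \<in> M"
    then have "(\<ominus> \<one>) \<otimes> a \<in> M" using smult subringE(3,5)[OF D] by blast
    then show "\<ominus> a \<in> M" using \<open>a \<in> M\<close> assms(2) by (auto simp: l_minus)
  qed (use assms in auto)
qed auto

lemma
  assumes "subalgebra D M R"
  shows subalgebra_zero: "\<zero> \<in> M"
    and subalgebra_add: "\<And>a b. a \<in> M \<Longrightarrow> b \<in> M \<Longrightarrow> a \<oplus> b \<in> M"
    and subalgebra_minus: "\<And>a b. a \<in> M \<Longrightarrow> b \<in> M \<Longrightarrow> a \<ominus> b \<in> M"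
proof -
  interpret subalgebra D M R by fact
  show "\<zero> \<in> M" using one_closed by simp
  show "a \<oplus> b \<in> M" if "a \<in> M" "b \<in> M" for a b using m_closed that by simp
  then show "a \<ominus> b \<in> M" if "a \<in> M" "b \<in> M" for a b
    using that m_inv_closed[of b] by (simp add: a_minus_def a_inv_def)
qed

lemma subalgebra_finsum:
  assumes M: "subalgebra D M R" and "f \<in> A \<rightarrow> M" shows "(\<Oplus>a\<in>A. f a) \<in> M"
  using assms(2)
proof (induction A rule: infinite_finite_induct)
  case (insert a A)
  then have "f \<in> A \<rightarrow> carrier R" "f a \<in> carrier R" using subalgebra_in_carrier[OF M] by auto
  then show ?case using insert subalgebra_add[OF M] by simp
qed (simp_all add: subalgebra_zero[OF M])

lemma subring_is_subalgebra:
  assumes "subring D R" shows "subalgebra D D R"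
  using subringE[OF assms] by (intro subalgebraI assms) auto

lemma subring_pow_closed: "subring D R \<Longrightarrow> d \<in> D \<Longrightarrow> d [^] (n::nat) \<in> D"
  by (induction n) (simp_all add: subringE)

lemma ideal_iff_subalgebra: "ideal J R \<longleftrightarrow> subalgebra (carrier R) J R"
proof
  assume "subalgebra (carrier R) J R"
  then interpret subalgebra "carrier R" J R .
  have "J \<subseteq> carrier R" using subset by simp
  show "ideal J R"
  proof (rule idealI[OF ring_axioms subgroup_axioms])
    fix a x assume "a \<in> J" "x \<in> carrier R"
    then show "x \<otimes> a \<in> J" by (intro smult_closed)
    moreover have "a \<in> carrier R" using \<open>a \<in> J\<close> \<open>J \<subseteq> carrier R\<close> by auto
    ultimately show "a \<otimes> x \<in> J" using \<open>x \<in> carrier R\<close> by (simp add: m_comm)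
  qed
qed (rule ideal_is_subalgebra[OF subset_refl])

lemma
  assumes "ideal J R"
  shows ideal_subset: "J \<subseteq> carrier R"
    and ideal_zero: "\<zero> \<in> J"
    and ideal_add: "\<And>a b. a \<in> J \<Longrightarrow> b \<in> J \<Longrightarrow> a \<oplus> b \<in> J"
    and ideal_minus: "\<And>a b. a \<in> J \<Longrightarrow> b \<in> J \<Longrightarrow> a \<ominus> b \<in> J"
  using assms subalgebra_in_carrier subalgebra_zero subalgebra_add subalgebra_minus
  unfolding ideal_iff_subalgebra by auto

lemma ideal_pow_mem:
  assumes "ideal J R" "a \<in> J" "0 < n" shows "a [^] (n::nat) \<in> J"
proof -
  obtain m where "n = Suc m" using assms(3) gr0_implies_Suc by blast
  then show ?thesis using assms ideal_subset ideal.I_l_closed[OF assms(1,2), of "a [^] m"] by auto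
qed

lemma mult_image_subalgebra:
  assumes D: "subring D R" and M: "subalgebra D M R" and c: "c \<in> carrier R"
  shows "subalgebra D ((\<otimes>) c ` M) R"
proof (rule subalgebraI[OF D])
  note sub = subsetD[OF subalgebra_in_carrier[OF M]]
  show "(\<otimes>) c ` M \<subseteq> carrier R" using sub c by auto
  show "\<zero> \<in> (\<otimes>) c ` M" using subalgebra_zero[OF M] c by (intro image_eqI[of _ _ \<zero>]) auto
  fix a b assume "a \<in> (\<otimes>) c ` M" "b \<in> (\<otimes>) c ` M"
  then obtain m n where "m \<in> M" "n \<in> M" "a = c \<otimes> m" "b = c \<otimes> n" by auto
  then show "a \<oplus> b \<in> (\<otimes>) c ` M"
    using subalgebra_add[OF M, of m n] sub c by (intro image_eqI[of _ _ "m \<oplus> n"]) (auto simp: r_distr)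
next
  fix d a assume d: "d \<in> D" and "a \<in> (\<otimes>) c ` M"
  then obtain m where "m \<in> M" "a = c \<otimes> m" by auto
  then show "d \<otimes> a \<in> (\<otimes>) c ` M"
    using subalgebra.smult_closed[OF M d, of m] subalgebra_in_carrier[OF M] subringE(1)[OF D] d c
    by (intro image_eqI[of _ _ "d \<otimes> m"]) (auto simp: m_lcomm subset_iff)
qed

lemma set_add_memI: "a \<in> M \<Longrightarrow> b \<in> N \<Longrightarrow> a \<oplus> b \<in> M <+> N"
  by (auto simp: set_add_def')

lemma set_add_memE:
  assumes "x \<in> M <+> N"
  obtains a b where "a \<in> M" "b \<in> N" "x = a \<oplus> b"
  using assms by (auto simp: set_add_def')

lemma set_add_subalgebra:
  assumes D: "subring D R" and M: "subalgebra D M R" and N: "subalgebra D N R"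
  shows "subalgebra D (M <+> N) R"
proof (rule subalgebraI[OF D])
  note sub = subsetD[OF subalgebra_in_carrier[OF M]] subsetD[OF subalgebra_in_carrier[OF N]]
  show "M <+> N \<subseteq> carrier R" by (rule set_add_closed) (use sub in auto)
  show "\<zero> \<in> M <+> N"
    using set_add_memI[OF subalgebra_zero[OF M] subalgebra_zero[OF N]] by simp
  fix a b assume "a \<in> M <+> N" "b \<in> M <+> N"
  then obtain m n m' n' where summands: "m \<in> M" "n \<in> N" "a = m \<oplus> n" "m' \<in> M" "n' \<in> N" "b = m' \<oplus> n'"
    by (elim set_add_memE)
  then have "a \<oplus> b = (m \<oplus> m') \<oplus> (n \<oplus> n')" using sub by (simp add: a_ac)
  then show "a \<oplus> b \<in> M <+> N"
    using summands subalgebra_add[OF M] subalgebra_add[OF N] by (simp add: set_add_memI)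
next
  fix d a assume d: "d \<in> D" and "a \<in> M <+> N"
  then obtain m n where mn: "m \<in> M" "n \<in> N" "a = m \<oplus> n" by (elim set_add_memE)
  then have "d \<otimes> a = d \<otimes> m \<oplus> d \<otimes> n"
    using d subringE(1)[OF D] subalgebra_in_carrier[OF M] subalgebra_in_carrier[OF N]
    by (auto simp: r_distr subset_iff)
  then show "d \<otimes> a \<in> M <+> N"
    using mn d subalgebra.smult_closed[OF M] subalgebra.smult_closed[OF N] by (simp add: set_add_memI)
qed

lemma
  assumes M: "subalgebra D M R" and N: "subalgebra D N R"
  shows set_add_upper1: "M \<subseteq> M <+> N" and set_add_upper2: "N \<subseteq> M <+> N"
proof -
  have "m \<in> M <+> N" if "m \<in> M" for m
    using set_add_memI[OF that subalgebra_zero[OF N]] that subalgebra_in_carrier[OF M] by auto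
  then show "M \<subseteq> M <+> N" by auto
  have "n \<in> M <+> N" if "n \<in> N" for n
    using set_add_memI[OF subalgebra_zero[OF M] that] that subalgebra_in_carrier[OF N] by auto
  then show "N \<subseteq> M <+> N" by auto
qed

lemma set_add_mono: "M \<subseteq> M' \<Longrightarrow> N \<subseteq> N' \<Longrightarrow> M <+> N \<subseteq> M' <+> N'"
  by (auto simp: set_add_def')

lemma set_add_least:
  assumes "subalgebra D L R" "M \<subseteq> L" "N \<subseteq> L" shows "M <+> N \<subseteq> L"
  using assms by (blast intro: subalgebra_add elim: set_add_memE)

lemma
  assumes J: "ideal J R" and x: "x \<in> carrier R"
  shows add_cgenideal: "ideal (J <+> PIdl x) R"
    and add_cgenideal_upper: "J \<subseteq> J <+> PIdl x" "x \<in> J <+> PIdl x"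
proof -
  note PIdl = cgenideal_ideal[OF x]
  show "ideal (J <+> PIdl x) R" by (rule add_ideals[OF J PIdl])
  show "J \<subseteq> J <+> PIdl x" "x \<in> J <+> PIdl x"
    using set_add_upper1 set_add_upper2 cgenideal_self[OF x] J PIdl
    unfolding ideal_iff_subalgebra by blast+
qed

end

subsection \<open>Colons and saturations\<close>

definition colon :: "('a, 'b) ring_scheme \<Rightarrow> 'a set \<Rightarrow> 'a \<Rightarrow> 'a set" where
  "colon R M x = {r \<in> carrier R. r \<otimes>\<^bsub>R\<^esub> x \<in> M}"

text \<open>For an ideal \<open>J\<close> this is the contraction of \<open>J R\<^sub>W\<close> to \<open>R\<close>; for a subring it is its ring of
  fractions with denominators in \<open>W\<close>, formed inside \<open>R\<close>.\<close>

definition saturation :: "('a, 'b) ring_scheme \<Rightarrow> 'a set \<Rightarrow> 'a set \<Rightarrow> 'a set" where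
  "saturation R W M = {r \<in> carrier R. \<exists>w \<in> W. w \<otimes>\<^bsub>R\<^esub> r \<in> M}"

lemma saturationI: "r \<in> carrier R \<Longrightarrow> w \<in> W \<Longrightarrow> w \<otimes>\<^bsub>R\<^esub> r \<in> M \<Longrightarrow> r \<in> saturation R W M"
  by (auto simp: saturation_def)

lemma saturationE:
  assumes "r \<in> saturation R W M"
  obtains w where "r \<in> carrier R" "w \<in> W" "w \<otimes>\<^bsub>R\<^esub> r \<in> M"
  using assms by (auto simp: saturation_def)

lemma saturation_mono: "M \<subseteq> N \<Longrightarrow> saturation R W M \<subseteq> saturation R W N"
  by (auto simp: saturation_def)

lemma saturation_mono_system: "V \<subseteq> W \<Longrightarrow> saturation R V M \<subseteq> saturation R W M"
  by (auto simp: saturation_def)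

context cring
begin

lemma
  assumes "mult_system R W"
  shows mult_system_subset: "W \<subseteq> carrier R"
    and mult_system_one: "\<one> \<in> W"
    and mult_system_mult: "\<And>v w. v \<in> W \<Longrightarrow> w \<in> W \<Longrightarrow> v \<otimes> w \<in> W"
  using assms by (auto simp: mult_system_def)

lemma mult_system_pow: "mult_system R W \<Longrightarrow> w \<in> W \<Longrightarrow> w [^] (n::nat) \<in> W"
  by (induction n) (simp_all add: mult_system_one mult_system_mult)

lemma colon_subalgebra:
  assumes D: "subring D R" and M: "subalgebra D M R" and x: "x \<in> carrier R"
  shows "subalgebra D (colon R M x) R"
proof (rule subalgebraI[OF D])
  show "\<zero> \<in> colon R M x" using subalgebra_zero[OF M] x by (simp add: colon_def)
  show "a \<oplus> b \<in> colon R M x" if "a \<in> colon R M x" "b \<in> colon R M x" for a b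
    using that x by (auto simp: colon_def l_distr subalgebra_add[OF M])
  show "d \<otimes> a \<in> colon R M x" if "d \<in> D" "a \<in> colon R M x" for d a
    using that x subringE(1)[OF D] subalgebra.smult_closed[OF M] by (auto simp: colon_def m_assoc)
qed (auto simp: colon_def)

lemma colon_ideal: "ideal J R \<Longrightarrow> x \<in> carrier R \<Longrightarrow> ideal (colon R J x) R"
  unfolding ideal_iff_subalgebra by (rule colon_subalgebra[OF carrier_is_subring])

lemma colon_superset: "ideal J R \<Longrightarrow> x \<in> carrier R \<Longrightarrow> J \<subseteq> colon R J x"
  unfolding colon_def using ideal_subset by (auto intro: ideal.I_r_closed)

lemma saturation_subalgebra:
  assumes D: "subring D R" and M: "subalgebra D M R" and W: "mult_system R W" "W \<subseteq> D"
  shows "subalgebra D (saturation R W M) R"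
proof (rule subalgebraI[OF D])
  note smult = subalgebra.smult_closed[OF M]
  note carriers = subsetD[OF subringE(1)[OF D]] subsetD[OF mult_system_subset[OF W(1)]]
  show "saturation R W M \<subseteq> carrier R" by (auto simp: saturation_def)
  show "\<zero> \<in> saturation R W M"
    using subalgebra_zero[OF M] mult_system_one[OF W(1)] by (intro saturationI[of _ _ \<one>]) auto
  fix a b assume "a \<in> saturation R W M" "b \<in> saturation R W M"
  then obtain v w where vw: "v \<in> W" "w \<in> W" "v \<otimes> a \<in> M" "w \<otimes> b \<in> M" "a \<in> carrier R" "b \<in> carrier R"
    by (elim saturationE)
  then have "(v \<otimes> w) \<otimes> (a \<oplus> b) = w \<otimes> (v \<otimes> a) \<oplus> v \<otimes> (w \<otimes> b)"
    using carriers by (simp add: r_distr m_ac)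
  also have "\<dots> \<in> M" by (rule subalgebra_add[OF M smult smult]) (use vw W(2) in auto)
  finally show "a \<oplus> b \<in> saturation R W M"
    using vw by (intro saturationI[OF _ mult_system_mult[OF W(1) vw(1,2)]]) auto
next
  note carriers = subsetD[OF subringE(1)[OF D]] subsetD[OF mult_system_subset[OF W(1)]]
  fix d a assume d: "d \<in> D" and "a \<in> saturation R W M"
  then obtain w where w: "w \<in> W" "w \<otimes> a \<in> M" "a \<in> carrier R" by (elim saturationE)
  then have "w \<otimes> (d \<otimes> a) = d \<otimes> (w \<otimes> a)" using carriers d by (simp add: m_lcomm)
  then show "d \<otimes> a \<in> saturation R W M"
    using w d carriers subalgebra.smult_closed[OF M d w(2)] by (intro saturationI[OF _ w(1)]) auto
qed

lemma saturation_ideal: "ideal J R \<Longrightarrow> mult_system R W \<Longrightarrow> ideal (saturation R W J) R"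
  unfolding ideal_iff_subalgebra
  by (intro saturation_subalgebra carrier_is_subring mult_system_subset)

lemma saturation_upper: "mult_system R W \<Longrightarrow> M \<subseteq> carrier R \<Longrightarrow> M \<subseteq> saturation R W M"
  using mult_system_one by (auto intro!: saturationI[of _ _ \<one>])

lemma saturation_saturation:
  assumes W: "mult_system R W" shows "saturation R W (saturation R W M) \<subseteq> saturation R W M"
proof
  fix r assume "r \<in> saturation R W (saturation R W M)"
  then obtain v w where vw: "r \<in> carrier R" "v \<in> W" "w \<in> W" "w \<otimes> (v \<otimes> r) \<in> M"
    by (elim saturationE)
  moreover have "w \<otimes> (v \<otimes> r) = (w \<otimes> v) \<otimes> r"
    using vw subsetD[OF mult_system_subset[OF W]] by (simp add: m_assoc)
  ultimately show "r \<in> saturation R W M" by (intro saturationI[OF _ mult_system_mult[OF W]]) auto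
qed

lemma saturation_subring:
  assumes D: "subring D R" and W: "mult_system R W" "W \<subseteq> D" shows "subring (saturation R W D) R"
proof (rule subringI)
  note sat = saturation_subalgebra[OF D subring_is_subalgebra[OF D] W]
  have carriers: "\<And>w. w \<in> W \<Longrightarrow> w \<in> carrier R" using W subringE(1)[OF D] by auto
  show "saturation R W D \<subseteq> carrier R" by (auto simp: saturation_def)
  show "\<one> \<in> saturation R W D" using saturation_upper[OF W(1) subringE(1)[OF D]] subringE(3)[OF D] by auto
  show "\<ominus> a \<in> saturation R W D" if "a \<in> saturation R W D" for a
    using subalgebra_minus[OF sat subalgebra_zero[OF sat] that] that by (simp add: a_minus_def saturation_def)
  show "a \<oplus> b \<in> saturation R W D" if "a \<in> saturation R W D" "b \<in> saturation R W D" for a b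
    by (rule subalgebra_add[OF sat that])
  show "a \<otimes> b \<in> saturation R W D" if ab: "a \<in> saturation R W D" "b \<in> saturation R W D" for a b
  proof -
    obtain v w where vw: "v \<in> W" "w \<in> W" "v \<otimes> a \<in> D" "w \<otimes> b \<in> D" "a \<in> carrier R" "b \<in> carrier R"
      using ab by (elim saturationE)
    then have "(v \<otimes> w) \<otimes> (a \<otimes> b) = (v \<otimes> a) \<otimes> (w \<otimes> b)" using carriers by (simp add: m_ac)
    then show ?thesis
      using vw subringE(6)[OF D vw(3,4)] by (intro saturationI[OF _ mult_system_mult[OF W(1) vw(1,2)]]) auto
  qed
qed

lemma mult_system_meets_family:
  assumes S: "mult_system R S" "S \<subseteq> D" and "finite A"
    and "\<And>i. i \<in> A \<Longrightarrow> subalgebra D (J i) R" and "\<And>i. i \<in> A \<Longrightarrow> J i \<inter> S \<noteq> {}"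
  shows "\<exists>s \<in> S. \<forall>i \<in> A. s \<in> J i"
  using assms(3-5)
proof (induction A rule: finite_induct)
  case empty
  then show ?case using mult_system_one[OF S(1)] by auto
next
  case (insert i A)
  obtain s where s: "s \<in> S" "\<forall>j \<in> A. s \<in> J j" using insert by auto
  obtain t where t: "t \<in> S" "t \<in> J i" using insert.prems(2) by auto
  have commute: "s \<otimes> t = t \<otimes> s" using m_comm[of s t] s t mult_system_subset[OF S(1)] by auto
  have "s \<otimes> t \<in> J j" if "j \<in> insert i A" for j
  proof (cases "j = i")
    case True
    then show ?thesis using subalgebra.smult_closed[OF insert.prems(1)[OF that], of s t] s t S(2) by auto
  next
    case False
    then show ?thesis
      using subalgebra.smult_closed[OF insert.prems(1)[OF that], of t s] s t S(2) that commute by auto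
  qed
  then show ?case using mult_system_mult[OF S(1) s(1) t(1)] by auto
qed

lemma mult_system_meets_ideals:
  assumes S: "mult_system R S" and "finite A"
    and "\<And>i. i \<in> A \<Longrightarrow> ideal (J i) R" and "\<And>i. i \<in> A \<Longrightarrow> J i \<inter> S \<noteq> {}"
  shows "\<exists>s \<in> S. \<forall>i \<in> A. s \<in> J i"
  using assms(2-) unfolding ideal_iff_subalgebra
  by (intro mult_system_meets_family[OF S mult_system_subset[OF S]])

end

section \<open>Prime ideals of Noetherian rings\<close>

definition nilradical :: "('a, 'b) ring_scheme \<Rightarrow> 'a set" where
  "nilradical R = {x \<in> carrier R. \<exists>n::nat. x [^]\<^bsub>R\<^esub> n = \<zero>\<^bsub>R\<^esub>}"

context cring
begin

lemma prime_mult_notin: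
  "primeideal P R \<Longrightarrow> a \<in> carrier R \<Longrightarrow> b \<in> carrier R \<Longrightarrow> a \<notin> P \<Longrightarrow> b \<notin> P \<Longrightarrow> a \<otimes> b \<notin> P"
  by (auto dest: primeideal.I_prime)

lemma prime_one_notin: "primeideal P R \<Longrightarrow> \<one> \<notin> P"
  by (metis primeideal.I_notcarr ideal.one_imp_carrier primeideal.axioms(1))

lemma prime_pow_notin:
  "primeideal P R \<Longrightarrow> a \<in> carrier R \<Longrightarrow> a \<notin> P \<Longrightarrow> a [^] (n::nat) \<notin> P"
  by (induction n) (simp_all add: prime_one_notin prime_mult_notin)

lemma prime_complement_mult_system: "primeideal P R \<Longrightarrow> mult_system R (carrier R - P)"
  unfolding mult_system_def using prime_one_notin prime_mult_notin by auto

lemma saturation_prime_complement: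
  assumes J: "ideal J R" and "\<not> J \<subseteq> Q" shows "saturation R (carrier R - Q) J = carrier R"
proof -
  obtain t where t: "t \<in> J" "t \<notin> Q" using assms(2) by auto
  then have "r \<in> saturation R (carrier R - Q) J" if "r \<in> carrier R" for r
    using ideal.I_r_closed[OF J t(1) that] ideal_subset[OF J] that by (intro saturationI[of _ _ t]) auto
  then show ?thesis by (auto elim: saturationE)
qed

lemma saturation_subset_prime:
  assumes Q: "primeideal Q R" and "W \<subseteq> carrier R - Q" "J \<subseteq> Q" shows "saturation R W J \<subseteq> Q"
proof
  fix r assume "r \<in> saturation R W J"
  then obtain w where "r \<in> carrier R" "w \<in> W" "w \<otimes> r \<in> J" by (elim saturationE)
  then show "r \<in> Q" using prime_mult_notin[OF Q, of w r] assms(2,3) by auto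
qed

lemma prime_above_product:
  assumes Q: "primeideal Q R" "J \<subseteq> Q" and xy: "x \<in> carrier R" "y \<in> carrier R" "x \<otimes> y \<in> J"
  shows "J <+> PIdl x \<subseteq> Q \<or> J <+> PIdl y \<subseteq> Q"
proof -
  note Q_ideal = primeideal.axioms(1)[OF Q(1)]
  have "x \<in> Q \<or> y \<in> Q" using primeideal.I_prime[OF Q(1) xy(1,2)] Q(2) xy(3) by auto
  then show ?thesis
    using set_add_least[OF Q_ideal[unfolded ideal_iff_subalgebra] Q(2)] cgenideal_minimal[OF Q_ideal] by blast
qed

lemma ideal_add_mem_iff:
  assumes J: "ideal J R" and "a \<in> J" "b \<in> carrier R" shows "a \<oplus> b \<in> J \<longleftrightarrow> b \<in> J"
proof
  assume "a \<oplus> b \<in> J"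
  then have "(a \<oplus> b) \<ominus> a \<in> J" using assms(2) by (rule ideal_minus[OF J])
  moreover have "a \<in> carrier R" using ideal_subset[OF J] assms(2) by auto
  then have "(a \<oplus> b) \<ominus> a = b" using assms(3) by algebra
  ultimately show "b \<in> J" by simp
qed (use assms ideal_add in auto)

lemma prime_avoidance:
  assumes "finite F" and "\<And>P. P \<in> F \<Longrightarrow> primeideal P R" and J: "ideal J R" and "\<And>P. P \<in> F \<Longrightarrow> \<not> J \<subseteq> P"
  shows "\<exists>x \<in> J. \<forall>P \<in> F. x \<notin> P"
  using assms(1,2,4)
proof (induction F rule: finite_psubset_induct)
  case (psubset F)
  have avoid_smaller: "\<exists>x \<in> J. \<forall>P' \<in> F - {P}. x \<notin> P'" if "P \<in> F" for P
    by (rule psubset.IH) (use that psubset.prems in auto)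
  consider (empty) "F = {}" | (redundant) P P' where "P \<in> F" "P' \<in> F" "P \<noteq> P'" "P \<subseteq> P'"
    | (minimal) P where "P \<in> F" "\<And>P'. P' \<in> F - {P} \<Longrightarrow> \<not> P' \<subseteq> P" by blast
  then show ?case
  proof cases
    case empty
    then show ?thesis using ideal_zero[OF J] by auto
  next
    case (redundant P P')
    then show ?thesis using avoid_smaller[of P] by blast
  next
    case (minimal P)
    note primes = psubset.prems(1) and ideals = primeideal.axioms(1)[OF psubset.prems(1)]
    obtain x where x: "x \<in> J" "\<And>P'. P' \<in> F - {P} \<Longrightarrow> x \<notin> P'" using avoid_smaller[OF minimal(1)] by auto
    have "\<exists>y \<in> carrier R - P. \<forall>I \<in> insert J (F - {P}). y \<in> I"
    proof (rule mult_system_meets_ideals[OF prime_complement_mult_system[OF primes[OF minimal(1)]]])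
      fix I assume I: "I \<in> insert J (F - {P})"
      then show "ideal I R" using J ideals by auto
      have "\<not> I \<subseteq> P" using I minimal psubset.prems(2) by auto
      then show "I \<inter> (carrier R - P) \<noteq> {}" using ideal_subset[OF \<open>ideal I R\<close>] by auto
    qed (use psubset.hyps in simp)
    then obtain y where y: "y \<in> carrier R" "y \<notin> P" "y \<in> J" "\<And>P'. P' \<in> F - {P} \<Longrightarrow> y \<in> P'" by auto
    have "x \<in> carrier R" using x(1) ideal_subset[OF J] by auto
    show ?thesis
    proof (cases "x \<in> P")
      case True
      then have "x \<oplus> y \<notin> P" using ideal_add_mem_iff[OF ideals[OF minimal(1)]] y by auto
      moreover have "x \<oplus> y \<notin> P'" if "P' \<in> F - {P}" for P'
        using ideal_add_mem_iff[OF ideals, of P' y x] that x(2) y \<open>x \<in> carrier R\<close> a_comm by auto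
      ultimately show ?thesis using ideal_add[OF J x(1) y(3)] by blast
    qed (use x in blast)
  qed
qed

lemma minimal_prime_prime: "minimal_prime R P \<Longrightarrow> primeideal P R"
  by (simp add: minimal_prime_def)

lemma minimal_prime_ideal: "minimal_prime R P \<Longrightarrow> ideal P R"
  by (rule primeideal.axioms(1)[OF minimal_prime_prime])

lemma ring_circ_iff: "c \<in> ring_circ R \<longleftrightarrow> c \<in> carrier R \<and> (\<forall>P. minimal_prime R P \<longrightarrow> c \<notin> P)"
  by (auto simp: ring_circ_def)

lemma ring_circ_mult_system: "mult_system R (ring_circ R)"
  unfolding mult_system_def
  by (auto simp: ring_circ_iff prime_one_notin minimal_prime_prime prime_mult_notin)

lemma power_mult_system:
  assumes "x \<in> carrier R" shows "mult_system R (range (\<lambda>n::nat. x [^] n))"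
  unfolding mult_system_def
proof (intro conjI ballI)
  show "\<one> \<in> range (\<lambda>n::nat. x [^] n)" using nat_pow_0 by (metis rangeI)
  show "a \<otimes> b \<in> range (\<lambda>n::nat. x [^] n)"
    if "a \<in> range (\<lambda>n::nat. x [^] n)" "b \<in> range (\<lambda>n::nat. x [^] n)" for a b
    using that assms by (auto simp: nat_pow_mult)
qed (use assms in auto)

lemma mult_system_product:
  assumes V: "mult_system R V" and W: "mult_system R W"
  shows "mult_system R {v \<otimes> w | v w. v \<in> V \<and> w \<in> W}"
  unfolding mult_system_def
proof (intro conjI ballI)
  note carriers = subsetD[OF mult_system_subset[OF V]] subsetD[OF mult_system_subset[OF W]]
  show "{v \<otimes> w | v w. v \<in> V \<and> w \<in> W} \<subseteq> carrier R" using carriers by auto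
  show "\<one> \<in> {v \<otimes> w | v w. v \<in> V \<and> w \<in> W}" using V W mult_system_one by force
  fix a b assume "a \<in> {v \<otimes> w | v w. v \<in> V \<and> w \<in> W}" "b \<in> {v \<otimes> w | v w. v \<in> V \<and> w \<in> W}"
  then obtain v w v' w' where factors: "a = v \<otimes> w" "b = v' \<otimes> w'" "v \<in> V" "w \<in> W" "v' \<in> V" "w' \<in> W" by auto
  then have "a \<otimes> b = (v \<otimes> v') \<otimes> (w \<otimes> w')" using carriers by (simp add: m_ac)
  then show "a \<otimes> b \<in> {v \<otimes> w | v w. v \<in> V \<and> w \<in> W}"
    using mult_system_mult[OF V factors(3,5)] mult_system_mult[OF W factors(4,6)] by blast
qed

end

locale noetherian_cring = cring R + noetherian_ring R for R (structure)
begin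

lemma maximal_ideal_with:
  assumes "ideal J\<^sub>0 R" "Pr J\<^sub>0"
  obtains J where "ideal J R" "Pr J" "J\<^sub>0 \<subseteq> J" "\<And>J'. ideal J' R \<Longrightarrow> J \<subset> J' \<Longrightarrow> \<not> Pr J'"
proof -
  let ?A = "{J. ideal J R \<and> Pr J \<and> J\<^sub>0 \<subseteq> J}"
  have "\<exists>M\<in>?A. \<forall>Z\<in>?A. M \<subseteq> Z \<longrightarrow> Z = M"
  proof (rule subset_Zorn_nonempty)
    show "?A \<noteq> {}" using assms by auto
    fix C assume C: "C \<noteq> {}" "subset.chain ?A C"
    then have "subset.chain {I. ideal I R} C" by (auto simp: pred_on.chain_def)
    then have "\<Union>C \<in> C" using ideal_chain_is_trivial C(1) by auto
    then show "\<Union>C \<in> ?A" using C(2) by (auto simp: pred_on.chain_def)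
  qed
  then obtain J where "J \<in> ?A" "\<forall>Z\<in>?A. J \<subseteq> Z \<longrightarrow> Z = J" by auto
  then show thesis by (intro that[of J]) auto
qed

lemma noetherian_induct [consumes 1, case_names step]:
  assumes "ideal J R" and step: "\<And>J. ideal J R \<Longrightarrow> (\<And>J'. ideal J' R \<Longrightarrow> J \<subset> J' \<Longrightarrow> Pr J') \<Longrightarrow> Pr J"
  shows "Pr J"
proof (rule ccontr)
  assume "\<not> Pr J"
  then obtain M where "ideal M R" "\<not> Pr M" "\<And>J'. ideal J' R \<Longrightarrow> M \<subset> J' \<Longrightarrow> Pr J'"
    using maximal_ideal_with[OF assms(1), of "\<lambda>J. \<not> Pr J"] by metis
  then show False using step by blast
qed

lemma ascending_ideals_stabilise:
  fixes Y :: "nat \<Rightarrow> 'a set"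
  assumes "\<And>n. ideal (Y n) R" and "\<And>n. Y n \<subseteq> Y (Suc n)"
  shows "\<exists>k. \<forall>n. Y n \<subseteq> Y k"
proof -
  have "Y i \<subseteq> Y j \<or> Y j \<subseteq> Y i" for i j
    using lift_Suc_mono_le[of Y i j, OF assms(2)] lift_Suc_mono_le[of Y j i, OF assms(2)] by (meson linear)
  then have "subset.chain {I. ideal I R} (range Y)"
    using assms(1) unfolding pred_on.chain_def by blast
  then have "\<Union>(range Y) \<in> range Y" by (intro ideal_chain_is_trivial) auto
  then show ?thesis by auto
qed

lemma not_prime_split:
  assumes "ideal J R" "J \<noteq> carrier R" "\<not> primeideal J R"
  obtains x y where "x \<in> carrier R" "y \<in> carrier R" "x \<otimes> y \<in> J"
    "J \<subset> J <+> PIdl x" "J \<subset> J <+> PIdl y"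
proof -
  obtain x y where xy: "x \<in> carrier R" "y \<in> carrier R" "x \<otimes> y \<in> J" "x \<notin> J" "y \<notin> J"
    using ideal.primeidealCD[OF assms(1) is_cring assms(3)] assms(2) by blast
  have "J \<subset> J <+> PIdl z" if "z \<in> carrier R" "z \<notin> J" for z
    using add_cgenideal_upper[OF assms(1) that(1)] that(2) by auto
  then show thesis using that[OF xy(1-3)] xy by simp
qed

lemma prime_avoiding_mult_system:
  assumes J: "ideal J R" and S: "mult_system R S" and disj: "J \<inter> S = {}"
  obtains P where "primeideal P R" "J \<subseteq> P" "P \<inter> S = {}"
proof -
  obtain P where P: "ideal P R" "P \<inter> S = {}" "J \<subseteq> P"
    and larger: "\<And>J'. ideal J' R \<Longrightarrow> P \<subset> J' \<Longrightarrow> J' \<inter> S \<noteq> {}"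
    using maximal_ideal_with[of J "\<lambda>J. J \<inter> S = {}", OF J disj] by metis
  have "primeideal P R"
  proof (rule ccontr)
    assume "\<not> primeideal P R"
    moreover have "P \<noteq> carrier R" using P(2) mult_system_one[OF S] by auto
    ultimately obtain x y where xy: "x \<in> carrier R" "y \<in> carrier R" "x \<otimes> y \<in> P"
      "P \<subset> P <+> PIdl x" "P \<subset> P <+> PIdl y" using not_prime_split P(1) by blast
    have "(P <+> PIdl x) \<inter> S \<noteq> {}" "(P <+> PIdl y) \<inter> S \<noteq> {}"
      using larger[OF add_cgenideal[OF P(1)]] xy by auto
    then obtain s t where st: "s \<in> S" "t \<in> S" "s \<in> P <+> PIdl x" "t \<in> P <+> PIdl y" by auto
    obtain i r where i: "s = i \<oplus> r \<otimes> x" "i \<in> P" "r \<in> carrier R"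
      using st(3) by (auto simp: cgenideal_def elim!: set_add_memE)
    obtain j u where j: "t = j \<oplus> u \<otimes> y" "j \<in> P" "u \<in> carrier R"
      using st(4) by (auto simp: cgenideal_def elim!: set_add_memE)
    note carriers = subsetD[OF ideal_subset[OF P(1)]]
    have "s \<otimes> t = i \<otimes> t \<oplus> j \<otimes> (r \<otimes> x) \<oplus> (r \<otimes> u) \<otimes> (x \<otimes> y)"
      unfolding i(1) j(1) using i j xy(1,2) carriers by (simp add: l_distr r_distr m_ac a_ac)
    also have "\<dots> \<in> P"
      using i j xy(1,2) carriers mult_system_subset[OF S] st(2)
      by (intro ideal_add[OF P(1)] ideal.I_r_closed[OF P(1) i(2)] ideal.I_r_closed[OF P(1) j(2)]
        ideal.I_l_closed[OF P(1) xy(3)]) auto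
    finally show False using mult_system_mult[OF S st(1,2)] P(2) by blast
  qed
  then show thesis using P by (intro that[of P]) auto
qed

lemma proper_ideal_in_maximal:
  assumes "ideal J R" "J \<noteq> carrier R"
  obtains M where "maximalideal M R" "J \<subseteq> M"
proof -
  obtain M where M: "ideal M R" "M \<noteq> carrier R" "J \<subseteq> M"
    "\<And>J'. ideal J' R \<Longrightarrow> M \<subset> J' \<Longrightarrow> J' = carrier R"
    using maximal_ideal_with[of J "\<lambda>J. J \<noteq> carrier R", OF assms] by metis
  then have "maximalideal M R" by (intro maximalidealI) auto
  then show thesis using that M(3) by simp
qed

lemma finite_primes_below:
  assumes "ideal J R"
  shows "\<exists>F. finite F \<and> (\<forall>P \<in> F. primeideal P R) \<and> (\<forall>Q. primeideal Q R \<longrightarrow> J \<subseteq> Q \<longrightarrow> (\<exists>P \<in> F. P \<subseteq> Q))"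
  using assms
proof (induction rule: noetherian_induct)
  case (step J)
  consider (whole) "J = carrier R" | (prime) "primeideal J R"
    | (split) "J \<noteq> carrier R" "\<not> primeideal J R" by blast
  then show ?case
  proof cases
    case whole
    then have "\<not> J \<subseteq> Q" if "primeideal Q R" for Q using prime_one_notin[OF that] by auto
    then show ?thesis by (intro exI[of _ "{}"]) auto
  next
    case prime
    then show ?thesis by (intro exI[of _ "{J}"]) auto
  next
    case split
    then obtain x y where xy: "x \<in> carrier R" "y \<in> carrier R" "x \<otimes> y \<in> J"
      "J \<subset> J <+> PIdl x" "J \<subset> J <+> PIdl y" using not_prime_split[OF step.hyps] by blast
    note IH = step.IH[OF add_cgenideal[OF step.hyps]]
    obtain F where F: "finite F" "\<forall>P \<in> F. primeideal P R"
      "\<forall>Q. primeideal Q R \<longrightarrow> J <+> PIdl x \<subseteq> Q \<longrightarrow> (\<exists>P \<in> F. P \<subseteq> Q)" using IH[OF xy(1,4)] by blast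
    obtain G where G: "finite G" "\<forall>P \<in> G. primeideal P R"
      "\<forall>Q. primeideal Q R \<longrightarrow> J <+> PIdl y \<subseteq> Q \<longrightarrow> (\<exists>P \<in> G. P \<subseteq> Q)" using IH[OF xy(2,5)] by blast
    have "\<exists>P \<in> F \<union> G. P \<subseteq> Q" if "primeideal Q R" "J \<subseteq> Q" for Q
      using prime_above_product[OF that xy(1-3)] F(3) G(3) that(1) by blast
    then show ?thesis using F(1,2) G(1,2) by (intro exI[of _ "F \<union> G"]) auto
  qed
qed

lemma
  shows finite_minimal_primes: "finite {P. minimal_prime R P}"
    and prime_contains_minimal: "primeideal Q R \<Longrightarrow> \<exists>P. minimal_prime R P \<and> P \<subseteq> Q"
proof -
  obtain F where F: "finite F" "\<forall>P \<in> F. primeideal P R"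
    and "\<forall>Q. primeideal Q R \<longrightarrow> {\<zero>} \<subseteq> Q \<longrightarrow> (\<exists>P \<in> F. P \<subseteq> Q)"
    using finite_primes_below[OF zeroideal] by auto
  then have below: "\<exists>P \<in> F. P \<subseteq> Q" if "primeideal Q R" for Q
    using ideal_zero[OF primeideal.axioms(1)[OF that]] that by auto
  have "P \<in> F" if "minimal_prime R P" for P
    using below[of P] that F(2) by (auto simp: minimal_prime_def)
  then show "finite {P. minimal_prime R P}" using F(1) by (auto intro: rev_finite_subset)
  assume Q: "primeideal Q R"
  let ?G = "{P \<in> F. P \<subseteq> Q}"
  have "finite ?G" "?G \<noteq> {}" using F(1) below[OF Q] by auto
  then obtain P where P: "P \<in> ?G" "\<And>P'. P' \<in> ?G \<Longrightarrow> P' \<subseteq> P \<Longrightarrow> P' = P"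
    using finite_has_minimal[of ?G] by metis
  have "Q' = P" if Q': "primeideal Q' R" "Q' \<subseteq> P" for Q'
  proof -
    obtain P' where "P' \<in> F" "P' \<subseteq> Q'" using below[OF Q'(1)] by auto
    then show ?thesis using P(1) P(2)[of P'] Q'(2) by auto
  qed
  then have "minimal_prime R P" using P(1) F(2) by (auto simp: minimal_prime_def)
  then show "\<exists>P. minimal_prime R P \<and> P \<subseteq> Q" using P(1) by auto
qed

lemma nilradicalI:
  assumes x: "x \<in> carrier R" and "\<And>P. minimal_prime R P \<Longrightarrow> x \<in> P"
  shows "x \<in> nilradical R"
proof (rule ccontr)
  let ?S = "range (\<lambda>n::nat. x [^] n)"
  assume "x \<notin> nilradical R"
  then have "{\<zero>} \<inter> ?S = {}" using x by (auto simp: nilradical_def)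
  then obtain Q where Q: "primeideal Q R" "Q \<inter> ?S = {}"
    using prime_avoiding_mult_system[OF zeroideal power_mult_system[OF x]] by metis
  obtain P where "minimal_prime R P" "P \<subseteq> Q" using prime_contains_minimal[OF Q(1)] by auto
  then have "x [^] (1::nat) \<in> Q" using assms by auto
  then show False using Q(2) by blast
qed

lemma minimal_prime_nil_locally:
  assumes P: "minimal_prime R P"
  shows "\<exists>d \<in> carrier R - P. \<forall>s \<in> P. d \<otimes> s \<in> nilradical R"
proof -
  let ?F = "{P'. minimal_prime R P'} - {P}"
  have "\<exists>d \<in> carrier R - P. \<forall>P' \<in> ?F. d \<in> P'"
  proof (rule mult_system_meets_ideals[OF prime_complement_mult_system[OF minimal_prime_prime[OF P]]])
    fix P' assume P': "P' \<in> ?F"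
    then show "ideal P' R" using minimal_prime_ideal by simp
    have "\<not> P' \<subseteq> P" using P' P by (auto simp: minimal_prime_def)
    then show "P' \<inter> (carrier R - P) \<noteq> {}" using ideal_subset[OF \<open>ideal P' R\<close>] by auto
  qed (use finite_minimal_primes in simp)
  then obtain d where d: "d \<in> carrier R - P" "\<And>P'. P' \<in> ?F \<Longrightarrow> d \<in> P'" by auto
  have "d \<otimes> s \<in> nilradical R" if s: "s \<in> P" for s
  proof (rule nilradicalI)
    have s_carrier: "s \<in> carrier R" using s ideal_subset[OF minimal_prime_ideal[OF P]] by auto
    then show "d \<otimes> s \<in> carrier R" using d(1) by simp
    show "d \<otimes> s \<in> P'" if "minimal_prime R P'" for P'
      using ideal.I_l_closed[OF minimal_prime_ideal[OF P] s, of d] d that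
        ideal.I_r_closed[OF minimal_prime_ideal[OF that] _ s_carrier] by (cases "P' = P") auto
  qed
  then show ?thesis using d(1) by blast
qed

lemma saturation_common_denominator:
  assumes J: "ideal J R" and W: "mult_system R W"
  shows "\<exists>w \<in> W. saturation R W J \<subseteq> colon R J w"
proof -
  note sat = saturation_ideal[OF J W]
  obtain A where A: "A \<subseteq> carrier R" "finite A" "saturation R W J = genideal R A"
    using finetely_gen[OF sat] by auto
  have "\<exists>w \<in> W. \<forall>a \<in> A. w \<in> colon R J a"
  proof (rule mult_system_meets_ideals[OF W A(2)])
    fix a assume a: "a \<in> A"
    then show "ideal (colon R J a) R" using colon_ideal[OF J] A(1) by auto
    have "a \<in> saturation R W J" using genideal_self[OF A(1)] A(3) a by auto
    then show "colon R J a \<inter> W \<noteq> {}"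
      using mult_system_subset[OF W] by (auto simp: colon_def elim!: saturationE)
  qed
  then obtain w where w: "w \<in> W" "\<forall>a \<in> A. w \<in> colon R J a" by auto
  then have "w \<in> carrier R" using mult_system_subset[OF W] by auto
  then have "A \<subseteq> colon R J w" using w(2) A(1) m_comm[of w] by (auto simp: colon_def subset_iff)
  then show ?thesis
    using genideal_minimal[OF colon_ideal[OF J \<open>w \<in> carrier R\<close>]] A(3) w(1) by auto
qed

lemma maximal_above_saturation_disjoint:
  assumes J: "ideal J R" and W: "mult_system R W"
    and primes: "\<And>Q. primeideal Q R \<Longrightarrow> J \<subseteq> Q \<Longrightarrow> Q \<inter> W = {} \<Longrightarrow> maximalideal Q R"
    and M: "maximalideal M R" "saturation R W J \<subseteq> M"
  shows "M \<inter> W = {}"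
proof -
  have M_prime: "primeideal M R" using maximalideal_prime[OF M(1)] .
  let ?T = "{w \<otimes> s | w s. w \<in> W \<and> s \<in> carrier R - M}"
  have T: "mult_system R ?T"
    by (rule mult_system_product[OF W prime_complement_mult_system[OF M_prime]])
  have "s \<in> M" if "w \<in> W" "s \<in> carrier R" "w \<otimes> s \<in> J" for w s
    using saturationI[OF that(2,1,3)] M(2) by auto
  then have "J \<inter> ?T = {}" by auto
  then obtain Q where Q: "primeideal Q R" "J \<subseteq> Q" "Q \<inter> ?T = {}"
    by (rule prime_avoiding_mult_system[OF J T])
  have "w \<in> ?T" if "w \<in> W" for w
    using that mult_system_subset[OF W] prime_one_notin[OF M_prime]
    by (intro CollectI exI[of _ w] exI[of _ \<one>]) auto
  then have "Q \<inter> W = {}" using Q(3) by auto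
  have "s \<in> ?T" if "s \<in> carrier R - M" for s
    using that mult_system_one[OF W] by (intro CollectI exI[of _ \<one>] exI[of _ s]) auto
  then have "Q \<subseteq> M" using Q(3) ideal_subset[OF primeideal.axioms(1)[OF Q(1)]] by auto
  have "maximalideal Q R" by (rule primes[OF Q(1,2) \<open>Q \<inter> W = {}\<close>])
  then have "Q = M"
    using maximalideal.I_maximal[of Q R M] \<open>Q \<subseteq> M\<close> primeideal.axioms(1)[OF M_prime]
      ideal_subset[of M] primeideal.I_notcarr[OF M_prime] by auto
  then show ?thesis using \<open>Q \<inter> W = {}\<close> by simp
qed

lemma ideal_eq_carrier_if_contains_powers:
  fixes n :: nat
  assumes J: "ideal J R" "w \<in> J" "\<And>a. a \<in> A \<Longrightarrow> a [^] n \<in> J" and "A \<subseteq> carrier R"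
    and "\<And>M. maximalideal M R \<Longrightarrow> A \<subseteq> M \<Longrightarrow> w \<notin> M"
  shows "J = carrier R"
proof (rule ccontr)
  assume "J \<noteq> carrier R"
  then obtain M where M: "maximalideal M R" "J \<subseteq> M" using proper_ideal_in_maximal[OF J(1)] by metis
  have "A \<subseteq> M" using prime_pow_notin[OF maximalideal_prime[OF M(1)]] J(3) M(2) assms(4) by blast
  then show False using assms(5)[OF M(1)] J(2) M(2) by auto
qed

end

subsection \<open>Artinian localizations\<close>

text \<open>For a prime \<open>Q\<close> above \<open>J\<close>: the ring \<open>(R/J)\<^sub>Q\<close> is Artinian.\<close>

definition locally_artinian :: "('a, 'b) ring_scheme \<Rightarrow> 'a set \<Rightarrow> 'a set \<Rightarrow> bool" where
  "locally_artinian R Q J \<longleftrightarrow>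
    (\<forall>Y :: nat \<Rightarrow> 'a set. (\<forall>n. ideal (Y n) R \<and> J \<subseteq> Y n \<and> Y (Suc n) \<subseteq> Y n) \<longrightarrow>
      (\<exists>k. \<forall>n \<ge> k. Y n \<subseteq> saturation R (carrier R - Q) (Y (Suc n))))"

lemma locally_artinianI:
  assumes "\<And>Y :: nat \<Rightarrow> 'a set. (\<And>n. ideal (Y n) R) \<Longrightarrow> (\<And>n. J \<subseteq> Y n) \<Longrightarrow> (\<And>n. Y (Suc n) \<subseteq> Y n) \<Longrightarrow>
    \<exists>k. \<forall>n \<ge> k. Y n \<subseteq> saturation R (carrier R - Q) (Y (Suc n))"
  shows "locally_artinian R Q J"
  unfolding locally_artinian_def by (intro allI impI assms) auto

lemma locally_artinianD:
  assumes "locally_artinian R Q J" "\<And>n. ideal (Y n) R" "\<And>n. J \<subseteq> Y n" "\<And>n. Y (Suc n) \<subseteq> Y n"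
  shows "\<exists>k. \<forall>n \<ge> k. Y n \<subseteq> saturation R (carrier R - Q) (Y (Suc n))"
  using assms unfolding locally_artinian_def by blast

context cring
begin

lemma locally_artinian_if_not_subset:
  assumes "\<not> J \<subseteq> Q" shows "locally_artinian R Q J"
proof (rule locally_artinianI, intro exI allI impI)
  fix Y :: "nat \<Rightarrow> 'a set" and n
  assume Y: "\<And>n. ideal (Y n) R" "\<And>n. J \<subseteq> Y n"
  have "\<not> Y (Suc n) \<subseteq> Q" using assms Y(2) by blast
  then show "Y n \<subseteq> saturation R (carrier R - Q) (Y (Suc n))"
    using saturation_prime_complement[OF Y(1)] ideal_subset[OF Y(1)] by simp
qed

lemma locally_artinian_prime:
  assumes Q: "primeideal Q R" shows "locally_artinian R Q Q"
proof (rule locally_artinianI)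
  fix Y :: "nat \<Rightarrow> 'a set"
  assume Y: "\<And>n. ideal (Y n) R" "\<And>n. Q \<subseteq> Y n" "\<And>n. Y (Suc n) \<subseteq> Y n"
  show "\<exists>k. \<forall>n \<ge> k. Y n \<subseteq> saturation R (carrier R - Q) (Y (Suc n))"
  proof (cases "\<exists>k. Y k \<subseteq> Q")
    case True
    then obtain k where "Y k \<subseteq> Q" by blast
    then have "Y n = Q" if "n \<ge> k" for n
      using lift_Suc_antimono_le[of Y, OF Y(3) that] Y(2) by blast
    then have "Y n \<subseteq> Y (Suc n)" if "n \<ge> k" for n using that by simp
    then show ?thesis
      using saturation_upper[OF prime_complement_mult_system[OF Q] ideal_subset[OF Y(1)]] by blast
  next
    case False
    then show ?thesis using saturation_prime_complement[OF Y(1)] ideal_subset[OF Y(1)] by simp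
  qed
qed

lemma subset_saturation_if_extension:
  assumes W: "mult_system R W" and Y: "ideal Y R" and Z: "ideal Z R" "Z \<subseteq> Y" and x: "x \<in> carrier R"
    and quotient: "Y \<subseteq> saturation R W (Z <+> PIdl x)"
    and kernel: "colon R Y x \<subseteq> saturation R W (colon R Z x)"
  shows "Y \<subseteq> saturation R W Z"
proof
  fix g assume g: "g \<in> Y"
  then obtain t where t: "t \<in> W" "t \<otimes> g \<in> Z <+> PIdl x" using quotient by (blast elim: saturationE)
  then obtain h r where h: "t \<otimes> g = h \<oplus> r \<otimes> x" "h \<in> Z" and r: "r \<in> carrier R"
    by (auto simp: cgenideal_def elim!: set_add_memE)
  have carriers: "g \<in> carrier R" "h \<in> carrier R" "t \<in> carrier R"
    using g h(2) ideal_subset[OF Y] Z(2) t(1) mult_system_subset[OF W] by auto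
  have "r \<otimes> x = t \<otimes> g \<ominus> h"
    unfolding h(1) using r carriers x by (simp add: a_minus_def a_ac r_neg2)
  also have "\<dots> \<in> Y"
    using g h(2) Z(2) carriers by (intro ideal_minus[OF Y] ideal.I_l_closed[OF Y]) auto
  finally have "r \<in> colon R Y x" using r by (simp add: colon_def)
  then obtain u where u: "u \<in> W" "(u \<otimes> r) \<otimes> x \<in> Z"
    using kernel by (auto simp: colon_def elim!: saturationE)
  have u_carrier: "u \<in> carrier R" using u(1) mult_system_subset[OF W] by auto
  have "(u \<otimes> t) \<otimes> g = u \<otimes> (h \<oplus> r \<otimes> x)" using h(1) u_carrier carriers by (simp add: m_assoc)
  also have "\<dots> = u \<otimes> h \<oplus> (u \<otimes> r) \<otimes> x" using u_carrier r carriers x by (simp add: r_distr m_assoc)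
  also have "\<dots> \<in> Z" by (intro ideal_add[OF Z(1)] ideal.I_l_closed[OF Z(1) h(2)] u_carrier u(2))
  finally show "g \<in> saturation R W Z"
    by (rule saturationI[OF carriers(1) mult_system_mult[OF W u(1) t(1)]])
qed

lemma locally_artinian_extension:
  assumes Q: "primeideal Q R" and x: "x \<in> carrier R"
    and quotient: "locally_artinian R Q (J <+> PIdl x)" and kernel: "locally_artinian R Q (colon R J x)"
  shows "locally_artinian R Q J"
proof (rule locally_artinianI)
  fix Y :: "nat \<Rightarrow> 'a set"
  assume Y: "\<And>n. ideal (Y n) R" "\<And>n. J \<subseteq> Y n" "\<And>n. Y (Suc n) \<subseteq> Y n"
  let ?S = "carrier R - Q"
  have "\<exists>k. \<forall>n \<ge> k. Y n <+> PIdl x \<subseteq> saturation R ?S (Y (Suc n) <+> PIdl x)"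
  proof (rule locally_artinianD[OF quotient])
    show "ideal (Y n <+> PIdl x) R" for n by (rule add_cgenideal[OF Y(1) x])
    show "J <+> PIdl x \<subseteq> Y n <+> PIdl x" "Y (Suc n) <+> PIdl x \<subseteq> Y n <+> PIdl x" for n
      using Y by (simp_all add: set_add_mono)
  qed
  moreover have "\<exists>l. \<forall>n \<ge> l. colon R (Y n) x \<subseteq> saturation R ?S (colon R (Y (Suc n)) x)"
  proof (rule locally_artinianD[OF kernel])
    show "ideal (colon R (Y n) x) R" for n by (rule colon_ideal[OF Y(1) x])
    show "colon R J x \<subseteq> colon R (Y n) x" "colon R (Y (Suc n)) x \<subseteq> colon R (Y n) x" for n
      using Y(2,3)[of n] unfolding colon_def by blast+
  qed
  ultimately obtain k l
    where k: "\<And>n. n \<ge> k \<Longrightarrow> Y n <+> PIdl x \<subseteq> saturation R ?S (Y (Suc n) <+> PIdl x)"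
      and l: "\<And>n. n \<ge> l \<Longrightarrow> colon R (Y n) x \<subseteq> saturation R ?S (colon R (Y (Suc n)) x)"
    by blast
  have "Y n \<subseteq> saturation R ?S (Y (Suc n))" if "n \<ge> max k l" for n
  proof (rule subset_saturation_if_extension[OF prime_complement_mult_system[OF Q] Y(1) Y(1) Y(3) x])
    show "Y n \<subseteq> saturation R ?S (Y (Suc n) <+> PIdl x)"
      using add_cgenideal_upper(1)[OF Y(1) x, of n] k[of n] that by auto
  qed (use l that in simp)
  then show "\<exists>k. \<forall>n \<ge> k. Y n \<subseteq> saturation R ?S (Y (Suc n))" by blast
qed

end

lemma (in noetherian_cring) locally_artinian_if_only_prime_above:
  assumes Q: "primeideal Q R" and "ideal J R"
    and "\<And>Q'. primeideal Q' R \<Longrightarrow> J \<subseteq> Q' \<Longrightarrow> Q' \<subseteq> Q \<Longrightarrow> Q' = Q"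
  shows "locally_artinian R Q J"
  using assms(2-)
proof (induction rule: noetherian_induct)
  case (step J)
  consider (not_subset) "\<not> J \<subseteq> Q" | (equal) "J = Q"
    | (split) "J \<subseteq> Q" "J \<noteq> carrier R" "\<not> primeideal J R"
    using step.prems[of J] prime_one_notin[OF Q] by auto
  then show ?case
  proof cases
    case not_subset
    then show ?thesis by (rule locally_artinian_if_not_subset)
  next
    case equal
    then show ?thesis using locally_artinian_prime[OF Q] by simp
  next
    case split
    then obtain x y where xy: "x \<in> carrier R" "y \<in> carrier R" "x \<otimes> y \<in> J"
      "J \<subset> J <+> PIdl x" "J \<subset> J <+> PIdl y" using not_prime_split[OF step.hyps] by blast
    have "y \<notin> J" using xy(5) set_add_least[OF step.hyps[unfolded ideal_iff_subalgebra] subset_refl]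
      cgenideal_minimal[OF step.hyps] by auto
    moreover have "y \<in> colon R J x" using xy m_comm[of x y] by (simp add: colon_def)
    ultimately have "J \<subset> colon R J x" using colon_superset[OF step.hyps xy(1)] by auto
    then have "locally_artinian R Q (colon R J x)"
      using step.prems by (intro step.IH[OF colon_ideal[OF step.hyps xy(1)]]) auto
    moreover have "locally_artinian R Q (J <+> PIdl x)"
      using step.prems xy(4) by (intro step.IH[OF add_cgenideal[OF step.hyps xy(1)]]) auto
    ultimately show ?thesis using locally_artinian_extension[OF Q xy(1)] by simp
  qed
qed

section \<open>Frobenius powers and tight closure\<close>

lemma (in cring) binomial_expansion:
  assumes x: "x \<in> carrier R" and y: "y \<in> carrier R"
  shows "(x \<oplus> y) [^] n = (\<Oplus>k\<in>{..n}. add_pow R (n choose k) (x [^] k \<otimes> y [^] (n - k)))"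
proof (induction n)
  case 0
  then show ?case using x y by simp
next
  case (Suc n)
  define T where "T = (\<lambda>n k. add_pow R (n choose k) (x [^] k \<otimes> y [^] (n - k)))"
  have T: "T n k \<in> carrier R" for n k using x y by (simp add: T_def)
  have pascal: "T (Suc n) (Suc k) = x \<otimes> T n k \<oplus> y \<otimes> T n (Suc k)" for k
  proof (cases "Suc k \<le> n")
    case True
    then have "n - k = Suc (n - Suc k)" by simp
    then show ?thesis using x y
      by (simp add: T_def add.nat_pow_mult[symmetric] add_pow_rdistr m_ac)
  qed (use x y in \<open>simp add: T_def add_pow_rdistr m_ac binomial_eq_0\<close>)
  have first: "T (Suc n) 0 = y \<otimes> T n 0" using x y by (simp add: T_def m_comm)
  have "T n (Suc n) = \<zero>" by (simp add: T_def binomial_eq_0)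
  then have shift: "(\<Oplus>k\<in>{..n}. T n k) = (\<Oplus>k\<in>{..n}. T n (Suc k)) \<oplus> T n 0"
    using T finsum_Suc2[of "T n" n] by simp
  have "(\<Oplus>k\<in>{..Suc n}. T (Suc n) k) = (\<Oplus>k\<in>{..n}. T (Suc n) (Suc k)) \<oplus> T (Suc n) 0"
    using T by (subst finsum_Suc2) auto
  also have "\<dots> = (\<Oplus>k\<in>{..n}. x \<otimes> T n k \<oplus> y \<otimes> T n (Suc k)) \<oplus> y \<otimes> T n 0"
    by (simp add: pascal first)
  also have "\<dots> = x \<otimes> (\<Oplus>k\<in>{..n}. T n k) \<oplus> y \<otimes> ((\<Oplus>k\<in>{..n}. T n (Suc k)) \<oplus> T n 0)"
    using T x y by (simp add: finsum_addf finsum_rdistr r_distr a_assoc)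
  also have "\<dots> = (x \<oplus> y) \<otimes> (\<Oplus>k\<in>{..n}. T n k)"
    using T x y by (simp add: shift[symmetric] l_distr)
  finally show ?case using Suc x y T by (simp add: T_def m_comm)
qed

locale prime_char = cring R for R (structure) +
  fixes p :: nat
  assumes char: "char_p R p"
begin

lemma p_prime: "Factorial_Ring.prime p"
  using char by (simp add: char_p_def)

lemma p_power_pos [simp]: "0 < p ^ e"
  using p_prime by (simp add: prime_gt_0_nat)

lemma le_p_power: "n \<le> p ^ n"
  using less_exp[of n] power_mono[of 2 p n] prime_ge_2_nat[OF p_prime] by linarith

lemma zero_p_power [simp]: "\<zero> [^] (p ^ e) = \<zero>"
  using p_power_pos[of e] by (simp add: nat_pow_zero)

lemma add_pow_multiple_of_p:
  assumes z: "z \<in> carrier R" and "p dvd m" shows "add_pow R m z = \<zero>"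
proof -
  obtain k where "m = p * k" using assms(2) by blast
  then have "add_pow R m z = add_pow R k (add_pow R p \<one> \<otimes> z)"
    using z add.nat_pow_pow[of z k p] by (simp add: add_pow_ldistr)
  then show ?thesis using z char by (simp add: char_p_def)
qed

lemma frobenius_add_p:
  assumes x: "x \<in> carrier R" and y: "y \<in> carrier R"
  shows "(x \<oplus> y) [^] p = x [^] p \<oplus> y [^] p"
proof -
  define T where "T = (\<lambda>k. add_pow R (p choose k) (x [^] k \<otimes> y [^] (p - k)))"
  have T: "T k \<in> carrier R" for k using x y by (simp add: T_def)
  obtain m where m: "p = Suc (Suc m)"
    using prime_ge_2_nat[OF p_prime] by (auto dest: le_Suc_ex)
  have "T (Suc k) = \<zero>" if "k \<le> m" for k
    unfolding T_def
  proof (rule add_pow_multiple_of_p)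
    show "p dvd (p choose Suc k)" by (rule dvd_choose_prime) (use that m p_prime in auto)
  qed (use x y in simp)
  then have middle: "(\<Oplus>k\<in>{..m}. T (Suc k)) = \<zero>" by (intro add.finprod_one_eqI) auto
  have "(x \<oplus> y) [^] p = (\<Oplus>k\<in>{..Suc (Suc m)}. T k)"
    using binomial_expansion[OF x y, of p] m by (simp add: T_def)
  also have "\<dots> = T p \<oplus> (\<Oplus>k\<in>{..Suc m}. T k)" using T by (subst finsum_Suc) (auto simp: m)
  also have "(\<Oplus>k\<in>{..Suc m}. T k) = (\<Oplus>k\<in>{..m}. T (Suc k)) \<oplus> T 0"
    using T by (subst finsum_Suc2) auto
  also have "T p \<oplus> \<dots> = T p \<oplus> T 0" using T by (simp add: middle)
  also have "\<dots> = x [^] p \<oplus> y [^] p" using x y by (simp add: T_def)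
  finally show ?thesis .
qed

lemma frobenius_add:
  assumes "x \<in> carrier R" "y \<in> carrier R"
  shows "(x \<oplus> y) [^] (p ^ e) = x [^] (p ^ e) \<oplus> y [^] (p ^ e)"
proof (induction e)
  case (Suc e)
  have "z [^] (p ^ Suc e) = (z [^] (p ^ e)) [^] p" if "z \<in> carrier R" for z
    using that by (simp add: nat_pow_pow mult.commute)
  then show ?case
    using assms Suc frobenius_add_p[of "x [^] (p ^ e)" "y [^] (p ^ e)"] by (simp del: power_Suc)
qed (use assms in simp)

lemma frobenius_finsum:
  assumes "finite A" "f \<in> A \<rightarrow> carrier R"
  shows "(\<Oplus>a\<in>A. f a) [^] (p ^ e) = (\<Oplus>a\<in>A. f a [^] (p ^ e))"
  using assms
proof (induction A rule: finite_induct)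
  case (insert a A)
  then have "f \<in> A \<rightarrow> carrier R" "(\<lambda>a. f a [^] (p ^ e)) \<in> A \<rightarrow> carrier R" by auto
  then show ?case using insert by (simp add: frobenius_add)
qed simp

lemma frobenius_preimage_subalgebra:
  assumes D: "subring D R" and M: "subalgebra D M R" and c: "c \<in> carrier R"
  shows "subalgebra D {y \<in> carrier R. c \<otimes> y [^] (p ^ e) \<in> M} R"
proof (rule subalgebraI[OF D])
  show "\<zero> \<in> {y \<in> carrier R. c \<otimes> y [^] (p ^ e) \<in> M}" using c subalgebra_zero[OF M] by simp
  show "a \<oplus> b \<in> {y \<in> carrier R. c \<otimes> y [^] (p ^ e) \<in> M}"
    if "a \<in> {y \<in> carrier R. c \<otimes> y [^] (p ^ e) \<in> M}" "b \<in> {y \<in> carrier R. c \<otimes> y [^] (p ^ e) \<in> M}" for a b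
    using that c by (simp add: frobenius_add r_distr subalgebra_add[OF M])
  fix d a assume d: "d \<in> D" and a: "a \<in> {y \<in> carrier R. c \<otimes> y [^] (p ^ e) \<in> M}"
  have "d \<in> carrier R" using d subringE(1)[OF D] by auto
  then have "c \<otimes> (d \<otimes> a) [^] (p ^ e) = d [^] (p ^ e) \<otimes> (c \<otimes> a [^] (p ^ e))"
    using a c by (simp add: nat_pow_distrib m_ac)
  then show "d \<otimes> a \<in> {y \<in> carrier R. c \<otimes> y [^] (p ^ e) \<in> M}"
    using a \<open>d \<in> carrier R\<close> subalgebra.smult_closed[OF M] subring_pow_closed[OF D d] by simp
qed auto

lemma frobenius_preimage_ideal:
  assumes "ideal J R" "c \<in> carrier R" shows "ideal {y \<in> carrier R. c \<otimes> y [^] (p ^ e) \<in> J} R"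
  using assms unfolding ideal_iff_subalgebra by (intro frobenius_preimage_subalgebra carrier_is_subring)

lemma frob_ideal_ideal: "ideal I R \<Longrightarrow> ideal (frob_ideal R q I) R"
  unfolding frob_ideal_def using ideal_subset by (intro genideal_ideal) auto

lemma pow_mem_frob_ideal: "ideal I R \<Longrightarrow> x \<in> I \<Longrightarrow> x [^] q \<in> frob_ideal R q I"
  unfolding frob_ideal_def
  using genideal_self[of "(\<lambda>x. x [^] q) ` I"] ideal_subset[of I] by auto

lemma frob_ideal_minimal: "ideal J R \<Longrightarrow> (\<And>x. x \<in> I \<Longrightarrow> x [^] q \<in> J) \<Longrightarrow> frob_ideal R q I \<subseteq> J"
  unfolding frob_ideal_def by (rule genideal_minimal) auto

lemma frob_ideal_genideal_minimal:
  assumes J: "ideal J R" and A: "A \<subseteq> carrier R" "\<And>a. a \<in> A \<Longrightarrow> a [^] (p ^ e) \<in> J"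
  shows "frob_ideal R (p ^ e) (genideal R A) \<subseteq> J"
proof (rule frob_ideal_minimal[OF J])
  have "genideal R A \<subseteq> {y \<in> carrier R. \<one> \<otimes> y [^] (p ^ e) \<in> J}"
    by (rule genideal_minimal[OF frobenius_preimage_ideal[OF J one_closed]]) (use A in auto)
  then show "x [^] (p ^ e) \<in> J" if "x \<in> genideal R A" for x using that by auto
qed

lemma frob_ideal_pow:
  assumes I: "ideal I R" and y: "y \<in> frob_ideal R (p ^ e) I"
  shows "y [^] (p ^ k) \<in> frob_ideal R (p ^ (e + k)) I"
proof -
  let ?J = "{y \<in> carrier R. \<one> \<otimes> y [^] (p ^ k) \<in> frob_ideal R (p ^ (e + k)) I}"
  have "ideal ?J R" by (rule frobenius_preimage_ideal[OF frob_ideal_ideal[OF I] one_closed])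
  then have "frob_ideal R (p ^ e) I \<subseteq> ?J"
    using pow_mem_frob_ideal[OF I] ideal_subset[OF I]
    by (intro frob_ideal_minimal) (auto simp: nat_pow_pow power_add subset_iff)
  then show ?thesis using y by auto
qed

end

subsection \<open>Multipliers\<close>

definition multipliers :: "('a, 'b) ring_scheme \<Rightarrow> nat \<Rightarrow> (nat \<Rightarrow> 'a set) \<Rightarrow> 'a \<Rightarrow> 'a set" where
  "multipliers R p F x =
    {c \<in> carrier R. \<forall>\<^sub>F e in sequentially. c \<otimes>\<^bsub>R\<^esub> x [^]\<^bsub>R\<^esub> (p ^ e) \<in> F e}"

definition multiplier_closure :: "('a, 'b) ring_scheme \<Rightarrow> nat \<Rightarrow> 'a set \<Rightarrow> (nat \<Rightarrow> 'a set) \<Rightarrow> 'a set" where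
  "multiplier_closure R p C F = {x \<in> carrier R. multipliers R p F x \<inter> C \<noteq> {}}"

abbreviation frobenius_powers :: "('a, 'b) ring_scheme \<Rightarrow> nat \<Rightarrow> 'a set \<Rightarrow> nat \<Rightarrow> 'a set" where
  "frobenius_powers R p I e \<equiv> frob_ideal R (p ^ e) I"

abbreviation frobenius_powers_mod :: "('a, 'b) ring_scheme \<Rightarrow> nat \<Rightarrow> 'a set \<Rightarrow> 'a set \<Rightarrow> nat \<Rightarrow> 'a set" where
  "frobenius_powers_mod R p J I e \<equiv> frob_ideal R (p ^ e) I <+>\<^bsub>R\<^esub> J"

lemma multipliers_mono: "(\<And>e. F e \<subseteq> G e) \<Longrightarrow> multipliers R p F x \<subseteq> multipliers R p G x"
  unfolding multipliers_def by (auto elim!: eventually_mono)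

lemma (in cring) tight_closure_eq_multiplier_closure:
  "tight_closure R p I = multiplier_closure R p (ring_circ R) (frobenius_powers R p I)"
  using mult_system_subset[OF ring_circ_mult_system]
  unfolding tight_closure_def multiplier_closure_def multipliers_def eventually_sequentially by blast

lemma multipliers_saturation_frequently:
  assumes "c \<in> multipliers R p (\<lambda>e. saturation R W (F e)) x"
  shows "\<exists>e \<ge> k. \<exists>w \<in> W. w \<otimes>\<^bsub>R\<^esub> (c \<otimes>\<^bsub>R\<^esub> x [^]\<^bsub>R\<^esub> (p ^ e)) \<in> F e"
proof -
  obtain e where "e \<ge> k" "c \<otimes>\<^bsub>R\<^esub> x [^]\<^bsub>R\<^esub> (p ^ e) \<in> saturation R W (F e)"
    using assms by (auto simp: multipliers_def eventually_sequentially) (meson max.cobounded1 max.cobounded2)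
  then show ?thesis by (blast elim: saturationE)
qed

context prime_char
begin

lemma multipliers_ideal:
  assumes F: "\<And>e. ideal (F e) R" and x: "x \<in> carrier R" shows "ideal (multipliers R p F x) R"
  unfolding ideal_iff_subalgebra
proof (rule subalgebraI[OF carrier_is_subring])
  show "\<zero> \<in> multipliers R p F x" using x ideal_zero[OF F] by (simp add: multipliers_def)
  show "a \<oplus> b \<in> multipliers R p F x" if "a \<in> multipliers R p F x" "b \<in> multipliers R p F x" for a b
    using that x eventually_elim2[of "\<lambda>e. a \<otimes> x [^] (p ^ e) \<in> F e" sequentially "\<lambda>e. b \<otimes> x [^] (p ^ e) \<in> F e"]
    by (simp add: multipliers_def l_distr ideal_add[OF F])
  show "r \<otimes> a \<in> multipliers R p F x" if "r \<in> carrier R" "a \<in> multipliers R p F x" for r a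
    using that x unfolding multipliers_def
    by (auto simp: m_assoc ideal.I_l_closed[OF F] elim!: eventually_mono)
qed (auto simp: multipliers_def)

lemma multipliers_add:
  assumes F: "\<And>e. ideal (F e) R" and x: "x \<in> carrier R" and y: "y \<in> carrier R"
  shows "multipliers R p F x \<inter> multipliers R p F y \<subseteq> multipliers R p F (x \<oplus> y)"
proof
  fix c assume c: "c \<in> multipliers R p F x \<inter> multipliers R p F y"
  then show "c \<in> multipliers R p F (x \<oplus> y)"
    using x y eventually_elim2[of "\<lambda>e. c \<otimes> x [^] (p ^ e) \<in> F e" sequentially "\<lambda>e. c \<otimes> y [^] (p ^ e) \<in> F e"]
    by (simp add: multipliers_def frobenius_add r_distr ideal_add[OF F])
qed

lemma multipliers_mult:
  assumes F: "\<And>e. ideal (F e) R" and x: "x \<in> carrier R" and r: "r \<in> carrier R"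
  shows "multipliers R p F x \<subseteq> multipliers R p F (r \<otimes> x)"
proof -
  have "c \<otimes> (r \<otimes> x) [^] (p ^ e) = r [^] (p ^ e) \<otimes> (c \<otimes> x [^] (p ^ e))" if "c \<in> carrier R" for c e
    using that x r by (simp add: nat_pow_distrib m_lcomm)
  then show ?thesis unfolding multipliers_def
    using r by (auto elim!: eventually_mono simp: ideal.I_l_closed[OF F])
qed

lemma one_multiplier_if_mem:
  assumes "x \<in> carrier R" "\<And>e. x [^] (p ^ e) \<in> F e" shows "\<one> \<in> multipliers R p F x"
  using assms by (simp add: multipliers_def)

lemma common_multiplier:
  assumes F: "\<And>e. ideal (F e) R" and C: "mult_system R C"
    and A: "finite A" "A \<subseteq> multiplier_closure R p C F"
  shows "\<exists>c \<in> C. \<forall>a \<in> A. c \<in> multipliers R p F a"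
  using A by (intro mult_system_meets_ideals[OF C A(1)] multipliers_ideal F)
    (auto simp: multiplier_closure_def)

lemma multiplier_closure_ideal:
  assumes F: "\<And>e. ideal (F e) R" and C: "mult_system R C"
  shows "ideal (multiplier_closure R p C F) R"
  unfolding ideal_iff_subalgebra
proof (rule subalgebraI[OF carrier_is_subring])
  show "\<zero> \<in> multiplier_closure R p C F"
    using mult_system_one[OF C] ideal_zero[OF F] one_multiplier_if_mem[of \<zero> F]
    by (auto simp: multiplier_closure_def)
  show "a \<oplus> b \<in> multiplier_closure R p C F"
    if ab: "a \<in> multiplier_closure R p C F" "b \<in> multiplier_closure R p C F" for a b
  proof -
    obtain c where "c \<in> C" "c \<in> multipliers R p F a" "c \<in> multipliers R p F b"
      using common_multiplier[of F C "{a, b}"] F C ab by auto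
    then show ?thesis using multipliers_add[of F a b] F ab by (auto simp: multiplier_closure_def)
  qed
  show "r \<otimes> a \<in> multiplier_closure R p C F"
    if "r \<in> carrier R" "a \<in> multiplier_closure R p C F" for r a
    using multipliers_mult[of F a r] F that by (auto simp: multiplier_closure_def)
qed (auto simp: multiplier_closure_def)

lemma frobenius_powers_mod_ideal: "ideal I R \<Longrightarrow> ideal J R \<Longrightarrow> ideal (frobenius_powers_mod R p J I e) R"
  by (intro add_ideals frob_ideal_ideal)

lemma frobenius_powers_mod_upper:
  assumes "ideal I R" "ideal J R"
  shows "frobenius_powers R p I e \<subseteq> frobenius_powers_mod R p J I e" "J \<subseteq> frobenius_powers_mod R p J I e"
  using set_add_upper1 set_add_upper2 frob_ideal_ideal assms unfolding ideal_iff_subalgebra by blast+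

lemma tight_closure_ideal: "ideal I R \<Longrightarrow> ideal (tight_closure R p I) R"
  unfolding tight_closure_eq_multiplier_closure
  by (intro multiplier_closure_ideal frob_ideal_ideal ring_circ_mult_system)

lemma multipliers_mod_mult:
  assumes I: "ideal I R" and b: "b \<in> multipliers R p (frobenius_powers_mod R p J I) x"
    and d: "d \<in> carrier R" "\<And>s. s \<in> J \<Longrightarrow> d \<otimes> s \<in> N" and J: "J \<subseteq> carrier R" and x: "x \<in> carrier R"
  shows "d \<otimes> b \<in> multipliers R p (frobenius_powers_mod R p N I) x"
proof -
  have "(d \<otimes> b) \<otimes> x [^] (p ^ e) \<in> frobenius_powers_mod R p N I e"
    if mem: "b \<otimes> x [^] (p ^ e) \<in> frobenius_powers_mod R p J I e" for e
  proof -
    obtain i s where split: "i \<in> frobenius_powers R p I e" "s \<in> J" "b \<otimes> x [^] (p ^ e) = i \<oplus> s"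
      using mem by (rule set_add_memE)
    have "(d \<otimes> b) \<otimes> x [^] (p ^ e) = d \<otimes> (b \<otimes> x [^] (p ^ e))"
      using b d(1) x by (simp add: multipliers_def m_assoc)
    also have "\<dots> = d \<otimes> i \<oplus> d \<otimes> s"
      unfolding split(3) using split(1,2) J d(1) ideal_subset[OF frob_ideal_ideal[OF I]]
      by (intro r_distr) auto
    finally show ?thesis
      using ideal.I_l_closed[OF frob_ideal_ideal[OF I] split(1) d(1)] d(2)[OF split(2)]
      by (simp add: set_add_memI)
  qed
  then show ?thesis using b d(1) by (auto simp: multipliers_def elim: eventually_mono)
qed

lemma mem_multiplier_closure_mod_if_mem:
  assumes P: "primeideal P R" and I: "ideal I R" and x: "x \<in> P"
  shows "x \<in> multiplier_closure R p (carrier R - P) (frobenius_powers_mod R p P I)"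
proof -
  note P_ideal = primeideal.axioms(1)[OF P]
  have "x [^] (p ^ e) \<in> frobenius_powers_mod R p P I e" for e
    using ideal_pow_mem[OF P_ideal x p_power_pos] frobenius_powers_mod_upper(2)[OF I P_ideal] by auto
  moreover have "x \<in> carrier R" using ideal_subset[OF P_ideal] x by auto
  ultimately show ?thesis
    using one_multiplier_if_mem[of x "frobenius_powers_mod R p P I"] prime_one_notin[OF P]
    by (auto simp: multiplier_closure_def)
qed

lemma multiplier_closure_mod_ideal:
  "primeideal P R \<Longrightarrow> ideal I R \<Longrightarrow>
    ideal (multiplier_closure R p (carrier R - P) (frobenius_powers_mod R p P I)) R"
  by (intro multiplier_closure_ideal frobenius_powers_mod_ideal prime_complement_mult_system)
    (auto dest: primeideal.axioms(1))

end

locale noetherian_char_p = noetherian_cring R + prime_char R p for R (structure) and p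
begin

lemma nilradical_eq_frobenius_kernel:
  "\<exists>k. nilradical R = {x \<in> carrier R. x [^] (p ^ k) = \<zero>}"
proof -
  define Y where "Y = (\<lambda>k. {x \<in> carrier R. x [^] (p ^ k) = \<zero>})"
  have "ideal (Y k) R" for k
    using frobenius_preimage_ideal[OF zeroideal one_closed, of k] by (simp add: Y_def cong: conj_cong)
  moreover have "Y k \<subseteq> Y (Suc k)" for k
  proof
    fix x assume x: "x \<in> Y k"
    then have "x [^] (p ^ Suc k) = (x [^] (p ^ k)) [^] p"
      using nat_pow_pow[of x "p ^ k" p] by (simp add: Y_def mult.commute)
    then show "x \<in> Y (Suc k)" using x zero_p_power[of 1] by (auto simp: Y_def)
  qed
  ultimately obtain k where k: "\<And>n. Y n \<subseteq> Y k" using ascending_ideals_stabilise[of Y] by auto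
  have "x \<in> Y k" if x: "x \<in> nilradical R" for x
  proof -
    obtain n :: nat where n: "x \<in> carrier R" "x [^] n = \<zero>" using x by (auto simp: nilradical_def)
    have "x [^] (p ^ n) = x [^] n \<otimes> x [^] (p ^ n - n)" using n(1) le_p_power[of n] by (simp add: nat_pow_mult)
    then have "x \<in> Y n" using n by (simp add: Y_def)
    then show ?thesis using k by auto
  qed
  then have "nilradical R = Y k" by (auto simp: Y_def nilradical_def)
  then show ?thesis unfolding Y_def by blast
qed

lemma nilradical_ideal: "ideal (nilradical R) R"
proof -
  obtain k where "nilradical R = {x \<in> carrier R. \<one> \<otimes> x [^] (p ^ k) \<in> {\<zero>}}"
    using nilradical_eq_frobenius_kernel by (auto cong: conj_cong)
  then show ?thesis using frobenius_preimage_ideal[OF zeroideal one_closed] by simp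
qed

lemma multipliers_mod_nilradical:
  assumes I: "ideal I R" and x: "x \<in> carrier R"
    and c: "c \<in> multipliers R p (frobenius_powers_mod R p (nilradical R) I) x"
  shows "\<exists>k. c [^] (p ^ k) \<in> multipliers R p (frobenius_powers R p I) x"
proof -
  obtain k where k: "nilradical R = {x \<in> carrier R. x [^] (p ^ k) = \<zero>}"
    using nilradical_eq_frobenius_kernel by blast
  obtain e\<^sub>0 where c_carrier: "c \<in> carrier R"
    and e\<^sub>0: "\<And>e. e \<ge> e\<^sub>0 \<Longrightarrow> c \<otimes> x [^] (p ^ e) \<in> frobenius_powers_mod R p (nilradical R) I e"
    using c by (auto simp: multipliers_def eventually_sequentially)
  have "c [^] (p ^ k) \<otimes> x [^] (p ^ (e + k)) \<in> frobenius_powers R p I (e + k)" if e: "e \<ge> e\<^sub>0" for e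
  proof -
    obtain i n where i: "i \<in> frobenius_powers R p I e" and n: "n \<in> nilradical R"
      and eq: "c \<otimes> x [^] (p ^ e) = i \<oplus> n" using e\<^sub>0[OF e] by (rule set_add_memE)
    have i_carrier: "i \<in> carrier R" using i ideal_subset[OF frob_ideal_ideal[OF I]] by auto
    have "c [^] (p ^ k) \<otimes> x [^] (p ^ (e + k)) = (c \<otimes> x [^] (p ^ e)) [^] (p ^ k)"
      using c_carrier x by (simp add: nat_pow_distrib nat_pow_pow power_add)
    also have "\<dots> = i [^] (p ^ k)" unfolding eq using i_carrier n k by (simp add: frobenius_add)
    finally show ?thesis using frob_ideal_pow[OF I i] by simp
  qed
  then have "c [^] (p ^ k) \<otimes> x [^] (p ^ e) \<in> frobenius_powers R p I e" if "e \<ge> e\<^sub>0 + k" for e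
    using that le_Suc_ex[of k e] by (metis add.commute add_le_cancel_right add_leD2)
  then show ?thesis using c_carrier by (auto simp: multipliers_def eventually_sequentially)
qed

lemma tight_closure_mod_minimal_primes:
  assumes I: "ideal I R" and x: "x \<in> carrier R"
    and mod_prime: "\<And>P. minimal_prime R P \<Longrightarrow>
      x \<in> multiplier_closure R p (carrier R - P) (frobenius_powers_mod R p P I)"
  shows "x \<in> tight_closure R p I"
proof -
  let ?N = "nilradical R" and ?Min = "{P. minimal_prime R P}"
  let ?C = "multipliers R p (frobenius_powers_mod R p ?N I) x"
  have "\<not> ?C \<subseteq> P" if P: "minimal_prime R P" for P
  proof -
    have P_prime: "primeideal P R" using minimal_prime_prime[OF P] .
    obtain d where d: "d \<in> carrier R - P" "\<And>s. s \<in> P \<Longrightarrow> d \<otimes> s \<in> ?N"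
      using minimal_prime_nil_locally[OF P] by blast
    obtain b where b: "b \<in> carrier R - P" "b \<in> multipliers R p (frobenius_powers_mod R p P I) x"
      using mod_prime[OF P] by (auto simp: multiplier_closure_def)
    have "d \<otimes> b \<in> ?C"
      using d(1) by (intro multipliers_mod_mult[OF I b(2) _ d(2) ideal_subset[OF minimal_prime_ideal[OF P]] x]) auto
    then show ?thesis using prime_mult_notin[OF P_prime, of d b] d b by auto
  qed
  then have "\<exists>c \<in> ?C. \<forall>P \<in> ?Min. c \<notin> P"
    using minimal_prime_prime multipliers_ideal[OF frobenius_powers_mod_ideal[OF I nilradical_ideal] x]
    by (intro prime_avoidance finite_minimal_primes) auto
  then obtain c where c: "c \<in> ?C" "c \<in> ring_circ R" by (auto simp: ring_circ_iff multipliers_def)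
  then show ?thesis
    using multipliers_mod_nilradical[OF I x c(1)] mult_system_pow[OF ring_circ_mult_system c(2)] x
    by (auto simp: tight_closure_eq_multiplier_closure multiplier_closure_def)
qed

end

section \<open>Localization\<close>

locale localized_ring = cring R for R (structure) +
  fixes W assumes W: "mult_system R W"
begin

abbreviation L where "L \<equiv> localization R W"
abbreviation frac where "frac \<equiv> loc_frac R W"

lemma W_carrier: "w \<in> W \<Longrightarrow> w \<in> carrier R" and W_one: "\<one> \<in> W"
  and W_mult: "v \<in> W \<Longrightarrow> w \<in> W \<Longrightarrow> v \<otimes> w \<in> W"
  using W by (auto simp: mult_system_def)

lemmas W_pow = mult_system_pow[OF W]

lemma loc_rel_iff:
  "((r, s), (r', s')) \<in> loc_rel R W \<longleftrightarrow> r \<in> carrier R \<and> s \<in> W \<and> r' \<in> carrier R \<and> s' \<in> W \<and>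
     (\<exists>u \<in> W. u \<otimes> (r \<otimes> s') = u \<otimes> (r' \<otimes> s))"
proof -
  have "u \<otimes> (r \<otimes> s' \<ominus> r' \<otimes> s) = \<zero> \<longleftrightarrow> u \<otimes> (r \<otimes> s') = u \<otimes> (r' \<otimes> s)"
    if "r \<in> carrier R" "s \<in> W" "r' \<in> carrier R" "s' \<in> W" "u \<in> W" for u
  proof -
    have "u \<otimes> (r \<otimes> s' \<ominus> r' \<otimes> s) = u \<otimes> (r \<otimes> s') \<ominus> u \<otimes> (r' \<otimes> s)"
      using that W_carrier by (simp add: a_minus_def r_distr r_minus)
    then show ?thesis using that W_carrier by simp
  qed
  then show ?thesis unfolding loc_rel_def by auto
qed

lemma loc_rel_trans: "trans (loc_rel R W)"
proof (rule transI)
  fix a b c assume related: "(a, b) \<in> loc_rel R W" "(b, c) \<in> loc_rel R W"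
  obtain r s r' s' r'' s'' where pairs: "a = (r, s)" "b = (r', s')" "c = (r'', s'')" by (cases a; cases b; cases c)
  obtain u v where u: "u \<in> W" "u \<otimes> (r \<otimes> s') = u \<otimes> (r' \<otimes> s)"
    and v: "v \<in> W" "v \<otimes> (r' \<otimes> s'') = v \<otimes> (r'' \<otimes> s')"
    using related by (auto simp: pairs loc_rel_iff)
  have mem: "r \<in> carrier R" "r' \<in> carrier R" "r'' \<in> carrier R" "s \<in> W" "s' \<in> W" "s'' \<in> W"
    using related by (auto simp: pairs loc_rel_iff)
  note carriers = mem(1-3) mem(4-6)[THEN W_carrier] u(1)[THEN W_carrier] v(1)[THEN W_carrier]
  have "u \<otimes> v \<otimes> s' \<otimes> (r \<otimes> s'') = v \<otimes> s'' \<otimes> (u \<otimes> (r \<otimes> s'))" using carriers by (simp add: m_ac)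
  also have "\<dots> = u \<otimes> s \<otimes> (v \<otimes> (r' \<otimes> s''))" unfolding u(2) using carriers by (simp add: m_ac)
  also have "\<dots> = u \<otimes> v \<otimes> s' \<otimes> (r'' \<otimes> s)" unfolding v(2) using carriers by (simp add: m_ac)
  finally show "(a, c) \<in> loc_rel R W"
    unfolding pairs loc_rel_iff using mem W_mult[OF W_mult[OF u(1) v(1)] mem(5)] by auto
qed

lemma loc_rel_equiv: "equiv (carrier R \<times> W) (loc_rel R W)"
proof (rule equivI)
  show "loc_rel R W \<subseteq> (carrier R \<times> W) \<times> (carrier R \<times> W)" by (auto simp: loc_rel_def)
  show "refl_on (carrier R \<times> W) (loc_rel R W)" using W_one by (auto simp: refl_on_def loc_rel_iff)
  show "sym (loc_rel R W)"
  proof (rule symI)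
    fix a b assume "(a, b) \<in> loc_rel R W"
    then show "(b, a) \<in> loc_rel R W" by (cases a; cases b) (auto simp: loc_rel_iff dest: sym)
  qed
qed (rule loc_rel_trans)

lemma frac_eq_iff:
  assumes "r \<in> carrier R" "s \<in> W" "r' \<in> carrier R" "s' \<in> W"
  shows "frac r s = frac r' s' \<longleftrightarrow> (\<exists>u \<in> W. u \<otimes> (r \<otimes> s') = u \<otimes> (r' \<otimes> s))"
  using eq_equiv_class_iff[OF loc_rel_equiv, of "(r, s)" "(r', s')"] assms
  by (simp add: loc_frac_def loc_rel_iff)

lemma frac_eqI:
  assumes "r \<in> carrier R" "s \<in> W" "r' \<in> carrier R" "s' \<in> W" "r \<otimes> s' = r' \<otimes> s"
  shows "frac r s = frac r' s'"
  using assms W_one frac_eq_iff by auto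

lemma mem_frac_iff:
  assumes "r \<in> carrier R" "s \<in> W"
  shows "(a, b) \<in> frac r s \<longleftrightarrow> a \<in> carrier R \<and> b \<in> W \<and> frac a b = frac r s"
  using assms frac_eq_iff[of a b r s] by (auto simp: loc_frac_def loc_rel_iff dest: sym)

lemma carrier_L: "carrier L = {frac r s | r s. r \<in> carrier R \<and> s \<in> W}"
  by (auto simp: localization_def quotient_def loc_frac_def)

lemma frac_closed [simp]: "r \<in> carrier R \<Longrightarrow> s \<in> W \<Longrightarrow> frac r s \<in> carrier L"
  by (auto simp: carrier_L)

lemma carrier_L_cases:
  assumes "x \<in> carrier L"
  obtains r s where "r \<in> carrier R" "s \<in> W" "x = frac r s"
  using assms by (auto simp: carrier_L)

lemma mult_frac_cong:
  assumes "a \<in> carrier R" "b \<in> W" "a' \<in> carrier R" "b' \<in> W" "frac a b = frac r s" "frac a' b' = frac r' s'"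
    and "r \<in> carrier R" "s \<in> W" "r' \<in> carrier R" "s' \<in> W"
  shows "frac (a \<otimes> a') (b \<otimes> b') = frac (r \<otimes> r') (s \<otimes> s')"
proof -
  obtain u v where u: "u \<in> W" "u \<otimes> (a \<otimes> s) = u \<otimes> (r \<otimes> b)"
    and v: "v \<in> W" "v \<otimes> (a' \<otimes> s') = v \<otimes> (r' \<otimes> b')"
    using assms frac_eq_iff by auto
  note carriers = assms(1,3,7,9) assms(2,4,8,10)[THEN W_carrier] u(1)[THEN W_carrier] v(1)[THEN W_carrier]
  have "u \<otimes> v \<otimes> (a \<otimes> a' \<otimes> (s \<otimes> s')) = (u \<otimes> (a \<otimes> s)) \<otimes> (v \<otimes> (a' \<otimes> s'))"
    using carriers by (simp add: m_ac)
  also have "\<dots> = u \<otimes> v \<otimes> (r \<otimes> r' \<otimes> (b \<otimes> b'))" unfolding u(2) v(2) using carriers by (simp add: m_ac)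
  finally show ?thesis using assms W_mult u(1) v(1) by (subst frac_eq_iff) auto
qed

lemma add_frac_cong:
  assumes "a \<in> carrier R" "b \<in> W" "a' \<in> carrier R" "b' \<in> W" "frac a b = frac r s" "frac a' b' = frac r' s'"
    and "r \<in> carrier R" "s \<in> W" "r' \<in> carrier R" "s' \<in> W"
  shows "frac (a \<otimes> b' \<oplus> a' \<otimes> b) (b \<otimes> b') = frac (r \<otimes> s' \<oplus> r' \<otimes> s) (s \<otimes> s')"
proof -
  obtain u v where u: "u \<in> W" "u \<otimes> (a \<otimes> s) = u \<otimes> (r \<otimes> b)"
    and v: "v \<in> W" "v \<otimes> (a' \<otimes> s') = v \<otimes> (r' \<otimes> b')"
    using assms frac_eq_iff by auto
  note carriers = assms(1,3,7,9) assms(2,4,8,10)[THEN W_carrier] u(1)[THEN W_carrier] v(1)[THEN W_carrier]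
  have "u \<otimes> v \<otimes> ((a \<otimes> b' \<oplus> a' \<otimes> b) \<otimes> (s \<otimes> s')) =
      (u \<otimes> (a \<otimes> s)) \<otimes> (v \<otimes> b' \<otimes> s') \<oplus> (v \<otimes> (a' \<otimes> s')) \<otimes> (u \<otimes> b \<otimes> s)"
    using carriers by (simp add: l_distr r_distr m_ac)
  also have "\<dots> = u \<otimes> v \<otimes> ((r \<otimes> s' \<oplus> r' \<otimes> s) \<otimes> (b \<otimes> b'))"
    unfolding u(2) v(2) using carriers by (simp add: l_distr r_distr m_ac)
  finally show ?thesis using assms W_mult u(1) v(1) W_carrier by (subst frac_eq_iff) auto
qed

lemma mult_frac:
  assumes "r \<in> carrier R" "s \<in> W" "r' \<in> carrier R" "s' \<in> W"
  shows "frac r s \<otimes>\<^bsub>L\<^esub> frac r' s' = frac (r \<otimes> r') (s \<otimes> s')"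
proof -
  have "frac (a \<otimes> a') (b \<otimes> b') = frac (r \<otimes> r') (s \<otimes> s')"
    if "(a, b) \<in> frac r s" "(a', b') \<in> frac r' s'" for a b a' b'
    using that mult_frac_cong[OF _ _ _ _ _ _ assms] mem_frac_iff assms by meson
  moreover have "(r, s) \<in> frac r s" "(r', s') \<in> frac r' s'" using assms mem_frac_iff by auto
  ultimately have "{frac (a \<otimes> a') (b \<otimes> b') | a b a' b'. (a, b) \<in> frac r s \<and> (a', b') \<in> frac r' s'} =
      {frac (r \<otimes> r') (s \<otimes> s')}" by blast
  then show ?thesis by (simp add: localization_def)
qed

lemma add_frac:
  assumes "r \<in> carrier R" "s \<in> W" "r' \<in> carrier R" "s' \<in> W"
  shows "frac r s \<oplus>\<^bsub>L\<^esub> frac r' s' = frac (r \<otimes> s' \<oplus> r' \<otimes> s) (s \<otimes> s')"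
proof -
  have "frac (a \<otimes> b' \<oplus> a' \<otimes> b) (b \<otimes> b') = frac (r \<otimes> s' \<oplus> r' \<otimes> s) (s \<otimes> s')"
    if "(a, b) \<in> frac r s" "(a', b') \<in> frac r' s'" for a b a' b'
    using that add_frac_cong[OF _ _ _ _ _ _ assms] mem_frac_iff assms by meson
  moreover have "(r, s) \<in> frac r s" "(r', s') \<in> frac r' s'" using assms mem_frac_iff by auto
  ultimately have "{frac (a \<otimes> b' \<oplus> a' \<otimes> b) (b \<otimes> b') | a b a' b'. (a, b) \<in> frac r s \<and> (a', b') \<in> frac r' s'} =
      {frac (r \<otimes> s' \<oplus> r' \<otimes> s) (s \<otimes> s')}" by blast
  then show ?thesis by (simp add: localization_def)
qed

lemma one_L: "\<one>\<^bsub>L\<^esub> = frac \<one> \<one>" and zero_L: "\<zero>\<^bsub>L\<^esub> = frac \<zero> \<one>"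
  by (simp_all add: localization_def)

lemma L_abelian_group: "abelian_group L"
proof (rule abelian_groupI)
  fix x y assume "x \<in> carrier L" "y \<in> carrier L"
  then show "x \<oplus>\<^bsub>L\<^esub> y \<in> carrier L" "x \<oplus>\<^bsub>L\<^esub> y = y \<oplus>\<^bsub>L\<^esub> x"
    by (elim carrier_L_cases; simp add: add_frac W_carrier W_mult m_ac a_ac)+
next
  fix x y z assume "x \<in> carrier L" "y \<in> carrier L" "z \<in> carrier L"
  then show "x \<oplus>\<^bsub>L\<^esub> y \<oplus>\<^bsub>L\<^esub> z = x \<oplus>\<^bsub>L\<^esub> (y \<oplus>\<^bsub>L\<^esub> z)"
    by (elim carrier_L_cases) (simp add: add_frac W_carrier W_mult l_distr r_distr m_ac a_ac)
next
  fix x assume "x \<in> carrier L"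
  then show "\<zero>\<^bsub>L\<^esub> \<oplus>\<^bsub>L\<^esub> x = x"
    by (elim carrier_L_cases) (simp add: zero_L add_frac W_carrier W_one)
next
  fix x assume "x \<in> carrier L"
  then obtain r s where x: "r \<in> carrier R" "s \<in> W" "x = frac r s" by (rule carrier_L_cases)
  have "frac (\<ominus> r) s \<oplus>\<^bsub>L\<^esub> x = frac (\<ominus> r \<otimes> s \<oplus> r \<otimes> s) (s \<otimes> s)" using x by (simp add: add_frac)
  also have "\<dots> = \<zero>\<^bsub>L\<^esub>"
    unfolding zero_L using x W_carrier W_mult W_one by (intro frac_eqI) (auto simp: l_minus l_neg)
  finally show "\<exists>y\<in>carrier L. y \<oplus>\<^bsub>L\<^esub> x = \<zero>\<^bsub>L\<^esub>" using x by (intro bexI[of _ "frac (\<ominus> r) s"]) auto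
qed (simp add: zero_L W_one)

lemma L_comm_monoid: "Group.comm_monoid L"
proof (rule comm_monoidI)
  fix x y assume "x \<in> carrier L" "y \<in> carrier L"
  then show "x \<otimes>\<^bsub>L\<^esub> y \<in> carrier L" "x \<otimes>\<^bsub>L\<^esub> y = y \<otimes>\<^bsub>L\<^esub> x"
    by (elim carrier_L_cases; simp add: mult_frac W_carrier W_mult m_comm)+
next
  fix x y z assume "x \<in> carrier L" "y \<in> carrier L" "z \<in> carrier L"
  then show "x \<otimes>\<^bsub>L\<^esub> y \<otimes>\<^bsub>L\<^esub> z = x \<otimes>\<^bsub>L\<^esub> (y \<otimes>\<^bsub>L\<^esub> z)"
    by (elim carrier_L_cases) (simp add: mult_frac W_carrier W_mult m_ac)
next
  fix x assume "x \<in> carrier L"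
  then show "\<one>\<^bsub>L\<^esub> \<otimes>\<^bsub>L\<^esub> x = x"
    by (elim carrier_L_cases) (simp add: one_L mult_frac W_carrier W_one)
qed (simp add: one_L W_one)

lemma L_cring: "cring L"
proof (rule cringI[OF L_abelian_group L_comm_monoid])
  fix x y z assume "x \<in> carrier L" "y \<in> carrier L" "z \<in> carrier L"
  then obtain r s r' s' r'' s'' where fracs: "r \<in> carrier R" "r' \<in> carrier R" "r'' \<in> carrier R"
      "s \<in> W" "s' \<in> W" "s'' \<in> W" "x = frac r s" "y = frac r' s'" "z = frac r'' s''"
    by (elim carrier_L_cases)
  note carriers = fracs(1-3) fracs(4-6)[THEN W_carrier]
  have "(x \<oplus>\<^bsub>L\<^esub> y) \<otimes>\<^bsub>L\<^esub> z = frac ((r \<otimes> s' \<oplus> r' \<otimes> s) \<otimes> r'') (s \<otimes> s' \<otimes> s'')"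
    using fracs carriers W_mult by (simp add: add_frac mult_frac)
  also have "\<dots> = frac (r \<otimes> r'' \<otimes> (s' \<otimes> s'') \<oplus> r' \<otimes> r'' \<otimes> (s \<otimes> s'')) (s \<otimes> s'' \<otimes> (s' \<otimes> s''))"
    using fracs carriers W_mult by (intro frac_eqI) (auto simp: l_distr r_distr m_ac)
  also have "\<dots> = x \<otimes>\<^bsub>L\<^esub> z \<oplus>\<^bsub>L\<^esub> y \<otimes>\<^bsub>L\<^esub> z"
    using fracs carriers W_mult by (simp add: add_frac mult_frac)
  finally show "(x \<oplus>\<^bsub>L\<^esub> y) \<otimes>\<^bsub>L\<^esub> z = x \<otimes>\<^bsub>L\<^esub> z \<oplus>\<^bsub>L\<^esub> y \<otimes>\<^bsub>L\<^esub> z" .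
qed

lemma loc_map_hom: "loc_map R W \<in> ring_hom R L"
  by (rule ring_hom_memI) (auto simp: loc_map_def W_one mult_frac add_frac one_L)

end

sublocale localized_ring \<subseteq> L: cring "localization R W"
  by (rule L_cring)

sublocale localized_ring \<subseteq> loc: ring_hom_cring R "localization R W" "loc_map R W"
  by unfold_locales (rule loc_map_hom)

context localized_ring
begin

lemma pow_frac: "r \<in> carrier R \<Longrightarrow> s \<in> W \<Longrightarrow> frac r s [^]\<^bsub>L\<^esub> (n::nat) = frac (r [^] n) (s [^] n)"
  by (induction n) (simp_all add: one_L mult_frac W_pow)

lemma frac_eq_mult_loc_map: "r \<in> carrier R \<Longrightarrow> s \<in> W \<Longrightarrow> frac r s = frac \<one> s \<otimes>\<^bsub>L\<^esub> loc_map R W r"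
  by (simp add: loc_map_def mult_frac W_one W_carrier)

lemma loc_map_eq_mult_frac:
  assumes "r \<in> carrier R" "s \<in> W" shows "loc_map R W r = loc_map R W s \<otimes>\<^bsub>L\<^esub> frac r s"
proof -
  have "loc_map R W s \<otimes>\<^bsub>L\<^esub> frac r s = frac (s \<otimes> r) s"
    using assms by (simp add: loc_map_def mult_frac W_one W_carrier)
  also have "\<dots> = frac r \<one>" using assms W_carrier W_one by (intro frac_eqI) (auto simp: m_comm)
  finally show ?thesis by (simp add: loc_map_def)
qed

lemma ext_ideal_ideal: assumes "ideal J R" shows "ideal (ext_ideal R W J) L"
  unfolding ext_ideal_def using ideal_subset[OF assms] by (intro L.genideal_ideal) auto

lemma loc_map_mem_ext_ideal: "ideal J R \<Longrightarrow> j \<in> J \<Longrightarrow> loc_map R W j \<in> ext_ideal R W J"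
  unfolding ext_ideal_def using L.genideal_self[of "loc_map R W ` J"] ideal_subset by blast

lemma frac_mem_ideal_iff:
  assumes q: "ideal q L" and r: "r \<in> carrier R" "s \<in> W"
  shows "frac r s \<in> q \<longleftrightarrow> loc_map R W r \<in> q"
proof
  assume "frac r s \<in> q"
  then have "loc_map R W s \<otimes>\<^bsub>L\<^esub> frac r s \<in> q" using ideal.I_l_closed[OF q] r W_carrier by simp
  then show "loc_map R W r \<in> q" by (simp only: loc_map_eq_mult_frac[OF r, symmetric])
next
  assume "loc_map R W r \<in> q"
  then have "frac \<one> s \<otimes>\<^bsub>L\<^esub> loc_map R W r \<in> q" using ideal.I_l_closed[OF q] r by simp
  then show "frac r s \<in> q" by (simp only: frac_eq_mult_loc_map[OF r, symmetric])
qed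

definition contraction :: "('a \<times> 'a) set set \<Rightarrow> 'a set" where "contraction q = {r \<in> carrier R. loc_map R W r \<in> q}"

lemma contraction_ideal: "ideal q L \<Longrightarrow> ideal (contraction q) R"
  unfolding contraction_def by (rule loc.ring.ideal_vimage)

lemma contraction_subsetD:
  assumes "ideal q L" "ideal q' L" "contraction q \<subseteq> contraction q'" shows "q \<subseteq> q'"
proof
  fix x assume x: "x \<in> q"
  then obtain r s where "r \<in> carrier R" "s \<in> W" "x = frac r s"
    using L.ideal_subset[OF assms(1)] by (blast elim: carrier_L_cases)
  then show "x \<in> q'" using x assms by (auto simp: contraction_def frac_mem_ideal_iff)
qed

lemma fractions_ideal:
  assumes J: "ideal J R" shows "ideal {frac r s | r s. r \<in> J \<and> s \<in> W} L" (is "ideal ?E L")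
  unfolding L.ideal_iff_subalgebra
proof (rule L.subalgebraI[OF L.carrier_is_subring])
  note J_carrier = subsetD[OF ideal_subset[OF J]]
  show "?E \<subseteq> carrier L" using J_carrier by auto
  show "\<zero>\<^bsub>L\<^esub> \<in> ?E" unfolding zero_L using ideal_zero[OF J] W_one by auto
  fix a b assume "a \<in> ?E" "b \<in> ?E"
  then obtain r s r' s' where fracs: "a = frac r s" "b = frac r' s'" "r \<in> J" "r' \<in> J" "s \<in> W" "s' \<in> W" by auto
  then have "a \<oplus>\<^bsub>L\<^esub> b = frac (r \<otimes> s' \<oplus> r' \<otimes> s) (s \<otimes> s')" using J_carrier by (simp add: add_frac)
  moreover have "r \<otimes> s' \<oplus> r' \<otimes> s \<in> J"
    using fracs W_carrier by (intro ideal_add[OF J] ideal.I_r_closed[OF J])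
  ultimately show "a \<oplus>\<^bsub>L\<^esub> b \<in> ?E" using W_mult fracs by blast
next
  note J_carrier = subsetD[OF ideal_subset[OF J]]
  fix x a assume "x \<in> carrier L" "a \<in> ?E"
  then obtain r s r' s' where fracs: "x = frac r s" "a = frac r' s'" "r \<in> carrier R" "r' \<in> J" "s \<in> W" "s' \<in> W"
    by (auto elim!: carrier_L_cases)
  then have "x \<otimes>\<^bsub>L\<^esub> a = frac (r \<otimes> r') (s \<otimes> s')" using J_carrier by (simp add: mult_frac)
  then show "x \<otimes>\<^bsub>L\<^esub> a \<in> ?E" using fracs W_mult ideal.I_l_closed[OF J] by blast
qed

lemma ext_ideal_eq:
  assumes J: "ideal J R"
  shows "ext_ideal R W J = {frac r s | r s. r \<in> saturation R W J \<and> s \<in> W}" (is "_ = ?E")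
proof
  have "loc_map R W ` J \<subseteq> ?E"
    using saturation_upper[OF W ideal_subset[OF J]] W_one by (auto simp: loc_map_def)
  then show "ext_ideal R W J \<subseteq> ?E"
    unfolding ext_ideal_def by (rule L.genideal_minimal[OF fractions_ideal[OF saturation_ideal[OF J W]]])
  show "?E \<subseteq> ext_ideal R W J"
  proof
    fix a assume "a \<in> ?E"
    then obtain r s w where a: "a = frac r s" and r: "r \<in> carrier R" "s \<in> W" "w \<in> W" "w \<otimes> r \<in> J"
      by (auto elim!: saturationE)
    then have "frac r s = frac (w \<otimes> r) (w \<otimes> s)" using W_carrier W_mult by (intro frac_eqI) (auto simp: m_ac)
    then show "a \<in> ext_ideal R W J"
      unfolding a using r W_mult W_carrier loc_map_mem_ext_ideal[OF J]
      by (simp add: frac_mem_ideal_iff[OF ext_ideal_ideal[OF J]] del: loc.hom_mult)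
  qed
qed

lemma frac_mem_ext_ideal_iff:
  assumes J: "ideal J R" and r: "r \<in> carrier R" "s \<in> W"
  shows "frac r s \<in> ext_ideal R W J \<longleftrightarrow> r \<in> saturation R W J"
proof
  assume "frac r s \<in> ext_ideal R W J"
  then obtain r' s' where r': "frac r s = frac r' s'" "r' \<in> saturation R W J" "s' \<in> W"
    by (auto simp: ext_ideal_eq[OF J])
  note sat = saturation_ideal[OF J W]
  have "r' \<in> carrier R" using ideal_subset[OF sat] r'(2) by auto
  then obtain u where u: "u \<in> W" "u \<otimes> (r \<otimes> s') = u \<otimes> (r' \<otimes> s)"
    using frac_eq_iff[OF r _ r'(3)] r'(1) by blast
  have "(u \<otimes> s') \<otimes> r = (u \<otimes> s) \<otimes> r'" using u r r' \<open>r' \<in> carrier R\<close> W_carrier by (simp add: m_ac)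
  also have "\<dots> \<in> saturation R W J" using u(1) r(2) W_carrier by (intro ideal.I_l_closed[OF sat r'(2)]) auto
  finally have "r \<in> saturation R W (saturation R W J)"
    by (rule saturationI[OF r(1) W_mult[OF u(1) r'(3)]])
  then show "r \<in> saturation R W J" using saturation_saturation[OF W] by auto
qed (use r in \<open>auto simp: ext_ideal_eq[OF J]\<close>)

lemma contraction_ext_ideal: "ideal J R \<Longrightarrow> contraction (ext_ideal R W J) = saturation R W J"
  using frac_mem_ext_ideal_iff[OF _ _ W_one] by (auto simp: contraction_def loc_map_def elim: saturationE)

subsection \<open>Prime ideals of the localization\<close>

lemma contraction_ext_prime:
  assumes P: "primeideal P R" "P \<inter> W = {}" shows "contraction (ext_ideal R W P) = P"
proof -
  have "W \<subseteq> carrier R - P" using P(2) W_carrier by auto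
  then have "saturation R W P = P"
    using saturation_subset_prime[OF P(1) _ subset_refl]
      saturation_upper[OF W ideal_subset[OF primeideal.axioms(1)[OF P(1)]]] by auto
  then show ?thesis by (simp add: contraction_ext_ideal[OF primeideal.axioms(1)[OF P(1)]])
qed

lemma contraction_prime:
  assumes q: "primeideal q L" shows "primeideal (contraction q) R" "contraction q \<inter> W = {}"
proof -
  show "primeideal (contraction q) R"
    unfolding contraction_def by (rule loc.ring.primeideal_vimage[OF is_cring q])
  have "w \<notin> contraction q" if w: "w \<in> W" for w
  proof
    assume "w \<in> contraction q"
    then have "frac w w \<in> q"
      using w W_carrier frac_mem_ideal_iff[OF primeideal.axioms(1)[OF q]] by (simp add: contraction_def)
    moreover have "frac w w = \<one>\<^bsub>L\<^esub>" unfolding one_L using w W_carrier W_one by (intro frac_eqI) auto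
    ultimately show False using L.prime_one_notin[OF q] by simp
  qed
  then show "contraction q \<inter> W = {}" by auto
qed

lemma ext_prime:
  assumes P: "primeideal P R" "P \<inter> W = {}" shows "primeideal (ext_ideal R W P) L"
proof (rule primeidealI[OF ext_ideal_ideal[OF primeideal.axioms(1)[OF P(1)]] L_cring])
  note ext = ext_ideal_ideal[OF primeideal.axioms(1)[OF P(1)]]
  have frac_iff: "frac r s \<in> ext_ideal R W P \<longleftrightarrow> r \<in> P" if "r \<in> carrier R" "s \<in> W" for r s
    using frac_mem_ideal_iff[OF ext that] contraction_ext_prime[OF P] that by (auto simp: contraction_def)
  have "frac \<one> \<one> \<notin> ext_ideal R W P" using frac_iff[OF _ W_one] prime_one_notin[OF P(1)] by simp
  then show "carrier L \<noteq> ext_ideal R W P" using frac_closed[OF one_closed W_one] by blast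
  fix x y assume "x \<in> carrier L" "y \<in> carrier L" and xy: "x \<otimes>\<^bsub>L\<^esub> y \<in> ext_ideal R W P"
  then obtain r s r' s' where fracs: "x = frac r s" "y = frac r' s'" "r \<in> carrier R" "r' \<in> carrier R" "s \<in> W" "s' \<in> W"
    by (elim carrier_L_cases)
  then have "r \<otimes> r' \<in> P" using xy W_mult by (simp add: mult_frac frac_iff)
  then have "r \<in> P \<or> r' \<in> P" using prime_mult_notin[OF P(1)] fracs by auto
  then show "x \<in> ext_ideal R W P \<or> y \<in> ext_ideal R W P" using frac_iff fracs by auto
qed

lemma contraction_minimal_prime:
  assumes q: "minimal_prime L q" shows "minimal_prime R (contraction q)"
  unfolding minimal_prime_def
proof (intro conjI allI impI)
  have q_prime: "primeideal q L" using L.minimal_prime_prime[OF q] .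
  show "primeideal (contraction q) R" by (rule contraction_prime[OF q_prime])
  fix Q assume Q: "primeideal Q R \<and> Q \<subseteq> contraction q"
  then have QW: "primeideal Q R" "Q \<inter> W = {}" using contraction_prime(2)[OF q_prime] by auto
  note ext = ext_prime[OF QW]
  have "ext_ideal R W Q \<subseteq> q"
    using Q contraction_ext_prime[OF QW]
    by (intro contraction_subsetD primeideal.axioms(1)[OF ext] primeideal.axioms(1)[OF q_prime]) auto
  then have "ext_ideal R W Q = q" using q ext by (simp add: minimal_prime_def)
  then show "Q = contraction q" using contraction_ext_prime[OF QW] by simp
qed

lemma ext_minimal_prime:
  assumes P: "minimal_prime R P" "P \<inter> W = {}" shows "minimal_prime L (ext_ideal R W P)"
  unfolding minimal_prime_def
proof (intro conjI allI impI)
  note P_prime = minimal_prime_prime[OF P(1)]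
  note ext = ext_prime[OF P_prime P(2)]
  show "primeideal (ext_ideal R W P) L" by (rule ext)
  fix q assume q: "primeideal q L \<and> q \<subseteq> ext_ideal R W P"
  then have "contraction q \<subseteq> P" using contraction_ext_prime[OF P_prime P(2)] by (auto simp: contraction_def)
  then have "contraction q = P" using P(1) contraction_prime(1)[of q] q by (simp add: minimal_prime_def)
  then have "ext_ideal R W P \<subseteq> q"
    using q contraction_ext_prime[OF P_prime P(2)]
    by (intro contraction_subsetD primeideal.axioms(1)[OF ext] primeideal.axioms(1)) auto
  then show "q = ext_ideal R W P" using q by auto
qed

lemma loc_map_ring_circ: assumes "c \<in> ring_circ R" shows "loc_map R W c \<in> ring_circ L"
  using assms contraction_minimal_prime by (auto simp: L.ring_circ_iff ring_circ_iff contraction_def)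

lemma ring_circ_frac_notin:
  assumes c: "frac c t \<in> ring_circ L" "c \<in> carrier R" "t \<in> W" and P: "minimal_prime R P" "P \<inter> W = {}"
  shows "c \<notin> P"
proof
  assume "c \<in> P"
  then have "frac c t \<in> ext_ideal R W P"
    using c(2,3) minimal_prime_ideal[OF P(1)] loc_map_mem_ext_ideal
    by (simp add: frac_mem_ideal_iff[OF ext_ideal_ideal])
  then show False using ext_minimal_prime[OF P] c(1) by (auto simp: L.ring_circ_iff)
qed

end

subsection \<open>Tight closure in the localization\<close>

locale localized_char_p = localized_ring R W + prime_char R p for R (structure) and W p

sublocale localized_char_p \<subseteq> L: prime_char "localization R W" p
proof unfold_locales
  have "add_pow L n \<one>\<^bsub>L\<^esub> = loc_map R W (add_pow R n \<one>)" for n :: nat by (induction n) simp_all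
  then show "char_p L p" using char by (simp add: char_p_def)
qed

context localized_char_p
begin

lemma frob_ideal_ext_ideal:
  assumes I: "ideal I R"
  shows "frob_ideal L q (ext_ideal R W I) = ext_ideal R W (frob_ideal R q I)"
proof
  note frob = frob_ideal_ideal[OF I, of q]
  show "frob_ideal L q (ext_ideal R W I) \<subseteq> ext_ideal R W (frob_ideal R q I)"
  proof (rule L.frob_ideal_minimal[OF ext_ideal_ideal[OF frob]])
    fix x assume "x \<in> ext_ideal R W I"
    then obtain r s w where x: "x = frac r s" "r \<in> carrier R" "s \<in> W" "w \<in> W" "w \<otimes> r \<in> I"
      by (auto simp: ext_ideal_eq[OF I] elim!: saturationE)
    have "w [^] q \<otimes> r [^] q = (w \<otimes> r) [^] q" using x W_carrier by (simp add: nat_pow_distrib)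
    also have "\<dots> \<in> frob_ideal R q I" by (rule pow_mem_frob_ideal[OF I x(5)])
    finally have "r [^] q \<in> saturation R W (frob_ideal R q I)"
      using x by (intro saturationI[OF _ W_pow]) auto
    then show "x [^]\<^bsub>L\<^esub> q \<in> ext_ideal R W (frob_ideal R q I)"
      using x by (simp add: pow_frac frac_mem_ext_ideal_iff[OF frob] W_pow)
  qed
  note frob_L = L.frob_ideal_ideal[OF ext_ideal_ideal[OF I], of q]
  have "frob_ideal R q I \<subseteq> contraction (frob_ideal L q (ext_ideal R W I))"
  proof (rule frob_ideal_minimal[OF contraction_ideal[OF frob_L]])
    fix i assume i: "i \<in> I"
    then have "loc_map R W (i [^] q) = loc_map R W i [^]\<^bsub>L\<^esub> q" "i \<in> carrier R"
      using ideal_subset[OF I] loc.ring.hom_nat_pow by auto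
    then show "i [^] q \<in> contraction (frob_ideal L q (ext_ideal R W I))"
      using L.pow_mem_frob_ideal[OF ext_ideal_ideal[OF I] loc_map_mem_ext_ideal[OF I i]]
      by (simp add: contraction_def)
  qed
  then show "ext_ideal R W (frob_ideal R q I) \<subseteq> frob_ideal L q (ext_ideal R W I)"
    unfolding ext_ideal_def[of R W "frob_ideal R q I"]
    by (intro L.genideal_minimal[OF frob_L]) (auto simp: contraction_def)
qed

lemma frac_mem_multipliers_iff:
  assumes I: "ideal I R" and c: "c \<in> carrier R" "t \<in> W" and x: "x \<in> carrier R" "s \<in> W"
  shows "frac c t \<in> multipliers L p (frobenius_powers L p (ext_ideal R W I)) (frac x s) \<longleftrightarrow>
    c \<in> multipliers R p (\<lambda>e. saturation R W (frobenius_powers R p I e)) x"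
proof -
  have "frac c t \<otimes>\<^bsub>L\<^esub> frac x s [^]\<^bsub>L\<^esub> (p ^ e) \<in> frobenius_powers L p (ext_ideal R W I) e \<longleftrightarrow>
      c \<otimes> x [^] (p ^ e) \<in> saturation R W (frobenius_powers R p I e)" for e
    using c x W_pow W_mult
    by (simp add: pow_frac mult_frac frob_ideal_ext_ideal[OF I] frac_mem_ext_ideal_iff frob_ideal_ideal[OF I])
  then show ?thesis using c by (simp add: multipliers_def)
qed

lemma ext_tight_closure_subset:
  assumes I: "ideal I R"
  shows "ext_ideal R W (tight_closure R p I) \<subseteq> tight_closure L p (ext_ideal R W I)"
  unfolding ext_ideal_def[of R W "tight_closure R p I"]
proof (rule L.genideal_minimal[OF L.tight_closure_ideal[OF ext_ideal_ideal[OF I]]], rule subsetI)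
  fix a assume "a \<in> loc_map R W ` tight_closure R p I"
  then obtain x c where x: "a = loc_map R W x" "x \<in> carrier R" "c \<in> ring_circ R"
      "c \<in> multipliers R p (frobenius_powers R p I) x"
    by (auto simp: tight_closure_eq_multiplier_closure multiplier_closure_def)
  have "c \<in> multipliers R p (\<lambda>e. saturation R W (frobenius_powers R p I e)) x"
    using saturation_upper[OF W ideal_subset[OF frob_ideal_ideal[OF I]]]
    by (rule subsetD[OF multipliers_mono x(4)])
  moreover have "c \<in> carrier R" using x(3) by (simp add: ring_circ_iff)
  ultimately have "loc_map R W c \<in> multipliers L p (frobenius_powers L p (ext_ideal R W I)) a"
    using x(1,2) frac_mem_multipliers_iff[OF I _ W_one _ W_one] by (simp add: loc_map_def)
  then show "a \<in> tight_closure L p (ext_ideal R W I)"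
    using loc_map_ring_circ[OF x(3)] x(1,2)
    by (auto simp: L.tight_closure_eq_multiplier_closure multiplier_closure_def)
qed

lemma frac_mem_tight_closureD:
  assumes I: "ideal I R" and x: "x \<in> carrier R" "s \<in> W"
    and mem: "frac x s \<in> tight_closure L p (ext_ideal R W I)"
  obtains c where "c \<in> multipliers R p (\<lambda>e. saturation R W (frobenius_powers R p I e)) x"
    and "\<And>P. minimal_prime R P \<Longrightarrow> P \<inter> W = {} \<Longrightarrow> c \<notin> P"
proof -
  obtain d where d: "d \<in> ring_circ L" "d \<in> multipliers L p (frobenius_powers L p (ext_ideal R W I)) (frac x s)"
    using mem by (auto simp: L.tight_closure_eq_multiplier_closure multiplier_closure_def)
  then obtain c t where c: "c \<in> carrier R" "t \<in> W" "d = frac c t"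
    using carrier_L_cases[of d] by (auto simp: L.ring_circ_iff)
  show thesis
    using that[of c] d c frac_mem_multipliers_iff[OF I c(1,2) x] ring_circ_frac_notin by auto
qed

end

section \<open>Complete integral closure\<close>

definition complete_integral_closure :: "('k, 'm) ring_scheme \<Rightarrow> 'k set \<Rightarrow> 'k set" where
  "complete_integral_closure K D =
    {t \<in> carrier K. \<exists>c \<in> D - {\<zero>\<^bsub>K\<^esub>}. \<forall>n::nat. c \<otimes>\<^bsub>K\<^esub> t [^]\<^bsub>K\<^esub> n \<in> D}"

primrec power_span :: "('k, 'm) ring_scheme \<Rightarrow> 'k set \<Rightarrow> 'k \<Rightarrow> nat \<Rightarrow> 'k set" where
  "power_span K D y 0 = {\<zero>\<^bsub>K\<^esub>}"
| "power_span K D y (Suc n) = power_span K D y n <+>\<^bsub>K\<^esub> (\<otimes>\<^bsub>K\<^esub>) (y [^]\<^bsub>K\<^esub> n) ` D"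

declare power_span.simps(2) [simp del]

context cring
begin

context
  fixes D y assumes D: "subring D R" and y: "y \<in> carrier R"
begin

lemma power_span_subalgebra: "subalgebra D (power_span R D y n) R"
proof (induction n)
  case 0
  then show ?case using subringE(1)[OF D] by (auto intro!: subalgebraI[OF D])
next
  case (Suc n)
  then show ?case
    using y by (simp add: power_span.simps set_add_subalgebra mult_image_subalgebra subring_is_subalgebra D)
qed

lemma power_span_carrier: "m \<in> power_span R D y n \<Longrightarrow> m \<in> carrier R"
  using subalgebra_in_carrier[OF power_span_subalgebra] by auto

lemma power_span_least:
  assumes M: "subalgebra D M R" and "\<And>i. i < n \<Longrightarrow> y [^] i \<in> M"
  shows "power_span R D y n \<subseteq> M"
  using assms(2)
proof (induction n)
  case 0
  then show ?case using subalgebra_zero[OF M] by simp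
next
  case (Suc n)
  have "y [^] n \<otimes> d \<in> M" if "d \<in> D" for d
    using subalgebra.smult_closed[OF M that Suc.prems[of n]] subringE(1)[OF D] that y
    by (auto simp: m_comm)
  then show ?case unfolding power_span.simps using Suc by (intro set_add_least[OF M]) auto
qed

lemma power_span_Suc_mono: "power_span R D y n \<subseteq> power_span R D y (Suc n)"
  using set_add_upper1[OF power_span_subalgebra mult_image_subalgebra[OF D subring_is_subalgebra[OF D]]] y
  by (simp add: power_span.simps)

lemma power_span_mono: "n \<le> k \<Longrightarrow> power_span R D y n \<subseteq> power_span R D y k"
  by (rule lift_Suc_mono_le[of "power_span R D y", OF power_span_Suc_mono])

lemma power_in_power_span:
  assumes "i < n" shows "y [^] i \<in> power_span R D y n"
proof -
  have "y [^] i \<in> (\<otimes>) (y [^] i) ` D" using subringE(3)[OF D] y by (intro image_eqI[of _ _ \<one>]) auto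
  then have "y [^] i \<in> power_span R D y (Suc i)"
    using set_add_upper2[OF power_span_subalgebra
        mult_image_subalgebra[OF D subring_is_subalgebra[OF D] nat_pow_closed[OF y]]]
    unfolding power_span.simps by blast
  then show ?thesis using power_span_mono[of "Suc i" n] assms by auto
qed

lemma monomial_in_power_span: "d \<in> D \<Longrightarrow> i < n \<Longrightarrow> d \<otimes> y [^] i \<in> power_span R D y n"
  by (rule subalgebra.smult_closed[OF power_span_subalgebra _ power_in_power_span])

lemma power_span_times_power:
  assumes "m \<in> power_span R D y n" shows "m \<otimes> y [^] i \<in> power_span R D y (n + i)"
proof -
  have "power_span R D y n \<subseteq> colon R (power_span R D y (n + i)) (y [^] i)"
    using y power_in_power_span[of _ "n + i"]
    by (intro power_span_least colon_subalgebra D power_span_subalgebra) (auto simp: colon_def nat_pow_mult)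
  then show ?thesis using assms by (auto simp: colon_def)
qed

lemma power_span_split: "power_span R D y k \<subseteq> power_span R D y n <+> (\<otimes>) (y [^] n) ` power_span R D y k"
proof (rule power_span_least)
  note low = power_span_subalgebra[of n]
    and high = mult_image_subalgebra[OF D power_span_subalgebra nat_pow_closed[OF y]]
  show "subalgebra D (power_span R D y n <+> (\<otimes>) (y [^] n) ` power_span R D y k) R"
    by (rule set_add_subalgebra[OF D low high])
  fix i assume "i < k"
  show "y [^] i \<in> power_span R D y n <+> (\<otimes>) (y [^] n) ` power_span R D y k"
  proof (cases "i < n")
    case True
    then show ?thesis by (rule subsetD[OF set_add_upper1[OF low high] power_in_power_span])
  next
    case False
    then have split: "y [^] i = y [^] n \<otimes> y [^] (i - n)" using y by (simp add: nat_pow_mult)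
    show ?thesis
      unfolding split using \<open>i < k\<close>
      by (intro subsetD[OF set_add_upper2[OF low high] imageI[OF power_in_power_span]]) simp
  qed
qed

lemma power_span_Union_subalgebra: "subalgebra D (\<Union>n. power_span R D y n) R"
proof (rule subalgebraI[OF D])
  show "(\<Union>n. power_span R D y n) \<subseteq> carrier R" using power_span_carrier by auto
  show "\<zero> \<in> (\<Union>n. power_span R D y n)" using subalgebra_zero[OF power_span_subalgebra] by auto
  show "d \<otimes> a \<in> (\<Union>n. power_span R D y n)" if "d \<in> D" "a \<in> (\<Union>n. power_span R D y n)" for d a
    using subalgebra.smult_closed[OF power_span_subalgebra] that by blast
  fix a b assume "a \<in> (\<Union>n. power_span R D y n)" "b \<in> (\<Union>n. power_span R D y n)"
  then obtain n k where "a \<in> power_span R D y n" "b \<in> power_span R D y k" by auto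
  then have "a \<oplus> b \<in> power_span R D y (max n k)"
    using power_span_mono[of n "max n k"] power_span_mono[of k "max n k"]
    by (intro subalgebra_add[OF power_span_subalgebra]) auto
  then show "a \<oplus> b \<in> (\<Union>n. power_span R D y n)" by blast
qed

end

end

lemma (in domain) nonzero_mult_system: "subring D R \<Longrightarrow> mult_system R (D - {\<zero>})"
  unfolding mult_system_def using subringE[of D R] by (auto simp: integral_iff subset_iff)

context domain
begin

lemma complete_integral_closure_memI:
  "t \<in> carrier R \<Longrightarrow> c \<in> D - {\<zero>} \<Longrightarrow> (\<And>n::nat. c \<otimes> t [^] n \<in> D) \<Longrightarrow> t \<in> complete_integral_closure R D"
  by (auto simp: complete_integral_closure_def)

lemma subset_complete_integral_closure:
  assumes D: "subring D R" shows "D \<subseteq> complete_integral_closure R D"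
proof
  fix d assume "d \<in> D"
  then show "d \<in> complete_integral_closure R D"
    using subringE(1,3)[OF D] subring_pow_closed[OF D] by (intro complete_integral_closure_memI[of _ \<one>]) auto
qed

lemma complete_integral_closure_common_conductor:
  assumes D: "subring D R" and "finite A" "A \<subseteq> complete_integral_closure R D"
  shows "\<exists>c \<in> D - {\<zero>}. \<forall>t \<in> A. \<forall>n::nat. c \<otimes> t [^] n \<in> D"
proof -
  let ?J = "\<lambda>t. {c \<in> D. \<forall>n::nat. c \<otimes> t [^] n \<in> D}"
  have "\<exists>c \<in> D - {\<zero>}. \<forall>t \<in> A. c \<in> ?J t"
  proof (rule mult_system_meets_family[OF nonzero_mult_system[OF D] Diff_subset assms(2)])
    fix t assume t: "t \<in> A"
    note closed = subringE(2,6,7)[OF D]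
    have "t \<in> carrier R" using t assms(3) by (auto simp: complete_integral_closure_def)
    moreover have "d \<in> carrier R" if "d \<in> D" for d using that subringE(1)[OF D] by auto
    ultimately show "subalgebra D (?J t) R"
      using closed by (intro subalgebraI[OF D]) (auto simp: l_distr m_assoc)
    show "?J t \<inter> (D - {\<zero>}) \<noteq> {}" using t assms(3) by (auto simp: complete_integral_closure_def)
  qed
  then show ?thesis by blast
qed

lemma complete_integral_closure_mult:
  assumes D: "subring D R" and st: "s \<in> complete_integral_closure R D" "t \<in> complete_integral_closure R D"
  shows "s \<otimes> t \<in> complete_integral_closure R D"
proof -
  obtain c where c: "c \<in> D - {\<zero>}" "\<And>n::nat. c \<otimes> s [^] n \<in> D" "\<And>n::nat. c \<otimes> t [^] n \<in> D"
    using complete_integral_closure_common_conductor[OF D, of "{s, t}"] st by auto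
  have carriers: "c \<in> carrier R" "s \<in> carrier R" "t \<in> carrier R"
    using c(1) subringE(1)[OF D] st by (auto simp: complete_integral_closure_def)
  then have "(c \<otimes> c) \<otimes> (s \<otimes> t) [^] n = (c \<otimes> s [^] n) \<otimes> (c \<otimes> t [^] n)" for n :: nat
    by (simp add: nat_pow_distrib m_ac)
  moreover have "c \<otimes> c \<in> D - {\<zero>}" using mult_system_mult[OF nonzero_mult_system[OF D] c(1) c(1)] .
  ultimately show ?thesis
    using c(2,3) carriers subringE(6)[OF D] by (intro complete_integral_closure_memI[of _ "c \<otimes> c"]) auto
qed

lemma complete_integral_closure_add:
  assumes D: "subring D R" and st: "s \<in> complete_integral_closure R D" "t \<in> complete_integral_closure R D"
  shows "s \<oplus> t \<in> complete_integral_closure R D"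
proof -
  obtain c where c: "c \<in> D - {\<zero>}" "\<And>n::nat. c \<otimes> s [^] n \<in> D" "\<And>n::nat. c \<otimes> t [^] n \<in> D"
    using complete_integral_closure_common_conductor[OF D, of "{s, t}"] st by auto
  have carriers: "c \<in> carrier R" "s \<in> carrier R" "t \<in> carrier R"
    using c(1) subringE(1)[OF D] st by (auto simp: complete_integral_closure_def)
  have "((c \<otimes> s [^] i) \<otimes> (c \<otimes> t [^] j)) \<otimes> (s \<oplus> t) [^] n \<in> D" for i j n :: nat
  proof (induction n arbitrary: i j)
    case 0
    then show ?case using c carriers subringE(6)[OF D] by simp
  next
    case (Suc n)
    have "((c \<otimes> s [^] i) \<otimes> (c \<otimes> t [^] j)) \<otimes> (s \<oplus> t) [^] (Suc n) =
      ((c \<otimes> s [^] (Suc i)) \<otimes> (c \<otimes> t [^] j)) \<otimes> (s \<oplus> t) [^] n \<oplus>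
      ((c \<otimes> s [^] i) \<otimes> (c \<otimes> t [^] (Suc j))) \<otimes> (s \<oplus> t) [^] n"
      using carriers by (simp add: l_distr r_distr m_ac)
    then show ?case using Suc.IH[of "Suc i" j] Suc.IH[of i "Suc j"] subringE(7)[OF D] by simp
  qed
  from this[of 0 0] have "(c \<otimes> c) \<otimes> (s \<oplus> t) [^] n \<in> D" for n :: nat using carriers by simp
  moreover have "c \<otimes> c \<in> D - {\<zero>}" using mult_system_mult[OF nonzero_mult_system[OF D] c(1) c(1)] .
  ultimately show ?thesis using carriers by (intro complete_integral_closure_memI[of _ "c \<otimes> c"]) auto
qed

lemma complete_integral_closure_subring:
  assumes D: "subring D R" shows "subring (complete_integral_closure R D) R"
proof (rule subringI)
  note sub = subsetD[OF subset_complete_integral_closure[OF D]]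
  show in_carrier: "complete_integral_closure R D \<subseteq> carrier R" by (auto simp: complete_integral_closure_def)
  show "\<one> \<in> complete_integral_closure R D" using sub subringE(3)[OF D] .
  fix t assume t: "t \<in> complete_integral_closure R D"
  have "(\<ominus> \<one>) \<otimes> t \<in> complete_integral_closure R D"
    using complete_integral_closure_mult[OF D sub t] subringE(3,5)[OF D] by blast
  then show "\<ominus> t \<in> complete_integral_closure R D" using t in_carrier by (auto simp: l_minus)
qed (simp_all add: complete_integral_closure_mult complete_integral_closure_add D)

lemma complete_integral_closureI:
  assumes t: "t \<in> carrier R" "\<And>m. m \<in> M \<Longrightarrow> t \<otimes> m \<in> M" and "\<one> \<in> M"
    and c: "c \<in> D - {\<zero>}" "\<And>m. m \<in> M \<Longrightarrow> c \<otimes> m \<in> D"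
  shows "t \<in> complete_integral_closure R D"
proof -
  have "t [^] n \<in> M" for n :: nat
  proof (induction n)
    case (Suc n)
    then show ?case using t(2)[OF Suc] t(1) by (simp add: m_comm)
  qed (use assms in simp)
  then show ?thesis using t(1) c by (intro complete_integral_closure_memI[of _ c]) auto
qed

end

locale fraction_field = field K for K (structure) +
  fixes D
  assumes D_subring: "subring D K"
    and fraction: "z \<in> carrier K \<Longrightarrow> \<exists>d \<in> D - {\<zero>}. d \<otimes> z \<in> D"
begin

abbreviation "D' \<equiv> complete_integral_closure K D"

abbreviation "adjoin y \<equiv> \<Union>n. power_span K D y n"

lemmas D'_subring = complete_integral_closure_subring[OF D_subring]

lemma D_carrier: "d \<in> D \<Longrightarrow> d \<in> carrier K"
  using subringE(1)[OF D_subring] by auto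

lemma power_span_common_denominator:
  assumes y: "y \<in> carrier K"
  shows "\<exists>d \<in> D - {\<zero>}. power_span K D y n \<subseteq> colon K D d"
proof -
  note D_subalgebra = subring_is_subalgebra[OF D_subring]
  have "\<exists>d \<in> D - {\<zero>}. \<forall>i \<in> {..<n}. d \<in> colon K D (y [^] i)"
  proof (rule mult_system_meets_family[OF nonzero_mult_system[OF D_subring] Diff_subset])
    fix i assume "i \<in> {..<n}"
    show "subalgebra D (colon K D (y [^] i)) K" using y by (intro colon_subalgebra D_subring D_subalgebra) simp
    show "colon K D (y [^] i) \<inter> (D - {\<zero>}) \<noteq> {}"
      using fraction[of "y [^] i"] y D_carrier by (auto simp: colon_def)
  qed simp
  then obtain d where d: "d \<in> D - {\<zero>}" "\<And>i. i < n \<Longrightarrow> d \<otimes> y [^] i \<in> D" by (auto simp: colon_def)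
  then have "power_span K D y n \<subseteq> colon K D d"
    using y D_carrier by (intro power_span_least colon_subalgebra D_subring D_subalgebra)
      (auto simp: colon_def m_comm)
  then show ?thesis using d(1) by blast
qed

lemma power_span_stable:
  assumes y: "y \<in> carrier K" and t: "t \<in> carrier K" and "0 < n"
    and "\<And>i. i < n \<Longrightarrow> y [^] i \<otimes> t \<in> power_span K D y n"
  shows "t \<in> D'"
proof -
  note carriers = power_span_carrier[OF D_subring y]
  obtain d where d: "d \<in> D - {\<zero>}" "power_span K D y n \<subseteq> colon K D d"
    using power_span_common_denominator[OF y] by blast
  have "power_span K D y n \<subseteq> colon K (power_span K D y n) t"
    using assms by (intro power_span_least colon_subalgebra D_subring power_span_subalgebra)
      (auto simp: colon_def)
  then have "m \<otimes> t \<in> power_span K D y n" if "m \<in> power_span K D y n" for m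
    using that by (auto simp: colon_def)
  then show ?thesis
    using power_in_power_span[OF D_subring y, of 0 n] d D_carrier carriers t \<open>0 < n\<close>
    by (intro complete_integral_closureI[of t "power_span K D y n" d D]) (auto simp: colon_def m_comm)
qed

lemma power_span_stable_both:
  assumes y: "y \<in> carrier K" and t: "t \<in> carrier K" and "0 < n"
    and stable: "\<And>i. i \<le> n \<Longrightarrow> y [^] i \<otimes> t \<in> power_span K D y n"
  shows "t \<in> D'" and "y \<otimes> t \<in> D'"
proof -
  show "t \<in> D'" using assms by (intro power_span_stable[OF y t]) auto
  have "y [^] i \<otimes> (y \<otimes> t) \<in> power_span K D y n" if "i < n" for i
    using stable[of "Suc i"] that y t by (simp add: m_assoc)
  then show "y \<otimes> t \<in> D'" using y t \<open>0 < n\<close> by (intro power_span_stable[OF y]) auto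
qed

lemma integral_if_power_multiple_in_span:
  assumes y: "y \<in> carrier K" and t: "t \<in> power_span K D y k" and low: "y [^] n \<otimes> t \<in> power_span K D y n"
  shows "t \<in> D'" and "y \<otimes> t \<in> D'"
proof -
  define N where "N = n + k + 1"
  note times_power = power_span_times_power[OF D_subring y]
    and mono = subsetD[OF power_span_mono[OF D_subring y]]
  have t_carrier: "t \<in> carrier K" using power_span_carrier[OF D_subring y t] .
  have "y [^] i \<otimes> t \<in> power_span K D y N" if "i \<le> N" for i
  proof (cases "i < n")
    case True
    then show ?thesis using mono[OF _ times_power[OF t, of i], of N] y t_carrier by (simp add: N_def m_comm)
  next
    case False
    then obtain j where j: "i = n + j" using le_Suc_ex[of n i] by auto
    have "(y [^] n \<otimes> t) \<otimes> y [^] j \<in> power_span K D y i" unfolding j by (rule times_power[OF low])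
    moreover have "(y [^] n \<otimes> t) \<otimes> y [^] j = y [^] i \<otimes> t"
      using y t_carrier nat_pow_mult[OF y, of n j] by (simp add: j m_ac)
    ultimately show ?thesis using mono[OF that] by simp
  qed
  then show "t \<in> D'" "y \<otimes> t \<in> D'"
    using power_span_stable_both[OF y t_carrier, of N] by (simp_all add: N_def)
qed

lemma
  assumes y: "y \<in> carrier K" and u: "u \<in> D" and l: "l \<in> power_span K D y n" and h: "h \<in> power_span K D y k"
    and relation: "u \<otimes> y [^] n = l \<oplus> y [^] Suc n \<otimes> h"
  shows relation_upper_part: "h \<in> D'" "y \<otimes> h \<in> D'"
    and relation_lower_part: "u \<ominus> y \<otimes> h \<in> D'" "y \<otimes> (u \<ominus> y \<otimes> h) \<in> D'"
proof -
  note span = power_span_subalgebra[OF D_subring y]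
  have carriers: "u \<in> carrier K" "l \<in> carrier K" "h \<in> carrier K"
    using D_carrier[OF u] power_span_carrier[OF D_subring y] l h by auto
  have "y [^] Suc n \<otimes> h = u \<otimes> y [^] n \<ominus> l"
    unfolding relation using carriers y by (simp add: a_minus_def a_ac r_neg2)
  also have "\<dots> \<in> power_span K D y (Suc n)"
    using monomial_in_power_span[OF D_subring y u, of n "Suc n"] power_span_Suc_mono[OF D_subring y] l
    by (intro subalgebra_minus[OF span]) auto
  finally show "h \<in> D'" "y \<otimes> h \<in> D'" by (rule integral_if_power_multiple_in_span[OF y h])+
  have "y [^] n \<otimes> (u \<ominus> y \<otimes> h) = u \<otimes> y [^] n \<ominus> y [^] Suc n \<otimes> h"
    using carriers y by (simp add: a_minus_def r_distr r_minus m_ac)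
  then have low: "y [^] n \<otimes> (u \<ominus> y \<otimes> h) \<in> power_span K D y n"
    unfolding relation using carriers y l by (simp add: a_minus_def a_assoc r_neg)
  have "u \<ominus> y \<otimes> h \<in> power_span K D y (k + 1)"
    using monomial_in_power_span[OF D_subring y u, of 0 "k + 1"] carriers y
      power_span_times_power[OF D_subring y h, of 1]
    by (intro subalgebra_minus[OF span]) (simp_all add: m_comm)
  then show "u \<ominus> y \<otimes> h \<in> D'" "y \<otimes> (u \<ominus> y \<otimes> h) \<in> D'"
    by (rule integral_if_power_multiple_in_span[OF y _ low])+
qed

end

subsection \<open>Invertible fractional ideals\<close>

text \<open>The values of \<open>h\<close> lie in the inverse of the fractional \<open>V\<close>-ideal generated by \<open>F\<close>.\<close>

definition invertible_over :: "('k, 'm) ring_scheme \<Rightarrow> 'k set \<Rightarrow> 'k set \<Rightarrow> bool" where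
  "invertible_over K V F \<longleftrightarrow> (\<exists>h \<in> F \<rightarrow> carrier K.
    (\<forall>\<alpha> \<in> F. \<forall>\<beta> \<in> F. h \<alpha> \<otimes>\<^bsub>K\<^esub> \<beta> \<in> V) \<and> finsum K (\<lambda>\<alpha>. h \<alpha> \<otimes>\<^bsub>K\<^esub> \<alpha>) F = \<one>\<^bsub>K\<^esub>)"

definition inverts_pair :: "('k, 'm) ring_scheme \<Rightarrow> 'k set \<Rightarrow> 'k \<Rightarrow> 'k \<Rightarrow> 'k \<Rightarrow> 'k \<Rightarrow> bool" where
  "inverts_pair K V a b u v \<longleftrightarrow> u \<in> carrier K \<and> v \<in> carrier K \<and>
    u \<otimes>\<^bsub>K\<^esub> a \<oplus>\<^bsub>K\<^esub> v \<otimes>\<^bsub>K\<^esub> b = \<one>\<^bsub>K\<^esub> \<and>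
    {u \<otimes>\<^bsub>K\<^esub> a, u \<otimes>\<^bsub>K\<^esub> b, v \<otimes>\<^bsub>K\<^esub> a, v \<otimes>\<^bsub>K\<^esub> b} \<subseteq> V"

context cring
begin

lemma finsum_partition_of_unity:
  assumes "F \<subseteq> carrier R" "b \<in> carrier R" "f \<in> F \<rightarrow> carrier R" "u \<in> F \<rightarrow> carrier R" "v \<in> F \<rightarrow> carrier R"
    and one: "\<And>a. a \<in> F \<Longrightarrow> u a \<otimes> a \<oplus> v a \<otimes> b = \<one>"
  shows "(\<Oplus>a\<in>F. f a \<otimes> v a \<otimes> b) \<oplus> (\<Oplus>a\<in>F. f a \<otimes> u a \<otimes> a) = (\<Oplus>a\<in>F. f a)"
proof -
  have carriers: "f a \<in> carrier R" "a \<in> carrier R" "u a \<in> carrier R" "v a \<in> carrier R" if "a \<in> F" for a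
    using that assms by auto
  have "(\<Oplus>a\<in>F. f a \<otimes> v a \<otimes> b) \<oplus> (\<Oplus>a\<in>F. f a \<otimes> u a \<otimes> a) = (\<Oplus>a\<in>F. f a \<otimes> v a \<otimes> b \<oplus> f a \<otimes> u a \<otimes> a)"
    using carriers assms(2) by (intro finsum_addf[symmetric]) auto
  also have "\<dots> = (\<Oplus>a\<in>F. f a)"
  proof (rule finsum_cong')
    fix a assume a: "a \<in> F"
    then have "f a \<otimes> v a \<otimes> b \<oplus> f a \<otimes> u a \<otimes> a = f a \<otimes> (u a \<otimes> a \<oplus> v a \<otimes> b)"
      using carriers assms(2) by (simp add: r_distr m_assoc a_comm)
    then show "f a \<otimes> v a \<otimes> b \<oplus> f a \<otimes> u a \<otimes> a = f a" using one[OF a] carriers a by simp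
  qed (use carriers in auto)
  finally show ?thesis .
qed

lemma cross_products_mem_subring:
  assumes V: "subring V R" and carriers: "h \<in> carrier R" "a \<in> carrier R" "w \<in> carrier R" "c \<in> carrier R"
    and mem: "h \<otimes> a \<in> V" "w \<otimes> a \<in> V" "h \<otimes> c \<in> V \<or> w \<otimes> c \<in> V"
  shows "h \<otimes> a \<otimes> w \<otimes> c \<in> V"
proof -
  have "h \<otimes> a \<otimes> w \<otimes> c = (h \<otimes> c) \<otimes> (w \<otimes> a)" "h \<otimes> a \<otimes> w \<otimes> c = (h \<otimes> a) \<otimes> (w \<otimes> c)"
    using carriers by (simp_all add: m_ac)
  then show ?thesis using mem subringE(6)[OF V] by metis
qed

lemma invertible_over_insert:
  assumes V: "subring V R" and F: "finite F" "b \<notin> F" "F \<subseteq> carrier R" "b \<in> carrier R"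
    and "invertible_over R V F"
    and pair: "\<And>a. a \<in> F \<Longrightarrow> \<exists>u v. inverts_pair R V a b u v"
  shows "invertible_over R V (insert b F)"
proof -
  obtain h where h: "h \<in> F \<rightarrow> carrier R" "\<And>a c. a \<in> F \<Longrightarrow> c \<in> F \<Longrightarrow> h a \<otimes> c \<in> V"
    "(\<Oplus>a\<in>F. h a \<otimes> a) = \<one>"
    using assms(6) by (auto simp: invertible_over_def)
  obtain u v where "\<And>a. a \<in> F \<Longrightarrow> inverts_pair R V a b (u a) (v a)" using pair by metis
  then have u: "u a \<in> carrier R" and v: "v a \<in> carrier R" and one: "u a \<otimes> a \<oplus> v a \<otimes> b = \<one>"
    and uv: "u a \<otimes> a \<in> V" "u a \<otimes> b \<in> V" "v a \<otimes> a \<in> V" "v a \<otimes> b \<in> V" if "a \<in> F" for a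
    using that by (auto simp: inverts_pair_def)
  have carriers: "h a \<in> carrier R" "a \<in> carrier R" "u a \<in> carrier R" "v a \<in> carrier R" if "a \<in> F" for a
    using that h(1) F(3) u v by auto
  have products: "h a \<otimes> a \<otimes> u a \<otimes> c \<in> V" "h a \<otimes> a \<otimes> v a \<otimes> c \<in> V" if "a \<in> F" "c \<in> insert b F" for a c
    using that carriers[OF that(1)] F(3,4) h(2) uv[OF that(1)] by (auto intro!: cross_products_mem_subring[OF V])
  define k where "k c = (if c = b then \<Oplus>a\<in>F. h a \<otimes> a \<otimes> v a else h c \<otimes> c \<otimes> u c)" for c
  have k_F: "k a = h a \<otimes> a \<otimes> u a" if "a \<in> F" for a using that F(2) by (auto simp: k_def)
  have k_b: "k b \<otimes> c = (\<Oplus>a\<in>F. h a \<otimes> a \<otimes> v a \<otimes> c)" if "c \<in> carrier R" for c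
    using carriers that F(1) by (simp add: k_def finsum_ldistr Pi_def)
  have k_closed: "k \<in> insert b F \<rightarrow> carrier R" using carriers by (auto simp: k_def intro!: finsum_closed)
  have "k a \<otimes> c \<in> V" if "a \<in> F" "c \<in> insert b F" for a c
    using products(1)[OF that] that(1) by (simp add: k_F)
  moreover have "k b \<otimes> c \<in> V" if "c \<in> insert b F" for c
  proof -
    have "(\<Oplus>a\<in>F. h a \<otimes> a \<otimes> v a \<otimes> c) \<in> V"
      using products(2)[OF _ that] by (intro subalgebra_finsum[OF subring_is_subalgebra[OF V]]) auto
    moreover have "c \<in> carrier R" using that F(3,4) by auto
    ultimately show ?thesis by (simp add: k_b)
  qed
  moreover have "(\<Oplus>c\<in>insert b F. k c \<otimes> c) = \<one>"
  proof -
    have "(\<Oplus>c\<in>insert b F. k c \<otimes> c) = k b \<otimes> b \<oplus> (\<Oplus>a\<in>F. k a \<otimes> a)"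
      using F k_closed by (intro finsum_insert) auto
    also have "(\<Oplus>a\<in>F. k a \<otimes> a) = (\<Oplus>a\<in>F. h a \<otimes> a \<otimes> u a \<otimes> a)"
      using k_F carriers by (intro finsum_cong') auto
    also have "k b \<otimes> b \<oplus> \<dots> = (\<Oplus>a\<in>F. h a \<otimes> a)"
      unfolding k_b[OF F(4)] using carriers F(3,4) one by (intro finsum_partition_of_unity) auto
    finally show ?thesis using h(3) by simp
  qed
  ultimately show ?thesis using k_closed unfolding invertible_over_def by blast
qed

end

lemma (in field) invertible_over_finite:
  assumes V: "subring V R" and "finite F" "F \<noteq> {}" "F \<subseteq> carrier R - {\<zero>}"
    and "\<And>a b. a \<in> F \<Longrightarrow> b \<in> F \<Longrightarrow> \<exists>u v. inverts_pair R V a b u v"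
  shows "invertible_over R V F"
  using assms(2-)
proof (induction F rule: finite_ne_induct)
  case (singleton a)
  then have "a \<in> Units R" using field_Units by auto
  then show ?case
    using subringE(3)[OF V] unfolding invertible_over_def
    by (intro bexI[of _ "\<lambda>_. inv a"]) (simp_all add: Units_closed)
next
  case (insert b F)
  then show ?case by (intro invertible_over_insert[OF V]) auto
qed

section \<open>Two adjacent primes\<close>

locale adjacent_primes = field K + R: noetherian_cring R
  for K :: "('k, 'm) ring_scheme" (structure) and R :: "('a, 'b) ring_scheme" +
  fixes \<phi> :: "'a \<Rightarrow> 'k" and P Q :: "'a set"
  assumes hom: "\<phi> \<in> ring_hom R K"
    and kernel: "r \<in> carrier R \<Longrightarrow> \<phi> r = \<zero> \<longleftrightarrow> r \<in> P"
    and fraction_image: "z \<in> carrier K \<Longrightarrow> \<exists>d \<in> \<phi> ` carrier R - {\<zero>}. d \<otimes> z \<in> \<phi> ` carrier R"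
    and P_prime: "primeideal P R" and Q_prime: "primeideal Q R" and PQ: "P \<subseteq> Q"
    and between: "primeideal Q' R \<Longrightarrow> P \<subset> Q' \<Longrightarrow> Q' \<subseteq> Q \<Longrightarrow> Q' = Q"

sublocale adjacent_primes \<subseteq> \<phi>: ring_hom_cring R K \<phi>
  by unfold_locales (rule hom)

sublocale adjacent_primes \<subseteq> fraction_field K "\<phi> ` carrier R"
  by (intro fraction_field.intro fraction_field_axioms.intro field_axioms fraction_image
      \<phi>.ring.img_is_subring R.carrier_is_subring)

context adjacent_primes
begin

abbreviation "D \<equiv> \<phi> ` carrier R"

definition S :: "'k set" where "S = \<phi> ` (carrier R - Q)"

text \<open>The integral closure of \<open>(R/P)\<^sub>Q\<close>, a local ring of dimension at most one, in its fraction field \<open>K\<close>.\<close>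

definition V :: "'k set" where "V = saturation K S D'"

lemma S_mult_system: "mult_system K S"
proof -
  have "\<one> \<in> S" unfolding S_def using R.prime_one_notin[OF Q_prime] by (intro image_eqI[of _ _ "\<one>\<^bsub>R\<^esub>"]) auto
  moreover have "u \<otimes> v \<in> S" if "u \<in> S" "v \<in> S" for u v
    using that R.prime_mult_notin[OF Q_prime] unfolding S_def by (auto simp flip: \<phi>.hom_mult)
  ultimately show ?thesis by (auto simp: mult_system_def S_def)
qed

lemma S_subset: "S \<subseteq> D - {\<zero>}"
  using PQ by (auto simp: S_def kernel)

lemma S_subset_D': "S \<subseteq> D'"
  using S_subset subset_complete_integral_closure[OF D_subring] by auto

lemma S_minus_image_Q:
  assumes "t \<in> S" and "a \<in> \<phi> ` Q" shows "t \<ominus> a \<in> S"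
proof -
  note Q_ideal = primeideal.axioms(1)[OF Q_prime]
  obtain \<tau> \<alpha> where \<tau>: "\<tau> \<in> carrier R" "\<tau> \<notin> Q" "t = \<phi> \<tau>" and \<alpha>: "\<alpha> \<in> Q" "a = \<phi> \<alpha>"
    using assms by (auto simp: S_def)
  have \<alpha>_carrier: "\<alpha> \<in> carrier R" using R.ideal_subset[OF Q_ideal] \<alpha>(1) by auto
  have "\<alpha> \<oplus>\<^bsub>R\<^esub> (\<tau> \<ominus>\<^bsub>R\<^esub> \<alpha>) = \<tau>" using \<tau>(1) \<alpha>_carrier by (simp add: a_minus_def R.a_lcomm[of \<alpha> \<tau>] R.r_neg)
  then have "\<tau> \<ominus>\<^bsub>R\<^esub> \<alpha> \<notin> Q" using R.ideal_add_mem_iff[OF Q_ideal \<alpha>(1), of "\<tau> \<ominus>\<^bsub>R\<^esub> \<alpha>"] \<tau> \<alpha>_carrier by auto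
  moreover have "\<phi> (\<tau> \<ominus>\<^bsub>R\<^esub> \<alpha>) = t \<ominus> a" using \<tau> \<alpha> \<alpha>_carrier by (simp add: a_minus_def)
  ultimately show ?thesis using \<tau>(1) \<alpha>_carrier by (auto simp: S_def intro!: image_eqI[of _ _ "\<tau> \<ominus>\<^bsub>R\<^esub> \<alpha>"])
qed

lemma mult_mem_image_Q:
  assumes "a \<in> D" "a \<notin> S" "d \<in> D" shows "a \<otimes> d \<in> \<phi> ` Q"
proof -
  obtain \<alpha> \<delta> where "\<alpha> \<in> Q" "\<alpha> \<in> carrier R" "a = \<phi> \<alpha>" "\<delta> \<in> carrier R" "d = \<phi> \<delta>"
    using assms by (auto simp: S_def)
  then show ?thesis
    using ideal.I_r_closed[OF primeideal.axioms(1)[OF Q_prime]]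
    by (intro image_eqI[of _ _ "\<alpha> \<otimes>\<^bsub>R\<^esub> \<delta>"]) auto
qed

lemma V_subring: "subring V K"
  unfolding V_def by (rule saturation_subring[OF D'_subring S_mult_system S_subset_D'])

lemma preimage_ideal:
  assumes M: "subalgebra D M K" shows "ideal {r \<in> carrier R. \<phi> r \<in> M} R"
  unfolding R.ideal_iff_subalgebra
proof (rule R.subalgebraI[OF R.carrier_is_subring])
  show "r \<otimes>\<^bsub>R\<^esub> a \<in> {r \<in> carrier R. \<phi> r \<in> M}"
    if "r \<in> carrier R" "a \<in> {r \<in> carrier R. \<phi> r \<in> M}" for r a
    using subalgebra.smult_closed[OF M, of "\<phi> r" "\<phi> a"] that by auto
qed (use subalgebra_zero[OF M] subalgebra_add[OF M] in auto)

subsection \<open>Chains of submodules of the fraction field\<close>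

lemma bounded_submodules_stabilise:
  assumes M: "\<And>n::nat. subalgebra D (M n) K" "\<And>n. M n \<subseteq> M (Suc n)"
    and c: "c \<in> carrier K - {\<zero>}" "\<And>n. M n \<subseteq> colon K D c"
  shows "\<exists>k. \<forall>n. M n \<subseteq> M k"
proof -
  define Y where "Y n = {r \<in> carrier R. \<phi> r \<in> (\<otimes>) c ` M n}" for n
  have "ideal (Y n) R" for n
    unfolding Y_def using c(1) by (intro preimage_ideal mult_image_subalgebra[OF D_subring M(1)]) simp
  moreover have "Y n \<subseteq> Y (Suc n)" for n using M(2)[of n] by (auto simp: Y_def)
  ultimately obtain k where k: "\<And>n. Y n \<subseteq> Y k" using R.ascending_ideals_stabilise[of Y] by auto
  have "m \<in> M k" if m: "m \<in> M n" for n m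
  proof -
    note sub = subsetD[OF subalgebra_in_carrier[OF M(1)]]
    have "m \<in> colon K D c" using m c(2) by blast
    then have "c \<otimes> m \<in> D" using c(1) sub[OF m] m_comm[of m c] by (auto simp: colon_def)
    then obtain r where r: "r \<in> carrier R" "\<phi> r = c \<otimes> m" by auto
    then have "r \<in> Y n" using m by (auto simp: Y_def)
    then have "r \<in> Y k" using k by auto
    then obtain m' where "m' \<in> M k" "c \<otimes> m = c \<otimes> m'" using r(2) by (auto simp: Y_def)
    then show ?thesis using sub[OF m] sub[of m' k] c(1) m_lcancel[of c m m'] by auto
  qed
  then show ?thesis by blast
qed

lemma bounded_degree:
  assumes y: "y \<in> carrier K" and c: "c \<in> carrier K - {\<zero>}"
  shows "\<exists>k. adjoin y \<inter> colon K D c \<subseteq> power_span K D y k"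
proof -
  have "\<exists>k. \<forall>n. power_span K D y n \<inter> colon K D c \<subseteq> power_span K D y k \<inter> colon K D c"
    using power_span_Suc_mono[OF D_subring y] c
    by (intro bounded_submodules_stabilise[OF _ _ c] subalgebra_inter power_span_subalgebra[OF D_subring y]
        colon_subalgebra subring_is_subalgebra D_subring) auto
  then show ?thesis by blast
qed

lemma descending_submodules_stable:
  assumes M: "\<And>n::nat. subalgebra D (M n) K" "\<And>n. M (Suc n) \<subseteq> M n"
    and a: "a \<in> D - {\<zero>}" "\<And>n. a \<in> M n"
  shows "\<exists>k. \<forall>n \<ge> k. M n \<inter> D \<subseteq> saturation K S (M (Suc n))"
proof -
  obtain \<alpha> where \<alpha>: "\<alpha> \<in> carrier R" "\<alpha> \<notin> P" "\<And>n. \<phi> \<alpha> \<in> M n" using a kernel by auto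
  note P_ideal = primeideal.axioms(1)[OF P_prime]
  define Y where "Y n = {r \<in> carrier R. \<phi> r \<in> M n}" for n
  have Y_ideal: "ideal (Y n) R" for n unfolding Y_def by (rule preimage_ideal[OF M(1)])
  have "\<exists>k. \<forall>n \<ge> k. Y n \<subseteq> saturation R (carrier R - Q) (Y (Suc n))"
  proof (rule locally_artinianD)
    show "locally_artinian R Q (P <+>\<^bsub>R\<^esub> PIdl\<^bsub>R\<^esub> \<alpha>)"
    proof (rule R.locally_artinian_if_only_prime_above[OF Q_prime R.add_cgenideal[OF P_ideal \<alpha>(1)]])
      show "Q' = Q" if "primeideal Q' R" "P <+>\<^bsub>R\<^esub> PIdl\<^bsub>R\<^esub> \<alpha> \<subseteq> Q'" "Q' \<subseteq> Q" for Q'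
        using that between[of Q'] R.add_cgenideal_upper[OF P_ideal \<alpha>(1)] \<alpha>(2) by auto
    qed
    show "P <+>\<^bsub>R\<^esub> PIdl\<^bsub>R\<^esub> \<alpha> \<subseteq> Y n" for n
    proof (rule R.set_add_least[OF Y_ideal[unfolded R.ideal_iff_subalgebra]])
      have "r \<in> Y n" if "r \<in> P" for r
        using that R.ideal_subset[OF P_ideal] kernel[of r] subalgebra_zero[OF M(1)] by (auto simp: Y_def)
      then show "P \<subseteq> Y n" by auto
      show "PIdl\<^bsub>R\<^esub> \<alpha> \<subseteq> Y n" using \<alpha>(1,3) by (intro R.cgenideal_minimal[OF Y_ideal]) (simp add: Y_def)
    qed
    show "Y (Suc n) \<subseteq> Y n" for n using M(2)[of n] by (auto simp: Y_def)
  qed (rule Y_ideal)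
  then obtain k where k: "\<And>n. n \<ge> k \<Longrightarrow> Y n \<subseteq> saturation R (carrier R - Q) (Y (Suc n))" by blast
  have "\<phi> r \<in> saturation K S (M (Suc n))" if r: "n \<ge> k" "\<phi> r \<in> M n" "r \<in> carrier R" for n r
  proof -
    have "r \<in> saturation R (carrier R - Q) (Y (Suc n))" using k r by (auto simp: Y_def)
    then obtain w where "w \<in> carrier R - Q" "w \<otimes>\<^bsub>R\<^esub> r \<in> Y (Suc n)" by (elim saturationE)
    then show ?thesis using r(3) by (intro saturationI[of _ _ "\<phi> w"]) (auto simp: S_def Y_def)
  qed
  then show ?thesis by blast
qed

lemma saturation_absorbs_chain:
  assumes M: "\<And>n::nat. subalgebra D (M n) K" and N: "subalgebra D N K"
    and step: "\<And>n. n \<ge> k \<Longrightarrow> M (Suc n) \<subseteq> saturation K S (M n <+> N)"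
  shows "M (k + m) \<subseteq> saturation K S (M k <+> N)"
proof -
  let ?Sat = "saturation K S (M k <+> N)"
  have sum: "subalgebra D (M k <+> N) K" by (rule set_add_subalgebra[OF D_subring M N])
  then have Sat: "subalgebra D ?Sat K"
    using S_subset by (intro saturation_subalgebra D_subring S_mult_system) auto
  have sum_Sat: "M k <+> N \<subseteq> ?Sat"
    by (rule saturation_upper[OF S_mult_system subalgebra_in_carrier[OF sum]])
  show ?thesis
  proof (induction m)
    case 0
    then show ?case using set_add_upper1[OF M N] sum_Sat by auto
  next
    case (Suc m)
    have "N \<subseteq> ?Sat" using set_add_upper2[OF M N] sum_Sat by blast
    then have "M (k + m) <+> N \<subseteq> ?Sat" by (rule set_add_least[OF Sat Suc])
    then have "saturation K S (M (k + m) <+> N) \<subseteq> ?Sat"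
      using saturation_mono saturation_saturation[OF S_mult_system] by blast
    then show ?case using step[of "k + m"] by auto
  qed
qed

subsection \<open>Polynomial relations with a unit coefficient\<close>

context
  fixes y a
  assumes y: "y \<in> carrier K" and a: "a \<in> D - {\<zero>}" and denominator: "a \<otimes> y \<in> D"
begin

lemmas adjoin_subalgebra = power_span_Union_subalgebra[OF D_subring y]
lemmas adjoin_carrier = subsetD[OF subalgebra_in_carrier[OF adjoin_subalgebra]]
lemmas a_pow = mult_system_pow[OF nonzero_mult_system[OF D_subring] a]

lemma a_carrier: "a \<in> carrier K"
  using a D_carrier by auto

lemma adjoin_bounded_denominators: "adjoin y \<subseteq> (\<Union>n::nat. colon K D (a [^] n))"
proof -
  have "power_span K D y n \<subseteq> colon K D (a [^] n)" for n
  proof (rule power_span_least[OF D_subring y])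
    show "subalgebra D (colon K D (a [^] n)) K"
      using a_carrier by (intro colon_subalgebra D_subring subring_is_subalgebra) simp
    fix i assume "i < n"
    then have "a [^] n = a [^] i \<otimes> a [^] (n - i)" using a_carrier by (simp add: nat_pow_mult)
    then have "y [^] i \<otimes> a [^] n = (a \<otimes> y) [^] i \<otimes> a [^] (n - i)"
      using y a_carrier by (simp add: nat_pow_distrib m_ac)
    then show "y [^] i \<in> colon K D (a [^] n)"
      using y a denominator subringE(6)[OF D_subring] subring_pow_closed[OF D_subring] by (simp add: colon_def)
  qed
  then show ?thesis by blast
qed

lemma adjoin_denominators_shrink_step:
  assumes t: "t \<in> S" and \<gamma>: "\<gamma> \<in> adjoin y" and \<beta>: "\<beta> \<in> adjoin y" and d: "d \<in> D"
    and relation: "t \<otimes> (a [^] Suc n \<otimes> \<gamma>) = a [^] Suc (Suc n) \<otimes> \<beta> \<oplus> a \<otimes> d"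
  shows "t \<otimes> \<gamma> \<in> (adjoin y \<inter> colon K D (a [^] n)) <+> (\<otimes>) a ` adjoin y"
proof -
  have carriers: "t \<in> carrier K" "\<gamma> \<in> carrier K" "\<beta> \<in> carrier K" "d \<in> carrier K"
    using mult_system_subset[OF S_mult_system] t adjoin_carrier[OF \<gamma>] adjoin_carrier[OF \<beta>] D_carrier[OF d]
    by auto
  define \<delta> where "\<delta> = t \<otimes> \<gamma> \<ominus> a \<otimes> \<beta>"
  have \<delta>: "\<delta> \<in> carrier K" "t \<otimes> \<gamma> = \<delta> \<oplus> a \<otimes> \<beta>"
    using carriers a_carrier by (auto simp: \<delta>_def a_minus_def a_assoc l_neg)
  have "a \<otimes> (a [^] n \<otimes> \<delta>) = t \<otimes> (a [^] Suc n \<otimes> \<gamma>) \<ominus> a [^] Suc (Suc n) \<otimes> \<beta>"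
    using carriers a_carrier by (simp add: \<delta>_def a_minus_def r_distr r_minus m_ac)
  also have "\<dots> = a \<otimes> d"
    unfolding relation using carriers a_carrier by (simp add: a_minus_def a_ac r_neg r_neg2)
  finally have "a [^] n \<otimes> \<delta> = d" using \<delta>(1) carriers a_carrier a m_lcancel by auto
  then have "\<delta> \<in> colon K D (a [^] n)" using d \<delta>(1) a_carrier by (simp add: colon_def m_comm)
  moreover have "\<delta> \<in> adjoin y"
    unfolding \<delta>_def using t S_subset \<gamma> \<beta> a
    by (intro subalgebra_minus[OF adjoin_subalgebra] subalgebra.smult_closed[OF adjoin_subalgebra]) auto
  ultimately show ?thesis unfolding \<delta>(2) using \<beta> by (intro set_add_memI) auto
qed

lemma power_multiple_adjoin_antimono: "(\<otimes>) (a [^] Suc n) ` adjoin y \<subseteq> (\<otimes>) (a [^] n) ` adjoin y"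
proof
  fix z assume "z \<in> (\<otimes>) (a [^] Suc n) ` adjoin y"
  then obtain b where b: "b \<in> adjoin y" "z = a [^] Suc n \<otimes> b" by blast
  then have "z = a [^] n \<otimes> (a \<otimes> b)" using adjoin_carrier[OF b(1)] a_carrier by (simp add: m_assoc)
  moreover have "a \<otimes> b \<in> adjoin y" using subalgebra.smult_closed[OF adjoin_subalgebra _ b(1)] a by blast
  ultimately show "z \<in> (\<otimes>) (a [^] n) ` adjoin y" by blast
qed

lemma adjoin_denominators_shrink:
  "\<exists>k. \<forall>n \<ge> k. adjoin y \<inter> colon K D (a [^] Suc n) \<subseteq>
    saturation K S ((adjoin y \<inter> colon K D (a [^] n)) <+> (\<otimes>) a ` adjoin y)"
proof -
  note D_subalgebra = subring_is_subalgebra[OF D_subring]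
  define M where "M n = (\<otimes>) (a [^] n) ` adjoin y <+> (\<otimes>) a ` D" for n :: nat
  have M: "subalgebra D (M n) K" for n
    unfolding M_def using a_carrier
    by (intro set_add_subalgebra mult_image_subalgebra D_subring D_subalgebra adjoin_subalgebra) auto
  have "\<exists>k. \<forall>n \<ge> k. M n \<inter> D \<subseteq> saturation K S (M (Suc n))"
  proof (rule descending_submodules_stable[OF M _ a])
    show "M (Suc n) \<subseteq> M n" for n
      unfolding M_def by (rule set_add_mono[OF power_multiple_adjoin_antimono subset_refl])
    have "a \<in> (\<otimes>) a ` D" using subringE(3)[OF D_subring] a_carrier by (intro image_eqI[of _ _ \<one>]) auto
    then show "a \<in> M n" for n
      unfolding M_def using a_carrier
      by (intro subsetD[OF set_add_upper2[of D]] mult_image_subalgebra D_subring D_subalgebra adjoin_subalgebra) auto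
  qed
  then obtain k where k: "\<And>n. n \<ge> k \<Longrightarrow> M n \<inter> D \<subseteq> saturation K S (M (Suc n))" by blast
  show ?thesis
  proof (intro exI[of _ k] allI impI subsetI)
    fix n \<gamma> assume n: "n \<ge> k" and "\<gamma> \<in> adjoin y \<inter> colon K D (a [^] Suc n)"
    then have \<gamma>: "\<gamma> \<in> adjoin y" "\<gamma> \<in> carrier K" "a [^] Suc n \<otimes> \<gamma> \<in> D"
      using adjoin_carrier a_carrier by (auto simp: colon_def m_comm)
    have "a [^] Suc n \<otimes> \<gamma> \<in> M (Suc n)"
      unfolding M_def using \<gamma>(1) a_carrier
      by (intro subsetD[OF set_add_upper1[of D]] mult_image_subalgebra D_subring D_subalgebra adjoin_subalgebra) auto
    then have "a [^] Suc n \<otimes> \<gamma> \<in> saturation K S (M (Suc (Suc n)))" using k[of "Suc n"] n \<gamma>(3) by auto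
    then obtain t where t: "t \<in> S" "t \<otimes> (a [^] Suc n \<otimes> \<gamma>) \<in> M (Suc (Suc n))" by (elim saturationE)
    then obtain \<beta> d where "\<beta> \<in> adjoin y" "d \<in> D" "t \<otimes> (a [^] Suc n \<otimes> \<gamma>) = a [^] Suc (Suc n) \<otimes> \<beta> \<oplus> a \<otimes> d"
      unfolding M_def by (auto elim!: set_add_memE)
    then have "t \<otimes> \<gamma> \<in> (adjoin y \<inter> colon K D (a [^] n)) <+> (\<otimes>) a ` adjoin y"
      by (rule adjoin_denominators_shrink_step[OF t(1) \<gamma>(1)])
    then show "\<gamma> \<in> saturation K S ((adjoin y \<inter> colon K D (a [^] n)) <+> (\<otimes>) a ` adjoin y)"
      by (rule saturationI[OF \<gamma>(2) t(1)])
  qed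
qed

text \<open>Akizuki's argument: modulo \<open>a D[y]\<close> and locally at \<open>Q\<close>, the denominators of \<open>D[y]\<close> shrink to a fixed
  power of \<open>a\<close>, and the elements of \<open>D[y]\<close> with a fixed denominator have bounded degree.\<close>

lemma adjoin_finite_mod:
  "\<exists>k. adjoin y \<subseteq> saturation K S (power_span K D y k <+> (\<otimes>) a ` adjoin y)"
proof -
  let ?aB = "(\<otimes>) a ` adjoin y"
  define C where "C n = adjoin y \<inter> colon K D (a [^] n)" for n :: nat
  have C: "subalgebra D (C n) K" for n
    unfolding C_def using a_carrier
    by (intro subalgebra_inter adjoin_subalgebra colon_subalgebra D_subring subring_is_subalgebra) simp
  have aB: "subalgebra D ?aB K" by (rule mult_image_subalgebra[OF D_subring adjoin_subalgebra a_carrier])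
  obtain k where "\<And>n. n \<ge> k \<Longrightarrow> C (Suc n) \<subseteq> saturation K S (C n <+> ?aB)"
    using adjoin_denominators_shrink unfolding C_def by blast
  then have "C (k + m) \<subseteq> saturation K S (C k <+> ?aB)" for m by (rule saturation_absorbs_chain[OF C aB])
  moreover have "adjoin y \<subseteq> (\<Union>m. C (k + m))"
  proof
    fix b assume b: "b \<in> adjoin y"
    then obtain n :: nat where "b \<in> colon K D (a [^] n)" using adjoin_bounded_denominators by blast
    then have "b \<in> carrier K" "b \<otimes> a [^] n \<in> D" by (auto simp: colon_def)
    moreover have "b \<otimes> a [^] (k + n) = a [^] k \<otimes> (b \<otimes> a [^] n)"
      using calculation(1) a_carrier by (simp add: nat_pow_mult[symmetric] m_ac)
    ultimately have "b \<in> C (k + n)"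
      using b subringE(6)[OF D_subring] a_pow[of k] by (auto simp: C_def colon_def)
    then show "b \<in> (\<Union>m. C (k + m))" by blast
  qed
  ultimately have "adjoin y \<subseteq> saturation K S (C k <+> ?aB)" by blast
  moreover obtain n where "C k \<subseteq> power_span K D y n"
    using bounded_degree[OF y, of "a [^] k"] a_pow[of k] D_carrier unfolding C_def by auto
  then have "saturation K S (C k <+> ?aB) \<subseteq> saturation K S (power_span K D y n <+> ?aB)"
    by (intro saturation_mono set_add_mono) auto
  ultimately show ?thesis by blast
qed

end

end

lemma (in cring) absorb_top_coefficient:
  assumes "t \<in> carrier R" "a \<in> carrier R" "h \<in> carrier R" "l \<in> carrier R" "d \<in> carrier R" "r \<in> carrier R"
    "v \<in> carrier R" "w \<in> carrier R"
    and relation: "t \<otimes> v = h \<oplus> a \<otimes> ((l \<oplus> v \<otimes> d) \<oplus> w \<otimes> r)"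
  shows "(t \<ominus> a \<otimes> d) \<otimes> v = (h \<oplus> a \<otimes> l) \<oplus> w \<otimes> (a \<otimes> r)"
proof -
  have "(t \<ominus> a \<otimes> d) \<otimes> v = t \<otimes> v \<ominus> a \<otimes> (v \<otimes> d)"
    using assms by (simp add: a_minus_def l_distr l_minus m_assoc m_comm[of v d])
  also have "t \<otimes> v = ((h \<oplus> a \<otimes> l) \<oplus> w \<otimes> (a \<otimes> r)) \<oplus> a \<otimes> (v \<otimes> d)"
    unfolding relation using assms by (simp add: r_distr m_ac a_ac)
  also have "\<dots> \<ominus> a \<otimes> (v \<otimes> d) = (h \<oplus> a \<otimes> l) \<oplus> w \<otimes> (a \<otimes> r)"
    using assms by (simp add: a_minus_def a_assoc r_neg)
  finally show ?thesis .
qed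

context adjacent_primes
begin

lemma unit_coefficient_relation:
  assumes y: "y \<in> carrier K"
  shows "\<exists>n k. \<exists>u \<in> S. \<exists>l \<in> power_span K D y n. \<exists>h \<in> power_span K D y k.
    u \<otimes> y [^] n = l \<oplus> y [^] Suc n \<otimes> h"
proof -
  obtain a where a: "a \<in> carrier K" "a \<in> D - {\<zero>}" "a \<otimes> y \<in> D"
    using fraction[OF y] D_carrier by blast
  note span = power_span_subalgebra[OF D_subring y] and span_carrier = power_span_carrier[OF D_subring y]
  show ?thesis
  proof (cases "a \<in> S")
    case True
    moreover have "a \<otimes> y [^] (1::nat) = a \<otimes> y \<oplus> y [^] Suc 1 \<otimes> \<zero>" using a(1) y by simp
    moreover have "a \<otimes> y \<in> power_span K D y 1"
      using monomial_in_power_span[OF D_subring y a(3), of 0 1] a(1) y by simp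
    moreover have "\<zero> \<in> power_span K D y 0" by simp
    ultimately show ?thesis by blast
  next
    case False
    obtain n where n: "adjoin y \<subseteq> saturation K S (power_span K D y n <+> (\<otimes>) a ` adjoin y)"
      using adjoin_finite_mod[OF y a(2,3)] by blast
    have "y [^] n \<in> adjoin y" using power_in_power_span[OF D_subring y, of n "Suc n"] by blast
    then obtain t where t: "t \<in> S" "t \<otimes> y [^] n \<in> power_span K D y n <+> (\<otimes>) a ` adjoin y"
      using n by (blast elim: saturationE)
    then obtain h \<beta> k where h: "h \<in> power_span K D y n" and \<beta>: "\<beta> \<in> power_span K D y k"
      and eq: "t \<otimes> y [^] n = h \<oplus> a \<otimes> \<beta>" by (auto elim!: set_add_memE)
    have "\<beta> \<in> power_span K D y (Suc n) <+> (\<otimes>) (y [^] Suc n) ` power_span K D y k"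
      using power_span_split[OF D_subring y] \<beta> by blast
    then obtain l r d where l: "l \<in> power_span K D y n" and r: "r \<in> power_span K D y k" and d: "d \<in> D"
      and \<beta>_eq: "\<beta> = (l \<oplus> y [^] n \<otimes> d) \<oplus> y [^] Suc n \<otimes> r"
      by (auto simp: power_span.simps(2) elim!: set_add_memE)
    have "(t \<ominus> a \<otimes> d) \<otimes> y [^] n = (h \<oplus> a \<otimes> l) \<oplus> y [^] Suc n \<otimes> (a \<otimes> r)"
      using mult_system_subset[OF S_mult_system] t(1) span_carrier h l r D_carrier[OF d] a(1) y eq[unfolded \<beta>_eq]
      by (intro absorb_top_coefficient) auto
    moreover have "t \<ominus> a \<otimes> d \<in> S" using S_minus_image_Q[OF t(1) mult_mem_image_Q] a(2) False d by auto
    moreover have "h \<oplus> a \<otimes> l \<in> power_span K D y n" "a \<otimes> r \<in> power_span K D y k"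
      using a(2) h l r by (auto intro: subalgebra_add[OF span] subalgebra.smult_closed[OF span])
    ultimately show ?thesis by blast
  qed
qed

subsection \<open>Invertibility over the integral closure\<close>

lemma V_fraction:
  assumes x: "x \<in> D'" and u: "u \<in> S" shows "x \<otimes> inv u \<in> V"
proof -
  have carriers: "x \<in> carrier K" "u \<in> carrier K" "u \<in> Units K"
    using subringE(1)[OF D'_subring] x u S_subset D_carrier field_Units by auto
  then have "u \<otimes> (x \<otimes> inv u) = x" by (simp add: m_lcomm[of u x])
  then show ?thesis unfolding V_def using x carriers by (intro saturationI[OF _ u]) simp_all
qed

lemma nonzero_pair_invertible:
  assumes a: "a \<in> carrier K" "a \<noteq> \<zero>" and b: "b \<in> carrier K"
  shows "\<exists>g h. inverts_pair K V a b g h"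
proof -
  define y where "y = b \<otimes> inv a"
  have a_unit: "a \<in> Units K" using a field_Units by auto
  then have y: "y \<in> carrier K" using b by (simp add: y_def)
  obtain n k u l r where u: "u \<in> S" and l: "l \<in> power_span K D y n" and r: "r \<in> power_span K D y k"
    and relation: "u \<otimes> y [^] n = l \<oplus> y [^] Suc n \<otimes> r"
    using unit_coefficient_relation[OF y] by blast
  have u_D: "u \<in> D" and u_unit: "u \<in> Units K" using u S_subset D_carrier field_Units by auto
  have carriers: "u \<in> carrier K" "r \<in> carrier K"
    using u_unit power_span_carrier[OF D_subring y r] by auto
  define s where "s = u \<ominus> y \<otimes> r"
  have s: "s \<in> carrier K" using carriers y by (simp add: s_def)
  note integral = relation_upper_part[OF y u_D l r relation]
    relation_lower_part[OF y u_D l r relation, folded s_def]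
  define g h where "g = s \<otimes> (inv u \<otimes> inv a)" and "h = r \<otimes> (inv u \<otimes> inv a)"
  have times_a: "w \<otimes> (inv u \<otimes> inv a) \<otimes> a = w \<otimes> inv u" if "w \<in> carrier K" for w
    using that a_unit u_unit a(1) by (simp add: m_assoc)
  have times_b: "w \<otimes> (inv u \<otimes> inv a) \<otimes> b = (y \<otimes> w) \<otimes> inv u" if "w \<in> carrier K" for w
    using that a_unit u_unit b by (simp add: y_def m_ac)
  have "g \<otimes> a \<oplus> h \<otimes> b = (s \<oplus> y \<otimes> r) \<otimes> inv u"
    using s carriers y u_unit by (simp add: g_def h_def times_a times_b l_distr)
  also have "s \<oplus> y \<otimes> r = u" using carriers y by (simp add: s_def a_minus_def a_assoc l_neg)
  finally have "g \<otimes> a \<oplus> h \<otimes> b = \<one>" using u_unit by simp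
  moreover have "{g \<otimes> a, g \<otimes> b, h \<otimes> a, h \<otimes> b} \<subseteq> V"
    using V_fraction[OF _ u] integral s carriers by (simp add: g_def h_def times_a times_b)
  moreover have "g \<in> carrier K" "h \<in> carrier K" using s carriers a_unit u_unit by (simp_all add: g_def h_def)
  ultimately show ?thesis by (auto simp: inverts_pair_def)
qed

lemma finite_invertible_over_V:
  assumes "finite F" "F \<noteq> {}" "F \<subseteq> carrier K - {\<zero>}" shows "invertible_over K V F"
  using nonzero_pair_invertible assms by (intro invertible_over_finite[OF V_subring]) auto

lemma V_carrier: "V \<subseteq> carrier K"
  by (rule subringE(1)[OF V_subring])

lemma V_if_multiple:
  assumes "z \<in> carrier K" "w \<in> S" "w \<otimes> z \<in> V" shows "z \<in> V"
  using saturation_saturation[OF S_mult_system] saturationI[OF assms(1,2)] assms(3) unfolding V_def by blast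

lemma V_common_conductor:
  assumes "finite A" "A \<subseteq> V"
  shows "\<exists>f \<in> S. \<exists>c \<in> D - {\<zero>}. \<forall>t \<in> A. \<forall>n::nat. c \<otimes> (f \<otimes> t) [^] n \<in> D"
proof -
  have "\<exists>f \<in> S. \<forall>t \<in> A. f \<in> colon K D' t"
  proof (rule mult_system_meets_family[OF S_mult_system S_subset_D' assms(1)])
    fix t assume "t \<in> A"
    then have t: "t \<in> V" "t \<in> carrier K" using assms(2) V_carrier by auto
    then show "subalgebra D' (colon K D' t) K"
      by (intro colon_subalgebra D'_subring subring_is_subalgebra)
    show "colon K D' t \<inter> S \<noteq> {}"
      using t(1) mult_system_subset[OF S_mult_system] unfolding V_def colon_def by (auto elim!: saturationE)
  qed
  then obtain f where f: "f \<in> S" "\<And>t. t \<in> A \<Longrightarrow> f \<otimes> t \<in> D'" by (auto simp: colon_def)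
  then have "(\<otimes>) f ` A \<subseteq> D'" by auto
  from complete_integral_closure_common_conductor[OF D_subring finite_imageI[OF assms(1)] this]
  have "\<exists>c \<in> D - {\<zero>}. \<forall>t \<in> A. \<forall>n::nat. c \<otimes> (f \<otimes> t) [^] n \<in> D" by simp
  then show ?thesis using f(1) by blast
qed

text \<open>If \<open>c w z\<^sup>n \<in> D\<close> then \<open>w z\<^sup>n\<close> lies in \<open>D[z]\<close> with denominator \<open>c\<close>, hence has degree bounded
  independently of \<open>n\<close>; this is an integral equation for \<open>w z\<close>.\<close>

lemma V_if_powers_bounded:
  assumes z: "z \<in> carrier K" and c: "c \<in> D - {\<zero>}"
    and powers: "\<And>k::nat. \<exists>n \<ge> k. \<exists>w \<in> S. c \<otimes> (w \<otimes> z [^] n) \<in> D"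
  shows "z \<in> V"
proof -
  have c_nonzero: "c \<in> carrier K - {\<zero>}" using c D_carrier by auto
  obtain k where k: "adjoin z \<inter> colon K D c \<subseteq> power_span K D z k"
    using bounded_degree[OF z c_nonzero] by blast
  obtain n w where n: "n \<ge> max 1 k" and w: "w \<in> S" and mem: "c \<otimes> (w \<otimes> z [^] n) \<in> D" using powers by blast
  have w_D: "w \<in> D" "w \<in> carrier K" using w S_subset D_carrier by auto
  note monomial = monomial_in_power_span[OF D_subring z w_D(1)]
  have "w \<otimes> z [^] n \<in> colon K D c" using mem w_D z c_nonzero by (simp add: colon_def m_comm)
  then have "w \<otimes> z [^] n \<in> power_span K D z k" using monomial[of n "Suc n"] k by blast
  then have top: "w \<otimes> z [^] n \<in> power_span K D z n"
    using power_span_mono[OF D_subring z, of k n] n by auto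
  have "z [^] i \<otimes> (w \<otimes> z) \<in> power_span K D z n" if "i < n" for i
  proof -
    have "z [^] i \<otimes> (w \<otimes> z) = w \<otimes> z [^] Suc i" using z w_D by (simp add: m_ac)
    then show ?thesis using monomial[of "Suc i" n] top that by (cases "Suc i = n") auto
  qed
  then have "w \<otimes> z \<in> D'" using power_span_stable[OF z, of "w \<otimes> z" n] z w_D n by auto
  then show ?thesis unfolding V_def by (rule saturationI[OF z w])
qed

end

subsection \<open>Frobenius powers over adjacent primes\<close>

locale adjacent_primes_char_p = adjacent_primes K R \<phi> P Q + R: prime_char R p
  for K :: "('k, 'm) ring_scheme" (structure) and R :: "('a, 'b) ring_scheme" and \<phi> P Q p

sublocale adjacent_primes_char_p \<subseteq> prime_char K p
proof unfold_locales
  have "\<phi> (add_pow R n \<one>\<^bsub>R\<^esub>) = add_pow K n \<one>" for n :: nat by (induction n) simp_all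
  from this[of p] show "char_p K p" using R.char by (simp add: char_p_def)
qed

context adjacent_primes_char_p
begin

lemma hom_p_power: "r \<in> carrier R \<Longrightarrow> \<phi> (r [^]\<^bsub>R\<^esub> (n::nat)) = \<phi> r [^] n"
  by (rule \<phi>.ring.hom_nat_pow)

lemma image_frobenius_powers_mult_mem:
  assumes "A \<subseteq> carrier R" and t: "t \<in> carrier K" and "\<And>a. a \<in> A \<Longrightarrow> \<phi> a [^] (p ^ e) \<otimes> t \<in> D"
    and i: "i \<in> frobenius_powers R p (genideal R A) e"
  shows "\<phi> i \<otimes> t \<in> D"
proof -
  have "ideal {r \<in> carrier R. \<phi> r \<in> colon K D t} R"
    using t by (intro preimage_ideal colon_subalgebra D_subring subring_is_subalgebra)
  then have "frobenius_powers R p (genideal R A) e \<subseteq> {r \<in> carrier R. \<phi> r \<in> colon K D t}"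
    using assms by (intro R.frob_ideal_genideal_minimal) (auto simp: colon_def hom_p_power subset_iff)
  then show ?thesis using i by (auto simp: colon_def)
qed

lemma inverse_multiple_mem_V:
  assumes A: "finite A" "A \<subseteq> carrier R" and x: "x \<in> carrier R" and c\<^sub>0: "c\<^sub>0 \<in> carrier R - P"
    and multiplier: "c\<^sub>0 \<in> multipliers R p
      (\<lambda>e. saturation R (carrier R - Q) (frobenius_powers R p (genideal R A) e)) x"
    and h: "h \<in> carrier K" "\<And>a. a \<in> A \<Longrightarrow> h \<otimes> \<phi> a \<in> V"
  shows "h \<otimes> \<phi> x \<in> V"
proof -
  obtain f c where f: "f \<in> S" and c: "c \<in> D - {\<zero>}"
    and conductor: "\<And>a n. a \<in> A \<Longrightarrow> c \<otimes> (f \<otimes> (h \<otimes> \<phi> a)) [^] (n::nat) \<in> D"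
    using V_common_conductor[of "(\<lambda>a. h \<otimes> \<phi> a) ` A"] A(1) h(2) by blast
  define g where "g = f \<otimes> h"
  have carriers: "f \<in> carrier K" "c \<in> carrier K" "g \<in> carrier K"
    using f c mult_system_subset[OF S_mult_system] D_carrier h(1) by (auto simp: g_def)
  have denominator: "\<phi> i \<otimes> (c \<otimes> g [^] (p ^ e)) \<in> D" if i: "i \<in> frobenius_powers R p (genideal R A) e" for i e
  proof (rule image_frobenius_powers_mult_mem[OF A(2) _ _ i])
    fix a assume a: "a \<in> A"
    then have "\<phi> a [^] (p ^ e) \<otimes> (c \<otimes> g [^] (p ^ e)) = c \<otimes> (f \<otimes> (h \<otimes> \<phi> a)) [^] (p ^ e)"
      using A(2) carriers h(1) by (auto simp: g_def nat_pow_distrib m_ac)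
    then show "\<phi> a [^] (p ^ e) \<otimes> (c \<otimes> g [^] (p ^ e)) \<in> D" using conductor[OF a] by simp
  qed (use carriers in simp)
  have "g \<otimes> \<phi> x \<in> V"
  proof (rule V_if_powers_bounded)
    show "c \<otimes> \<phi> c\<^sub>0 \<in> D - {\<zero>}"
      using c c\<^sub>0 kernel mult_system_mult[OF nonzero_mult_system[OF D_subring]] by auto
    fix k :: nat
    obtain e w where e: "e \<ge> k" and w: "w \<in> carrier R - Q"
      "w \<otimes>\<^bsub>R\<^esub> (c\<^sub>0 \<otimes>\<^bsub>R\<^esub> x [^]\<^bsub>R\<^esub> (p ^ e)) \<in> frobenius_powers R p (genideal R A) e"
      using multipliers_saturation_frequently[OF multiplier] by blast
    have "c \<otimes> \<phi> c\<^sub>0 \<otimes> (\<phi> w \<otimes> (g \<otimes> \<phi> x) [^] (p ^ e)) =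
        \<phi> (w \<otimes>\<^bsub>R\<^esub> (c\<^sub>0 \<otimes>\<^bsub>R\<^esub> x [^]\<^bsub>R\<^esub> (p ^ e))) \<otimes> (c \<otimes> g [^] (p ^ e))"
      using w(1) c\<^sub>0 x carriers by (simp add: hom_p_power nat_pow_distrib m_ac)
    also have "\<dots> \<in> D" by (rule denominator[OF w(2)])
    finally have "c \<otimes> \<phi> c\<^sub>0 \<otimes> (\<phi> w \<otimes> (g \<otimes> \<phi> x) [^] (p ^ e)) \<in> D" .
    moreover have "\<phi> w \<in> S" using w(1) by (auto simp: S_def)
    moreover have "k \<le> p ^ e" using e le_p_power by (rule order_trans)
    ultimately show "\<exists>n \<ge> k. \<exists>w \<in> S. c \<otimes> \<phi> c\<^sub>0 \<otimes> (w \<otimes> (g \<otimes> \<phi> x) [^] n) \<in> D" by blast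
  qed (use carriers x in simp)
  then show ?thesis
    using V_if_multiple[OF _ f, of "h \<otimes> \<phi> x"] h(1) x carriers(1) by (simp add: g_def m_assoc)
qed

text \<open>With \<open>1 = \<Sum> h\<^sub>\<alpha> \<alpha>\<close>, the element \<open>\<phi> x = \<Sum> (h\<^sub>\<alpha> \<phi> x) \<alpha>\<close> lies in the extension of \<open>I\<close> to \<open>V\<close>.\<close>

lemma frobenius_image_of_invertible:
  assumes I: "ideal I R" and F: "finite F" "F \<subseteq> \<phi> ` I" and x: "x \<in> carrier R"
    and h: "h \<in> F \<rightarrow> carrier K" "(\<Oplus>\<alpha>\<in>F. h \<alpha> \<otimes> \<alpha>) = \<one>" "\<And>\<alpha>. \<alpha> \<in> F \<Longrightarrow> h \<alpha> \<otimes> \<phi> x \<in> V"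
  shows "\<exists>f \<in> S. \<exists>c \<in> D - {\<zero>}. \<forall>e. c \<otimes> (f \<otimes> \<phi> x) [^] (p ^ e) \<in> \<phi> ` frobenius_powers R p I e"
proof -
  obtain f c where f: "f \<in> S" and c: "c \<in> D - {\<zero>}"
    and conductor: "\<And>\<alpha> n. \<alpha> \<in> F \<Longrightarrow> c \<otimes> (f \<otimes> (h \<alpha> \<otimes> \<phi> x)) [^] (n::nat) \<in> D"
    using V_common_conductor[of "(\<lambda>\<alpha>. h \<alpha> \<otimes> \<phi> x) ` F"] F(1) h(3) by blast
  have f_carrier: "f \<in> carrier K" and c_carrier: "c \<in> carrier K"
    using f c mult_system_subset[OF S_mult_system] D_carrier by auto
  have carriers: "\<alpha> \<in> carrier K" "h \<alpha> \<in> carrier K" if "\<alpha> \<in> F" for \<alpha>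
    using that F(2) h(1) R.ideal_subset[OF I] by auto
  have "c \<otimes> (f \<otimes> \<phi> x) [^] (p ^ e) \<in> \<phi> ` frobenius_powers R p I e" for e
  proof -
    have image: "subalgebra D (\<phi> ` frobenius_powers R p I e) K"
      by (intro \<phi>.ring.img_is_subalgebra R.ideal_is_subalgebra R.frob_ideal_ideal I subset_refl)
    have "f \<otimes> \<phi> x = (\<Oplus>\<alpha>\<in>F. h \<alpha> \<otimes> \<alpha>) \<otimes> (f \<otimes> \<phi> x)" using h(2) f_carrier x by simp
    also have "\<dots> = (\<Oplus>\<alpha>\<in>F. h \<alpha> \<otimes> \<alpha> \<otimes> (f \<otimes> \<phi> x))"
      using F(1) carriers f_carrier x by (intro finsum_ldistr) auto
    finally have "c \<otimes> (f \<otimes> \<phi> x) [^] (p ^ e) = c \<otimes> (\<Oplus>\<alpha>\<in>F. h \<alpha> \<otimes> \<alpha> \<otimes> (f \<otimes> \<phi> x)) [^] (p ^ e)"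
      by (rule arg_cong)
    also have "\<dots> = (\<Oplus>\<alpha>\<in>F. c \<otimes> (h \<alpha> \<otimes> \<alpha> \<otimes> (f \<otimes> \<phi> x)) [^] (p ^ e))"
      using F(1) carriers f_carrier c_carrier x by (simp add: frobenius_finsum finsum_rdistr Pi_def)
    also have "\<dots> \<in> \<phi> ` frobenius_powers R p I e"
    proof (rule subalgebra_finsum[OF image], rule funcsetI)
      fix \<alpha> assume \<alpha>: "\<alpha> \<in> F"
      then obtain i where i: "i \<in> I" "i \<in> carrier R" "\<alpha> = \<phi> i" using F(2) R.ideal_subset[OF I] by auto
      have "\<alpha> [^] (p ^ e) \<in> \<phi> ` frobenius_powers R p I e"
        using R.pow_mem_frob_ideal[OF I i(1)] i(2,3) hom_p_power by (intro image_eqI) auto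
      moreover have "c \<otimes> (h \<alpha> \<otimes> \<alpha> \<otimes> (f \<otimes> \<phi> x)) [^] (p ^ e) =
          (c \<otimes> (f \<otimes> (h \<alpha> \<otimes> \<phi> x)) [^] (p ^ e)) \<otimes> \<alpha> [^] (p ^ e)"
        using carriers[OF \<alpha>] f_carrier c_carrier x by (simp add: nat_pow_distrib m_ac)
      ultimately show "c \<otimes> (h \<alpha> \<otimes> \<alpha> \<otimes> (f \<otimes> \<phi> x)) [^] (p ^ e) \<in> \<phi> ` frobenius_powers R p I e"
        using subalgebra.smult_closed[OF image conductor[OF \<alpha>]] by simp
    qed
    finally show ?thesis .
  qed
  then show ?thesis using f c by blast
qed

lemma multiplier_of_image_mem:
  assumes I: "ideal I R" and x: "x \<in> carrier R" and c: "c \<in> carrier R"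
    and image: "\<And>e. \<phi> c \<otimes> \<phi> x [^] (p ^ e) \<in> \<phi> ` frobenius_powers R p I e"
  shows "c \<in> multipliers R p (frobenius_powers_mod R p P I) x"
proof -
  have "c \<otimes>\<^bsub>R\<^esub> x [^]\<^bsub>R\<^esub> (p ^ e) \<in> frobenius_powers_mod R p P I e" for e
  proof -
    obtain i where i: "i \<in> frobenius_powers R p I e" "\<phi> c \<otimes> \<phi> x [^] (p ^ e) = \<phi> i" using image by blast
    have i_carrier: "i \<in> carrier R" using R.ideal_subset[OF R.frob_ideal_ideal[OF I]] i(1) by auto
    let ?d = "c \<otimes>\<^bsub>R\<^esub> x [^]\<^bsub>R\<^esub> (p ^ e)"
    have "\<phi> (?d \<ominus>\<^bsub>R\<^esub> i) = \<zero>" using i(2) i_carrier x c by (simp add: a_minus_def hom_p_power r_neg)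
    then have "?d \<ominus>\<^bsub>R\<^esub> i \<in> P" using kernel[of "?d \<ominus>\<^bsub>R\<^esub> i"] i_carrier x c by auto
    moreover have "?d = i \<oplus>\<^bsub>R\<^esub> (?d \<ominus>\<^bsub>R\<^esub> i)"
      using i_carrier x c by (simp add: a_minus_def R.a_lcomm[of i] R.r_neg)
    ultimately show ?thesis using R.set_add_memI[OF i(1)] by metis
  qed
  then show ?thesis using c by (simp add: multipliers_def)
qed

lemma mem_P_if_multiplier:
  assumes I: "ideal I R" "I \<subseteq> P" and x: "x \<in> carrier R" and c: "c \<in> carrier R - P"
    and multiplier: "c \<in> multipliers R p (\<lambda>e. saturation R (carrier R - Q) (frobenius_powers R p I e)) x"
  shows "x \<in> P"
proof -
  note P_ideal = primeideal.axioms(1)[OF P_prime]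
  have generators: "I \<subseteq> carrier R" "I = genideal R I"
    using R.ideal_subset[OF I(1)] R.genideal_minimal[OF I(1) subset_refl] R.genideal_self[of I] by auto
  have "frobenius_powers R p I e \<subseteq> P" for e
    using R.frob_ideal_genideal_minimal[OF P_ideal generators(1)] R.ideal_pow_mem[OF P_ideal] R.p_power_pos I(2)
    by (subst generators(2)) blast
  then have "saturation R (carrier R - Q) (frobenius_powers R p I e) \<subseteq> P" for e
    using PQ by (intro R.saturation_subset_prime[OF P_prime]) auto
  then obtain e where "c \<otimes>\<^bsub>R\<^esub> x [^]\<^bsub>R\<^esub> (p ^ e) \<in> P"
    using multiplier by (auto simp: multipliers_def eventually_sequentially)
  then show ?thesis
    using R.prime_mult_notin[OF P_prime, of c "x [^]\<^bsub>R\<^esub> (p ^ e)"] R.prime_pow_notin[OF P_prime x] c x by auto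
qed

lemma frobenius_image_if_multiplier:
  assumes I: "ideal I R" "\<not> I \<subseteq> P" and x: "x \<in> carrier R" and c\<^sub>0: "c\<^sub>0 \<in> carrier R - P"
    and multiplier: "c\<^sub>0 \<in> multipliers R p (\<lambda>e. saturation R (carrier R - Q) (frobenius_powers R p I e)) x"
  shows "\<exists>f \<in> S. \<exists>c \<in> D - {\<zero>}. \<forall>e. c \<otimes> (f \<otimes> \<phi> x) [^] (p ^ e) \<in> \<phi> ` frobenius_powers R p I e"
proof -
  obtain A where A: "A \<subseteq> carrier R" "finite A" "I = genideal R A" using R.finetely_gen[OF I(1)] by auto
  define F where "F = \<phi> ` A - {\<zero>}"
  have F: "finite F" "F \<subseteq> carrier K - {\<zero>}" "F \<subseteq> \<phi> ` I"
    using A R.genideal_self[OF A(1)] by (auto simp: F_def)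
  have "F \<noteq> {}"
    using I(2) A R.genideal_minimal[OF primeideal.axioms(1)[OF P_prime], of A] kernel by (auto simp: F_def)
  then obtain h where h: "h \<in> F \<rightarrow> carrier K" "\<And>\<alpha> \<beta>. \<alpha> \<in> F \<Longrightarrow> \<beta> \<in> F \<Longrightarrow> h \<alpha> \<otimes> \<beta> \<in> V"
    "(\<Oplus>\<alpha>\<in>F. h \<alpha> \<otimes> \<alpha>) = \<one>"
    using finite_invertible_over_V[OF F(1) _ F(2)] by (auto simp: invertible_over_def)
  have "h \<alpha> \<otimes> \<phi> x \<in> V" if \<alpha>: "\<alpha> \<in> F" for \<alpha>
  proof (rule inverse_multiple_mem_V[OF A(2,1) x c\<^sub>0 multiplier[unfolded A(3)]])
    show "h \<alpha> \<in> carrier K" using h(1) \<alpha> by auto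
    then show "h \<alpha> \<otimes> \<phi> a \<in> V" if "a \<in> A" for a
      using h(2)[OF \<alpha>, of "\<phi> a"] that subringE(2)[OF V_subring] by (cases "\<phi> a = \<zero>") (auto simp: F_def)
  qed
  then show ?thesis by (rule frobenius_image_of_invertible[OF I(1) F(1,3) x h(1,3)])
qed

lemma saturation_multiplier_closure_mod:
  assumes I: "ideal I R" and x: "x \<in> carrier R" and c\<^sub>0: "c\<^sub>0 \<in> carrier R - P"
    and multiplier: "c\<^sub>0 \<in> multipliers R p (\<lambda>e. saturation R (carrier R - Q) (frobenius_powers R p I e)) x"
  shows "x \<in> saturation R (carrier R - Q) (multiplier_closure R p (carrier R - P) (frobenius_powers_mod R p P I))"
proof (cases "I \<subseteq> P")
  case True
  then have "x \<in> multiplier_closure R p (carrier R - P) (frobenius_powers_mod R p P I)"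
    by (intro R.mem_multiplier_closure_mod_if_mem[OF P_prime I] mem_P_if_multiplier[OF I _ x c\<^sub>0 multiplier])
  then show ?thesis using x R.prime_one_notin[OF Q_prime] by (intro saturationI[of _ _ "\<one>\<^bsub>R\<^esub>"]) simp_all
next
  case False
  from frobenius_image_if_multiplier[OF I False x c\<^sub>0 multiplier]
  obtain f c where f: "f \<in> carrier R - Q" and c: "c \<in> carrier R" "\<phi> c \<noteq> \<zero>"
    and image: "\<And>e. \<phi> c \<otimes> (\<phi> f \<otimes> \<phi> x) [^] (p ^ e) \<in> \<phi> ` frobenius_powers R p I e"
    by (auto simp: S_def)
  have "c \<in> multipliers R p (frobenius_powers_mod R p P I) (f \<otimes>\<^bsub>R\<^esub> x)"
    using f x c(1) image by (intro multiplier_of_image_mem[OF I]) auto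
  then have "f \<otimes>\<^bsub>R\<^esub> x \<in> multiplier_closure R p (carrier R - P) (frobenius_powers_mod R p P I)"
    using f x c kernel by (auto simp: multiplier_closure_def)
  then show ?thesis by (rule saturationI[OF x f])
qed

end

section \<open>Residue fields\<close>

context domain
begin

interpretation fractions: localized_ring R "carrier R - {\<zero>}"
  by unfold_locales (rule nonzero_mult_system[OF carrier_is_subring])

lemma fraction_eq_zero_iff:
  assumes "r \<in> carrier R" "s \<in> carrier R - {\<zero>}"
  shows "loc_frac R (carrier R - {\<zero>}) r s = \<zero>\<^bsub>localization R (carrier R - {\<zero>})\<^esub> \<longleftrightarrow> r = \<zero>"
  using assms fractions.frac_eq_iff[OF assms zero_closed fractions.W_one]
  by (auto simp: fractions.zero_L integral_iff)

lemma field_of_fractions: "field (localization R (carrier R - {\<zero>}))"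
proof (rule fractions.L.cring_fieldI2)
  show "\<zero>\<^bsub>fractions.L\<^esub> \<noteq> \<one>\<^bsub>fractions.L\<^esub>"
    using fraction_eq_zero_iff[OF one_closed fractions.W_one] by (auto simp: fractions.one_L)
  fix a assume a: "a \<in> carrier fractions.L" "a \<noteq> \<zero>\<^bsub>fractions.L\<^esub>"
  then obtain r s where r: "r \<in> carrier R" "s \<in> carrier R - {\<zero>}" "a = fractions.frac r s"
    by (blast elim: fractions.carrier_L_cases)
  then have r_nonzero: "r \<in> carrier R - {\<zero>}" using a(2) fraction_eq_zero_iff by auto
  then have "a \<otimes>\<^bsub>fractions.L\<^esub> fractions.frac s r = fractions.frac (r \<otimes> s) (s \<otimes> r)"
    using r by (simp add: fractions.mult_frac)
  also have "\<dots> = \<one>\<^bsub>fractions.L\<^esub>"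
    unfolding fractions.one_L using r r_nonzero fractions.W_one fractions.W_mult
    by (intro fractions.frac_eqI) (auto simp: m_comm)
  finally show "\<exists>b\<in>carrier fractions.L. a \<otimes>\<^bsub>fractions.L\<^esub> b = \<one>\<^bsub>fractions.L\<^esub>"
    using r(2) r_nonzero by (intro bexI[of _ "fractions.frac s r"]) auto
qed

lemma loc_map_eq_zero_iff:
  "r \<in> carrier R \<Longrightarrow> loc_map R (carrier R - {\<zero>}) r = \<zero>\<^bsub>localization R (carrier R - {\<zero>})\<^esub> \<longleftrightarrow> r = \<zero>"
  using fraction_eq_zero_iff[OF _ fractions.W_one] by (simp add: loc_map_def)

lemma field_of_fractions_denominator:
  assumes "z \<in> carrier (localization R (carrier R - {\<zero>}))"
  shows "\<exists>r \<in> carrier R. \<exists>s \<in> carrier R - {\<zero>}.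
    loc_map R (carrier R - {\<zero>}) s \<otimes>\<^bsub>localization R (carrier R - {\<zero>})\<^esub> z = loc_map R (carrier R - {\<zero>}) r"
proof -
  obtain r s where "r \<in> carrier R" "s \<in> carrier R - {\<zero>}" "z = fractions.frac r s"
    using assms by (rule fractions.carrier_L_cases)
  then show ?thesis using fractions.loc_map_eq_mult_frac[of r s] by auto
qed

lemmas loc_map_fractions_hom = fractions.loc_map_hom

end

lemma (in cring) exists_residue_field:
  assumes P: "primeideal P R"
  obtains K :: "('a set \<times> 'a set) set ring" and \<phi> where "field K" "\<phi> \<in> ring_hom R K"
    "\<And>r. r \<in> carrier R \<Longrightarrow> \<phi> r = \<zero>\<^bsub>K\<^esub> \<longleftrightarrow> r \<in> P"
    "\<And>z. z \<in> carrier K \<Longrightarrow> \<exists>d \<in> \<phi> ` carrier R - {\<zero>\<^bsub>K\<^esub>}. d \<otimes>\<^bsub>K\<^esub> z \<in> \<phi> ` carrier R"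
proof -
  interpret P: primeideal P R by (rule P)
  let ?D = "R Quot P" and ?quot = "(+>) P"
  interpret D: domain ?D by (rule P.quotient_is_domain)
  let ?K = "localization ?D (carrier ?D - {\<zero>\<^bsub>?D\<^esub>})" and ?loc = "loc_map ?D (carrier ?D - {\<zero>\<^bsub>?D\<^esub>})"
  have quot_zero_iff: "?quot r = \<zero>\<^bsub>?D\<^esub> \<longleftrightarrow> r \<in> P" if "r \<in> carrier R" for r
    using P.rcos_const_imp_mem[OF that] a_rcos_zero[OF P.is_ideal] by (auto simp: FactRing_def)
  have surj: "?quot ` carrier R = carrier ?D"
    by (auto simp: FactRing_def A_RCOSETS_def' a_r_coset_def')
  have kernel: "(?loc \<circ> ?quot) r = \<zero>\<^bsub>?K\<^esub> \<longleftrightarrow> r \<in> P" if "r \<in> carrier R" for r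
    using D.loc_map_eq_zero_iff quot_zero_iff[OF that] surj that by auto
  show thesis
  proof (rule that[of ?K "?loc \<circ> ?quot"])
    show "field ?K" by (rule D.field_of_fractions)
    show "?loc \<circ> ?quot \<in> ring_hom R ?K"
      by (rule ring_hom_trans[OF P.rcos_ring_hom D.loc_map_fractions_hom])
    fix z assume "z \<in> carrier ?K"
    then obtain d' d where "d' \<in> carrier ?D" "d \<in> carrier ?D - {\<zero>\<^bsub>?D\<^esub>}" "?loc d \<otimes>\<^bsub>?K\<^esub> z = ?loc d'"
      using D.field_of_fractions_denominator by blast
    moreover from this have "?loc d \<noteq> \<zero>\<^bsub>?K\<^esub>" using D.loc_map_eq_zero_iff by auto
    ultimately show "\<exists>d \<in> (?loc \<circ> ?quot) ` carrier R - {\<zero>\<^bsub>?K\<^esub>}. d \<otimes>\<^bsub>?K\<^esub> z \<in> (?loc \<circ> ?quot) ` carrier R"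
      unfolding image_comp[symmetric] surj by auto
  qed (rule kernel)
qed

section \<open>Localization of tight closure in dimension at most two\<close>

definition height_le_one :: "('a, 'b) ring_scheme \<Rightarrow> 'a set \<Rightarrow> bool" where
  "height_le_one R Q \<longleftrightarrow>
    (\<forall>P Q'. primeideal P R \<longrightarrow> primeideal Q' R \<longrightarrow> P \<subset> Q' \<longrightarrow> Q' \<subseteq> Q \<longrightarrow> Q' = Q)"

lemma (in noetherian_cring) height_le_one_if_no_long_chain:
  assumes dim: "\<not> prime_chain R 3" and Q: "primeideal Q R" "\<not> maximalideal Q R"
  shows "height_le_one R Q"
  unfolding height_le_one_def
proof (intro allI impI, rule ccontr)
  fix P Q' assume chain: "primeideal P R" "primeideal Q' R" "P \<subset> Q'" "Q' \<subseteq> Q" "Q' \<noteq> Q"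
  obtain M where M: "maximalideal M R" "Q \<subseteq> M"
    using proper_ideal_in_maximal primeideal.axioms(1)[OF Q(1)] primeideal.I_notcarr[OF Q(1)] by metis
  then have "Q \<subset> M" using Q(2) by auto
  define Ps where "Ps i = (if i = 0 then P else if i = 1 then Q' else if i = 2 then Q else M)" for i :: nat
  have "primeideal (Ps i) R" for i using chain(1,2) Q(1) maximalideal_prime[OF M(1)] by (simp add: Ps_def)
  moreover have "Ps i \<subset> Ps (Suc i)" if "i < 3" for i
  proof -
    have "i = 0 \<or> i = 1 \<or> i = 2" using that by auto
    then show ?thesis using chain(3-5) \<open>Q \<subset> M\<close> by (auto simp: Ps_def)
  qed
  ultimately show False using dim unfolding prime_chain_def by blast
qed

lemma no_prime_chain_if_krull_dim_less:
  assumes "krull_dim R < enat n" shows "\<not> prime_chain R n"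
proof
  assume "prime_chain R n"
  then have "enat n \<le> krull_dim R" unfolding krull_dim_def by (intro SUP_upper) simp
  then show False using assms by simp
qed

lemma (in noetherian_cring) power_multiple_mem_ideal:
  fixes n :: nat
  assumes J: "ideal J R" and A: "A \<subseteq> carrier R" and W: "W \<subseteq> carrier R"
    and x: "x \<in> carrier R" and v: "v \<in> carrier R" and c: "c \<in> carrier R" and d: "d \<in> carrier R"
    and disjoint: "\<And>M. maximalideal M R \<Longrightarrow> A \<subseteq> M \<Longrightarrow> M \<inter> W = {}"
    and localized: "c \<otimes> x [^] n \<in> saturation R W J"
    and multiples: "\<And>y. y \<in> A \<Longrightarrow> d \<otimes> (y \<otimes> (v \<otimes> x)) [^] n \<in> J"
  shows "(d \<otimes> c) \<otimes> (v \<otimes> x) [^] n \<in> J"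
proof -
  define z where "z = (d \<otimes> c) \<otimes> (v \<otimes> x) [^] n"
  have z: "z \<in> carrier R" using d c v x by (simp add: z_def)
  obtain w where w: "w \<in> W" "w \<otimes> (c \<otimes> x [^] n) \<in> J" using localized by (rule saturationE)
  then have w_carrier: "w \<in> carrier R" using W by auto
  have "colon R J z = carrier R"
  proof (rule ideal_eq_carrier_if_contains_powers[OF colon_ideal[OF J z] _ _ A])
    have "w \<otimes> z = (d \<otimes> v [^] n) \<otimes> (w \<otimes> (c \<otimes> x [^] n))"
      unfolding z_def using w_carrier c d v x by (simp add: nat_pow_distrib m_ac)
    then show "w \<in> colon R J z"
      using ideal.I_l_closed[OF J w(2), of "d \<otimes> v [^] n"] d v w_carrier by (simp add: colon_def)
    fix y assume y: "y \<in> A"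
    then have y_carrier: "y \<in> carrier R" using A by auto
    have "y [^] n \<otimes> z = c \<otimes> (d \<otimes> (y \<otimes> (v \<otimes> x)) [^] n)"
      unfolding z_def using y_carrier c d v x by (simp add: nat_pow_distrib m_ac)
    then show "y [^] n \<in> colon R J z"
      using ideal.I_l_closed[OF J multiples[OF y] c] y_carrier by (simp add: colon_def)
  next
    show "w \<notin> M" if "maximalideal M R" "A \<subseteq> M" for M using disjoint[OF that] w(1) by auto
  qed
  then have "\<one> \<in> colon R J z" by simp
  then show ?thesis using z by (simp add: colon_def z_def)
qed

context noetherian_char_p
begin

lemma saturation_multiplier_closure_mod_prime:
  assumes P: "primeideal P R" and Q: "primeideal Q R" "P \<subseteq> Q" "height_le_one R Q"
    and I: "ideal I R" and x: "x \<in> carrier R" and c: "c \<in> carrier R - P"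
    and multiplier: "c \<in> multipliers R p (\<lambda>e. saturation R (carrier R - Q) (frobenius_powers R p I e)) x"
  shows "x \<in> saturation R (carrier R - Q) (multiplier_closure R p (carrier R - P) (frobenius_powers_mod R p P I))"
proof -
  obtain K :: "('a set \<times> 'a set) set ring" and \<phi> where K: "field K" "\<phi> \<in> ring_hom R K"
    "\<And>r. r \<in> carrier R \<Longrightarrow> \<phi> r = \<zero>\<^bsub>K\<^esub> \<longleftrightarrow> r \<in> P"
    "\<And>z. z \<in> carrier K \<Longrightarrow> \<exists>d \<in> \<phi> ` carrier R - {\<zero>\<^bsub>K\<^esub>}. d \<otimes>\<^bsub>K\<^esub> z \<in> \<phi> ` carrier R"
    using exists_residue_field[OF P] by blast
  have "adjacent_primes K R \<phi> P Q"
    using Q(3) P unfolding height_le_one_def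
    by (intro adjacent_primes.intro adjacent_primes_axioms.intro K noetherian_cring_axioms P Q) auto
  then have "adjacent_primes_char_p K R \<phi> P Q p" by (intro adjacent_primes_char_p.intro prime_char_axioms)
  then show ?thesis
    by (rule adjacent_primes_char_p.saturation_multiplier_closure_mod[OF _ I x c multiplier])
qed

lemma tight_closure_at_height_le_one_prime:
  assumes Q: "primeideal Q R" "height_le_one R Q" and I: "ideal I R" and x: "x \<in> carrier R"
    and multiplier: "c \<in> multipliers R p (\<lambda>e. saturation R (carrier R - Q) (frobenius_powers R p I e)) x"
    and c: "\<And>P. minimal_prime R P \<Longrightarrow> P \<subseteq> Q \<Longrightarrow> c \<notin> P"
  shows "x \<in> saturation R (carrier R - Q) (tight_closure R p I)"
proof -
  let ?F = "\<lambda>P. multiplier_closure R p (carrier R - P) (frobenius_powers_mod R p P I)"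
  have "\<exists>f \<in> carrier R - Q. \<forall>P \<in> {P. minimal_prime R P}. f \<in> colon R (?F P) x"
  proof (rule mult_system_meets_ideals[OF prime_complement_mult_system[OF Q(1)] finite_minimal_primes])
    fix P assume "P \<in> {P. minimal_prime R P}"
    then have P: "minimal_prime R P" "primeideal P R" using minimal_prime_prime by auto
    show "ideal (colon R (?F P) x) R"
      by (rule colon_ideal[OF multiplier_closure_mod_ideal[OF P(2) I] x])
    show "colon R (?F P) x \<inter> (carrier R - Q) \<noteq> {}"
    proof (cases "P \<subseteq> Q")
      case True
      have "c \<in> carrier R - P" using multiplier c[OF P(1) True] by (auto simp: multipliers_def)
      then have "x \<in> saturation R (carrier R - Q) (?F P)"
        by (rule saturation_multiplier_closure_mod_prime[OF P(2) Q(1) True Q(2) I x _ multiplier])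
      then show ?thesis by (auto simp: colon_def elim!: saturationE)
    next
      case False
      then obtain f where f: "f \<in> P" "f \<notin> Q" by auto
      have "f \<otimes> x \<in> ?F P"
        using ideal.I_r_closed[OF minimal_prime_ideal[OF P(1)] f(1) x]
        by (rule mem_multiplier_closure_mod_if_mem[OF P(2) I])
      then show ?thesis using f ideal_subset[OF minimal_prime_ideal[OF P(1)]] by (auto simp: colon_def)
    qed
  qed
  then obtain f where f: "f \<in> carrier R - Q" "\<And>P. minimal_prime R P \<Longrightarrow> f \<otimes> x \<in> ?F P"
    by (auto simp: colon_def)
  then have "f \<otimes> x \<in> tight_closure R p I" using x by (intro tight_closure_mod_minimal_primes[OF I]) auto
  then show ?thesis by (rule saturationI[OF x f(1)])
qed

lemma saturation_tight_closure_if_multiplier: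
  assumes W: "mult_system R W" and I: "ideal I R" and u: "u \<in> carrier R"
    and multiplier: "c \<in> multipliers R p (frobenius_powers R p I) u"
    and c: "\<And>P. minimal_prime R P \<Longrightarrow> P \<inter> W = {} \<Longrightarrow> c \<notin> P"
  shows "u \<in> saturation R W (tight_closure R p I)"
proof -
  have "\<exists>t \<in> W. \<forall>P \<in> {P. minimal_prime R P \<and> P \<inter> W \<noteq> {}}. t \<in> P"
  proof (rule mult_system_meets_ideals[OF W])
    show "finite {P. minimal_prime R P \<and> P \<inter> W \<noteq> {}}"
      using finite_minimal_primes by (rule rev_finite_subset) auto
  qed (use minimal_prime_ideal in auto)
  then obtain t where t: "t \<in> W" "\<And>P. minimal_prime R P \<Longrightarrow> P \<inter> W \<noteq> {} \<Longrightarrow> t \<in> P" by auto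
  have t_carrier: "t \<in> carrier R" using mult_system_subset[OF W] t(1) by auto
  have "t \<otimes> u \<in> tight_closure R p I"
  proof (rule tight_closure_mod_minimal_primes[OF I])
    fix P assume P: "minimal_prime R P"
    show "t \<otimes> u \<in> multiplier_closure R p (carrier R - P) (frobenius_powers_mod R p P I)"
    proof (cases "P \<inter> W = {}")
      case True
      have "c \<in> multipliers R p (frobenius_powers R p I) (t \<otimes> u)"
        using multipliers_mult[of "frobenius_powers R p I" u t] frob_ideal_ideal[OF I] u t_carrier multiplier by auto
      then have "c \<in> multipliers R p (frobenius_powers_mod R p P I) (t \<otimes> u)"
        by (rule subsetD[OF multipliers_mono[OF frobenius_powers_mod_upper(1)[OF I minimal_prime_ideal[OF P]]]])
      then show ?thesis using c[OF P True] u t_carrier by (auto simp: multiplier_closure_def multipliers_def)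
    next
      case False
      then show ?thesis
        using mem_multiplier_closure_mod_if_mem[OF minimal_prime_prime[OF P] I]
          ideal.I_r_closed[OF minimal_prime_ideal[OF P] t(2)[OF P] u] by simp
    qed
  qed (use t_carrier u in simp)
  then show ?thesis by (rule saturationI[OF u t(1)])
qed

lemma multiplier_of_localized_multiplier:
  assumes W: "mult_system R W" and I: "ideal I R" and x: "x \<in> carrier R"
    and c: "c \<in> multipliers R p (\<lambda>e. saturation R W (frobenius_powers R p I e)) x"
    and primes: "\<And>Q. primeideal Q R \<Longrightarrow> colon R (tight_closure R p I) x \<subseteq> Q \<Longrightarrow> Q \<inter> W = {} \<Longrightarrow> maximalideal Q R"
  shows "\<exists>v \<in> W. \<exists>d \<in> ring_circ R. d \<otimes> c \<in> multipliers R p (frobenius_powers R p I) (v \<otimes> x)"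
proof -
  let ?J = "colon R (tight_closure R p I) x" and ?Fr = "frobenius_powers R p I"
  note J = colon_ideal[OF tight_closure_ideal[OF I] x] and Fr = frob_ideal_ideal[OF I]
  obtain v where v: "v \<in> W" "saturation R W ?J \<subseteq> colon R ?J v"
    using saturation_common_denominator[OF J W] by blast
  have v_carrier: "v \<in> carrier R" using mult_system_subset[OF W] v(1) by auto
  obtain A where A: "A \<subseteq> carrier R" "finite A" "saturation R W ?J = genideal R A"
    using finetely_gen[OF saturation_ideal[OF J W]] by auto
  have disjoint: "M \<inter> W = {}" if M: "maximalideal M R" "A \<subseteq> M" for M
  proof (rule maximal_above_saturation_disjoint[OF J W _ M(1)])
    show "saturation R W ?J \<subseteq> M"
      unfolding A(3) by (rule genideal_minimal[OF maximalideal.axioms(1)[OF M(1)] M(2)])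
  qed (rule primes)
  have "y \<otimes> (v \<otimes> x) \<in> tight_closure R p I" if "y \<in> A" for y
  proof -
    have "y \<in> colon R ?J v" using that v(2) A(3) genideal_self[OF A(1)] by auto
    then show ?thesis using v_carrier x by (auto simp: colon_def m_assoc)
  qed
  then have "(\<lambda>y. y \<otimes> (v \<otimes> x)) ` A \<subseteq> multiplier_closure R p (ring_circ R) ?Fr"
    by (auto simp: tight_closure_eq_multiplier_closure)
  then have "\<exists>d \<in> ring_circ R. \<forall>a \<in> (\<lambda>y. y \<otimes> (v \<otimes> x)) ` A. d \<in> multipliers R p ?Fr a"
    using A(2) by (intro common_multiplier Fr ring_circ_mult_system) auto
  then obtain d where d: "d \<in> ring_circ R" "\<And>y. y \<in> A \<Longrightarrow> d \<in> multipliers R p ?Fr (y \<otimes> (v \<otimes> x))" by auto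
  have carriers: "d \<in> carrier R" "c \<in> carrier R" using d(1) c by (auto simp: ring_circ_iff multipliers_def)
  have "\<forall>\<^sub>F e in sequentially. \<forall>y \<in> A. d \<otimes> (y \<otimes> (v \<otimes> x)) [^] (p ^ e) \<in> ?Fr e"
    using A(2) d(2) by (intro eventually_ball_finite) (auto simp: multipliers_def)
  moreover have "\<forall>\<^sub>F e in sequentially. c \<otimes> x [^] (p ^ e) \<in> saturation R W (?Fr e)"
    using c by (simp add: multipliers_def)
  ultimately have "\<forall>\<^sub>F e in sequentially. (d \<otimes> c) \<otimes> (v \<otimes> x) [^] (p ^ e) \<in> ?Fr e"
    by eventually_elim
      (use power_multiple_mem_ideal[OF Fr A(1) mult_system_subset[OF W] x v_carrier carriers(2,1) disjoint] in blast)
  then have "d \<otimes> c \<in> multipliers R p ?Fr (v \<otimes> x)" using carriers by (simp add: multipliers_def)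
  then show ?thesis using v(1) d(1) by blast
qed

lemma localized_tight_closure_subset_saturation:
  assumes W: "mult_system R W" and I: "ideal I R" and x: "x \<in> carrier R"
    and heights: "\<And>Q. primeideal Q R \<Longrightarrow> \<not> maximalideal Q R \<Longrightarrow> Q \<inter> W = {} \<Longrightarrow> height_le_one R Q"
    and multiplier: "c \<in> multipliers R p (\<lambda>e. saturation R W (frobenius_powers R p I e)) x"
    and c: "\<And>P. minimal_prime R P \<Longrightarrow> P \<inter> W = {} \<Longrightarrow> c \<notin> P"
  shows "x \<in> saturation R W (tight_closure R p I)"
proof -
  have "maximalideal Q R"
    if Q: "primeideal Q R" "colon R (tight_closure R p I) x \<subseteq> Q" "Q \<inter> W = {}" for Q
  proof (rule ccontr)
    assume nonmaximal: "\<not> maximalideal Q R"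
    have WQ: "W \<subseteq> carrier R - Q" using mult_system_subset[OF W] Q(3) by auto
    have "x \<in> saturation R (carrier R - Q) (tight_closure R p I)"
    proof (rule tight_closure_at_height_le_one_prime[OF Q(1) heights[OF Q(1) nonmaximal Q(3)] I x])
      show "c \<in> multipliers R p (\<lambda>e. saturation R (carrier R - Q) (frobenius_powers R p I e)) x"
        by (rule subsetD[OF multipliers_mono[OF saturation_mono_system[OF WQ]] multiplier])
      show "c \<notin> P" if "minimal_prime R P" "P \<subseteq> Q" for P using that(2) Q(3) by (intro c[OF that(1)]) auto
    qed
    then show False using Q(2) by (auto simp: colon_def elim!: saturationE)
  qed
  then obtain v d where v: "v \<in> W" and d: "d \<in> ring_circ R"
    and dc_multiplier: "d \<otimes> c \<in> multipliers R p (frobenius_powers R p I) (v \<otimes> x)"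
    using multiplier_of_localized_multiplier[OF W I x multiplier] by blast
  have "v \<otimes> x \<in> saturation R W (tight_closure R p I)"
  proof (rule saturation_tight_closure_if_multiplier[OF W I _ dc_multiplier])
    show "v \<otimes> x \<in> carrier R" using mult_system_subset[OF W] v x by auto
    show "d \<otimes> c \<notin> P" if "minimal_prime R P" "P \<inter> W = {}" for P
      using prime_mult_notin[OF minimal_prime_prime[OF that(1)]] c[OF that] d multiplier that(1)
      by (auto simp: ring_circ_iff multipliers_def)
  qed
  then show ?thesis using saturation_saturation[OF W] saturationI[OF x v] by blast
qed

theorem tight_closure_commutes_with_localization:
  assumes W: "mult_system R W" and I: "ideal I R"
    and heights: "\<And>Q. primeideal Q R \<Longrightarrow> \<not> maximalideal Q R \<Longrightarrow> Q \<inter> W = {} \<Longrightarrow> height_le_one R Q"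
  shows "ext_ideal R W (tight_closure R p I) = tight_closure (localization R W) p (ext_ideal R W I)"
proof
  interpret RW: localized_char_p R W p
    by (intro localized_char_p.intro localized_ring.intro localized_ring_axioms.intro W cring_axioms prime_char_axioms)
  show "ext_ideal R W (tight_closure R p I) \<subseteq> tight_closure (localization R W) p (ext_ideal R W I)"
    by (rule RW.ext_tight_closure_subset[OF I])
  show "tight_closure (localization R W) p (ext_ideal R W I) \<subseteq> ext_ideal R W (tight_closure R p I)"
  proof
    fix a assume a: "a \<in> tight_closure (localization R W) p (ext_ideal R W I)"
    then obtain x s where x: "x \<in> carrier R" "s \<in> W" "a = RW.frac x s"
      using RW.carrier_L_cases by (auto simp: tight_closure_def)
    obtain c where "c \<in> multipliers R p (\<lambda>e. saturation R W (frobenius_powers R p I e)) x"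
      "\<And>P. minimal_prime R P \<Longrightarrow> P \<inter> W = {} \<Longrightarrow> c \<notin> P"
      using RW.frac_mem_tight_closureD[OF I x(1,2)] a x(3) by blast
    then have "x \<in> saturation R W (tight_closure R p I)"
      by (intro localized_tight_closure_subset_saturation[OF W I x(1) heights])
    then show "a \<in> ext_ideal R W (tight_closure R p I)"
      by (simp add: x(3) RW.frac_mem_ext_ideal_iff[OF tight_closure_ideal[OF I] x(1,2)])
  qed
qed

end

theorem theorem1p1:
  fixes R :: "('a, 'b) ring_scheme" and p :: nat
  assumes "cring R" and "noetherian_ring R" and "char_p R p"
    and "krull_dim R < 2
         \<or> (local_ring R \<and> krull_dim R = 2)
         \<or> (krull_dim R = 2 \<and> (nagata_ring R \<or> (\<exists>e' c. weak_test_element R p (p ^ e') c)))"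
  shows "\<forall>I W. ideal I R \<longrightarrow> mult_system R W \<longrightarrow>
           ext_ideal R W (tight_closure R p I) =
           tight_closure (localization R W) p (ext_ideal R W I)"
proof -
  interpret noetherian_char_p R p
    by (intro noetherian_char_p.intro noetherian_cring.intro prime_char.intro prime_char_axioms.intro assms(1-3))
  have "krull_dim R \<le> 2" using assms(4) by auto
  also have "(2 :: enat) < enat 3" by (simp add: numeral_eq_enat)
  finally have "\<not> prime_chain R 3" by (rule no_prime_chain_if_krull_dim_less)
  then show ?thesis
    using tight_closure_commutes_with_localization height_le_one_if_no_long_chain by blast
qed

end
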